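(* Let $n\ge 1$, $\ell\in\mathbb{N}^*$, $s_1,\dots,s_\ell\in(0,1)$ and $p_1,\dots,p_\ell\in[1,+\infty)$. If either $\Omega=\mathbb{R}^n$, or $\Omega\subset\mathbb{R}^n$ is a Lipschitz bounded open set, or $\Omega$ is an $n$-dimensional Lipschitz compact manifold with a possibly empty boundary, then $$\dot W^{s_1,p_1}(\Omega)+\dots+\dot W^{s_\ell,p_\ell}(\Omega)=\Bigl\{u:\Omega\to\mathbb{R}\ ;\ u\text{ is measurable and }\iint_{\Omega\times\Omega}\min_{1\le i\le\ell}\frac{|u(x)-u(y)|^{p_i}}{d_\Omega(x,y)^{n+s_ip_i}}\,dx\,dy<+\infty\Bigr\}.$$
   Context: $\mathbb{N}^*=\{1,2,\dots\}$. $d_\Omega(x,y)$ denotes the Euclidean distance $|x-y|$ when $\Omega\subset\mathbb{R}^n$, and the geodesic distance when $\Omega$ is a (Riemannian) manifold; integrals on a manifold are with respect to the Riemannian volume measure. A compact Lipschitz manifold (with possibly empty boundary) is understood to be covered by finitely many coordinate domains, each mapped by a bi-Lipschitz homeomorphism onto the unit ball $B(0,1)\subset\mathbb{R}^n$ or the half-ball $B(0,1)\cap(\mathbb{R}^{n-1}\times[0,+\infty))$. For $s\in(0,1)$ and $p\in[1,+\infty)$, the homogeneous fractional Sobolev space $\dot W^{s,p}(\Omega)$ is the set of measurable functions $u:\Omega\to\mathbb{R}$ such that $$|u|_{W^{s,p}(\Omega)}^p=\iint_{\Omega\times\Omega}\frac{|u(x)-u(y)|^p}{d_\Omega(x,y)^{n+sp}}\,dx\,dy<+\infty.$$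 The sum of spaces is $\dot W^{s_1,p_1}(\Omega)+\dots+\dot W^{s_\ell,p_\ell}(\Omega)=\{u_1+\dots+u_\ell\ ;\ u_i\in\dot W^{s_i,p_i}(\Omega)\text{ for each }i\in\{1,\dots,\ell\}\}$. *)

theory Defs
  imports "HOL-Analysis.Analysis"
begin

section \<open>Fractional Sobolev spaces over a measure with a distance\<close>

text \<open>
  The domain \<open>\<Omega>\<close> enters through a measure \<open>\<mu>\<close> with \<open>space \<mu> = \<Omega>\<close> and a distance
  \<open>d\<close>.  Distances take values in \<open>[0, \<infinity>]\<close> because a geodesic distance is infinite
  between different connected components; the quotient vanishes there, since
  \<open>a / top = 0\<close> for real \<open>a\<close>.  In \<^typ>\<open>ennreal\<close> also \<open>a / 0 = top\<close> for \<open>a > 0\<close> and \<open>0 / 0 = 0\<close>.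
\<close>

definition ennreal_powr :: "ennreal \<Rightarrow> real \<Rightarrow> ennreal" where
  "ennreal_powr a r = (if a = top then top else ennreal (enn2real a powr r))"

definition frac_quotient ::
  "('a \<Rightarrow> 'a \<Rightarrow> ennreal) \<Rightarrow> nat \<Rightarrow> real \<Rightarrow> real \<Rightarrow> ('a \<Rightarrow> real) \<Rightarrow> 'a \<Rightarrow> 'a \<Rightarrow> ennreal" where
  "frac_quotient d n s p u x y =
     ennreal (\<bar>u x - u y\<bar> powr p) / ennreal_powr (d x y) (real n + s * p)"

text \<open>
  Functions on \<open>\<Omega>\<close> are represented by functions on the whole type; only their values on
  \<open>space \<mu>\<close> matter, in the spaces below as well as in their sum.
\<close>

definition frac_sobolev ::
  "'a measure \<Rightarrow> ('a \<Rightarrow> 'a \<Rightarrow> ennreal) \<Rightarrow> nat \<Rightarrow> real \<Rightarrow> real \<Rightarrow> ('a \<Rightarrow> real) set" where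
  "frac_sobolev \<mu> d n s p =
     {u \<in> borel_measurable \<mu>.
        (\<integral>\<^sup>+ (x, y). frac_quotient d n s p u x y \<partial>(\<mu> \<Otimes>\<^sub>M \<mu>)) < top}"

definition frac_sobolev_sum ::
  "'a measure \<Rightarrow> ('a \<Rightarrow> 'a \<Rightarrow> ennreal) \<Rightarrow> nat \<Rightarrow> nat \<Rightarrow> (nat \<Rightarrow> real) \<Rightarrow> (nat \<Rightarrow> real)
     \<Rightarrow> ('a \<Rightarrow> real) set" where
  "frac_sobolev_sum \<mu> d n l s p =
     {u. \<exists>v. (\<forall>i\<in>{1..l}. v i \<in> frac_sobolev \<mu> d n (s i) (p i)) \<and>
             (\<forall>x\<in>space \<mu>. u x = (\<Sum>i=1..l. v i x))}"

definition frac_min_space ::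
  "'a measure \<Rightarrow> ('a \<Rightarrow> 'a \<Rightarrow> ennreal) \<Rightarrow> nat \<Rightarrow> nat \<Rightarrow> (nat \<Rightarrow> real) \<Rightarrow> (nat \<Rightarrow> real)
     \<Rightarrow> ('a \<Rightarrow> real) set" where
  "frac_min_space \<mu> d n l s p =
     {u \<in> borel_measurable \<mu>.
        (\<integral>\<^sup>+ (x, y). (MIN i\<in>{1..l}. frac_quotient d n (s i) (p i) u x y) \<partial>(\<mu> \<Otimes>\<^sub>M \<mu>)) < top}"

definition euclidean_dist :: "real ^ 'n \<Rightarrow> real ^ 'n \<Rightarrow> ennreal" where
  "euclidean_dist x y = ennreal (dist x y)"


section \<open>Lipschitz open sets\<close>

text \<open>
  Near each boundary point, \<open>\<Omega>\<close> is the strict epigraph, in some unit direction \<open>e\<close>, of a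
  Lipschitz function \<open>h\<close> on the hyperplane orthogonal to \<open>e\<close>.
\<close>

definition lipschitz_open_set :: "(real ^ 'n) set \<Rightarrow> bool" where
  "lipschitz_open_set \<Omega> \<longleftrightarrow> open \<Omega> \<and>
     (\<forall>x\<in>frontier \<Omega>. \<exists>r>0. \<exists>e. \<exists>h :: real ^ 'n \<Rightarrow> real. \<exists>L.
        norm e = 1 \<and> L-lipschitz_on {v. v \<bullet> e = 0} h \<and>
        \<Omega> \<inter> ball x r = {y \<in> ball x r. h (y - (y \<bullet> e) *\<^sub>R e) < y \<bullet> e})"


section \<open>Compact Lipschitz manifolds with a Riemannian metric\<close>

text \<open>
  A manifold is a compact set \<open>M\<close> in a Hausdorff space with charts \<open>\<phi> i\<close> on open sets \<open>U i\<close>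
  for \<open>i < m\<close>.  Transition maps being merely Lipschitz, tangent spaces exist only almost
  everywhere, and a Riemannian metric is a measurable, uniformly elliptic field of symmetric
  matrices \<open>g i\<close> in each chart, which obeys the tensor transformation law almost everywhere.
\<close>

definition chart_image :: "(real ^ 'n) set \<Rightarrow> bool" where
  "chart_image V \<longleftrightarrow> V = ball 0 1 \<or> (\<exists>k. V = ball 0 1 \<inter> {x. 0 \<le> x $ k})"

definition finite_atlas ::
  "'a::t2_space set \<Rightarrow> nat \<Rightarrow> (nat \<Rightarrow> 'a set) \<Rightarrow> (nat \<Rightarrow> 'a \<Rightarrow> real ^ 'n) \<Rightarrow> bool" where
  "finite_atlas M m U \<phi> \<longleftrightarrow>
     M = (\<Union>i<m. U i) \<and>
     (\<forall>i<m. openin (top_of_set M) (U i) \<and> chart_image (\<phi> i ` U i) \<and>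
            (\<exists>\<psi>. homeomorphism (U i) (\<phi> i ` U i) (\<phi> i) \<psi>))"

definition transition ::
  "(nat \<Rightarrow> 'a set) \<Rightarrow> (nat \<Rightarrow> 'a \<Rightarrow> real ^ 'n) \<Rightarrow> nat \<Rightarrow> nat \<Rightarrow> real ^ 'n \<Rightarrow> real ^ 'n" where
  "transition U \<phi> i j = \<phi> j \<circ> the_inv_into (U i) (\<phi> i)"

definition riemannian_metric ::
  "nat \<Rightarrow> (nat \<Rightarrow> 'a set) \<Rightarrow> (nat \<Rightarrow> 'a \<Rightarrow> real ^ 'n) \<Rightarrow> (nat \<Rightarrow> real ^ 'n \<Rightarrow> real ^ 'n ^ 'n)
     \<Rightarrow> bool" where
  "riemannian_metric m U \<phi> g \<longleftrightarrow>
     (\<forall>i<m. g i \<in> borel_measurable (restrict_space borel (\<phi> i ` U i))) \<and>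
     (\<exists>c>0. \<exists>C. \<forall>i<m. AE x in lebesgue_on (\<phi> i ` U i).
        transpose (g i x) = g i x \<and>
        (\<forall>w. c * (norm w)\<^sup>2 \<le> w \<bullet> (g i x *v w) \<and> w \<bullet> (g i x *v w) \<le> C * (norm w)\<^sup>2)) \<and>
     (\<forall>i<m. \<forall>j<m. AE x in lebesgue.
        x \<in> interior (\<phi> i ` (U i \<inter> U j)) \<longrightarrow>
        (\<forall>D. (transition U \<phi> i j has_derivative D) (at x) \<longrightarrow>
          (\<forall>w z. w \<bullet> (g i x *v z) = D w \<bullet> (g j (transition U \<phi> i j x) *v D z))))"

definition null_in_charts ::
  "nat \<Rightarrow> (nat \<Rightarrow> 'a set) \<Rightarrow> (nat \<Rightarrow> 'a \<Rightarrow> real ^ 'n) \<Rightarrow> 'a set \<Rightarrow> bool" where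
  "null_in_charts m U \<phi> N \<longleftrightarrow> (\<forall>i<m. negligible (\<phi> i ` (N \<inter> U i)))"

definition lipschitz_curve ::
  "'a::t2_space set \<Rightarrow> nat \<Rightarrow> (nat \<Rightarrow> 'a set) \<Rightarrow> (nat \<Rightarrow> 'a \<Rightarrow> real ^ 'n) \<Rightarrow> (real \<Rightarrow> 'a) \<Rightarrow> bool"
  where
  "lipschitz_curve M m U \<phi> \<gamma> \<longleftrightarrow>
     path \<gamma> \<and> path_image \<gamma> \<subseteq> M \<and>
     (\<forall>i<m. \<forall>t\<in>{0..1}. \<gamma> t \<in> U i \<longrightarrow>
        (\<exists>\<delta>>0. \<exists>L. L-lipschitz_on ({0..1} \<inter> ball t \<delta>) (\<phi> i \<circ> \<gamma>)))"

text \<open>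
  The speed \<open>\<surd>g(\<gamma>', \<gamma>')\<close> is computed in the first chart around \<open>\<gamma> t\<close>.  Outside a null set of
  the manifold the choice of the chart does not matter.
\<close>

definition riemannian_speed ::
  "nat \<Rightarrow> (nat \<Rightarrow> 'a set) \<Rightarrow> (nat \<Rightarrow> 'a \<Rightarrow> real ^ 'n) \<Rightarrow> (nat \<Rightarrow> real ^ 'n \<Rightarrow> real ^ 'n ^ 'n)
     \<Rightarrow> (real \<Rightarrow> 'a) \<Rightarrow> real \<Rightarrow> real" where
  "riemannian_speed m U \<phi> g \<gamma> t =
     (let i = (LEAST i. i < m \<and> \<gamma> t \<in> U i);
          w = vector_derivative (\<phi> i \<circ> \<gamma>) (at t)
      in sqrt (w \<bullet> (g i (\<phi> i (\<gamma> t)) *v w)))"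

definition riemannian_length ::
  "nat \<Rightarrow> (nat \<Rightarrow> 'a set) \<Rightarrow> (nat \<Rightarrow> 'a \<Rightarrow> real ^ 'n) \<Rightarrow> (nat \<Rightarrow> real ^ 'n \<Rightarrow> real ^ 'n ^ 'n)
     \<Rightarrow> (real \<Rightarrow> 'a) \<Rightarrow> ennreal" where
  "riemannian_length m U \<phi> g \<gamma> =
     (\<integral>\<^sup>+ t. ennreal (riemannian_speed m U \<phi> g \<gamma> t) \<partial>lebesgue_on {0..1})"

text \<open>
  The geodesic distance is the infimum of the lengths of the curves that join two points.
  As \<open>g\<close> is only determined almost everywhere, lengths are only meaningful for curves that
  spend no time in a given null set \<open>N\<close>; the supremum over \<open>N\<close> (De Cecco and Palmieri's
  intrinsic distance of a Lipschitz Riemannian manifold) makes the distance depend on the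
  almost everywhere class of \<open>g\<close> only.  When \<open>g\<close> is continuous on a smooth manifold, any curve
  can be approximated by curves avoiding \<open>N\<close> for almost every time, and this is the usual
  infimum of lengths.  It is \<open>top\<close> if no curve joins the points.
\<close>

definition geodesic_dist ::
  "'a::t2_space set \<Rightarrow> nat \<Rightarrow> (nat \<Rightarrow> 'a set) \<Rightarrow> (nat \<Rightarrow> 'a \<Rightarrow> real ^ 'n)
     \<Rightarrow> (nat \<Rightarrow> real ^ 'n \<Rightarrow> real ^ 'n ^ 'n) \<Rightarrow> 'a \<Rightarrow> 'a \<Rightarrow> ennreal" where
  "geodesic_dist M m U \<phi> g x y =
     (SUP N \<in> {N. N \<subseteq> M \<and> null_in_charts m U \<phi> N}.
        INF \<gamma> \<in> {\<gamma>. lipschitz_curve M m U \<phi> \<gamma> \<and> pathstart \<gamma> = x \<and> pathfinish \<gamma> = y \<and>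
                     negligible {t \<in> {0..1}. \<gamma> t \<in> N}}.
          riemannian_length m U \<phi> g \<gamma>)"

definition compact_lipschitz_manifold ::
  "'a::t2_space set \<Rightarrow> nat \<Rightarrow> (nat \<Rightarrow> 'a set) \<Rightarrow> (nat \<Rightarrow> 'a \<Rightarrow> real ^ 'n)
     \<Rightarrow> (nat \<Rightarrow> real ^ 'n \<Rightarrow> real ^ 'n ^ 'n) \<Rightarrow> bool" where
  "compact_lipschitz_manifold M m U \<phi> g \<longleftrightarrow>
     compact M \<and> finite_atlas M m U \<phi> \<and> riemannian_metric m U \<phi> g \<and>
     (\<forall>i<m. \<exists>C::real. \<forall>x\<in>U i. \<forall>y\<in>U i.
        geodesic_dist M m U \<phi> g x y \<le> ennreal C * ennreal (dist (\<phi> i x) (\<phi> i y)) \<and>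
        ennreal (dist (\<phi> i x) (\<phi> i y)) \<le> ennreal C * geodesic_dist M m U \<phi> g x y)"

text \<open>
  The Riemannian volume measure, on the sets that are Lebesgue measurable in every chart.
  The conditions determine it uniquely.
\<close>

definition riemannian_volume ::
  "'a set \<Rightarrow> nat \<Rightarrow> (nat \<Rightarrow> 'a set) \<Rightarrow> (nat \<Rightarrow> 'a \<Rightarrow> real ^ 'n)
     \<Rightarrow> (nat \<Rightarrow> real ^ 'n \<Rightarrow> real ^ 'n ^ 'n) \<Rightarrow> 'a measure \<Rightarrow> bool" where
  "riemannian_volume M m U \<phi> g \<nu> \<longleftrightarrow>
     space \<nu> = M \<and>
     sets \<nu> = {A. A \<subseteq> M \<and> (\<forall>i<m. \<phi> i ` (A \<inter> U i) \<in> sets lebesgue)} \<and>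
     (\<forall>i<m. \<forall>A\<in>sets \<nu>. A \<subseteq> U i \<longrightarrow>
        emeasure \<nu> A = (\<integral>\<^sup>+ x. ennreal (sqrt (det (g i x))) \<partial>lebesgue_on (\<phi> i ` A)))"

end

theory Submission
  imports Defs
begin

text \<open>
  The inclusion of the sum in the space on the right is elementary: if \<open>u\<close> is the sum of the
  \<open>u\<^sub>i\<close>, then \<open>\<bar>u x - u y\<bar>\<close> is at most \<open>l\<close> times the largest of the \<open>\<bar>u\<^sub>i x - u\<^sub>i y\<bar>\<close>, and the
  minimum of the quotients is at most the quotient with the index of that largest term.

  For the converse, let \<open>P\<^sub>k u\<close> be the average of \<open>u\<close> against a Lipschitz kernel \<open>K\<^sub>k\<close> that lives at
  scale \<open>2\<^sup>-\<^sup>k\<close>, for every integer \<open>k\<close>.  As both kernels have integral \<open>1\<close>,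
  \<open>P\<^sub>k\<^sub>+\<^sub>1 u x - P\<^sub>k u x\<close> is the integral of \<open>K\<^sub>k\<^sub>+\<^sub>1 x y * K\<^sub>k x z * (u y - u z)\<close> over all pairs
  \<open>(y, z)\<close>.  Each pair is now given, at each scale \<open>k\<close>, to the index \<open>i\<close> for which
  \<open>2 powr (s\<^sub>i p\<^sub>i k) * \<bar>u y - u z\<bar> powr p\<^sub>i\<close> is smallest, and \<open>u\<^sub>i\<close> collects, over all scales, the
  part of the telescoping sum that comes from the pairs given to \<open>i\<close>.  The sum over the scales of
  the energy of the pairs given to \<open>i\<close> is a geometric series that is bounded by each of the
  quotients, hence by their minimum (\<open>energy_finite\<close>).

  It remains to see that such a superposition lies in the fractional Sobolev space of a single pair
  \<open>(s, p)\<close> (\<open>superposition_in_frac_sobolev\<close>).  The difference of the kernels of \<open>u\<^sub>i\<close> at \<open>x\<close> and \<open>x'\<close> is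
  controlled by \<open>min 1 \<tau>\<close> with \<open>\<tau> = 2\<^sup>k * \<rho> x x'\<close>.  Writing \<open>min 1 \<tau> = (min 1 \<tau> * \<tau> powr - s) * \<tau> powr s\<close>,
  the first factor has a sum over \<open>k\<close> that is bounded because \<open>0 < s < 1\<close>, so that it can serve as
  the weight in one inequality between means, and the integral of \<open>min 1 \<tau> * \<tau> powr - (n + s)\<close> in \<open>x'\<close>
  completes the estimate.  The almost everywhere convergence \<open>P\<^sub>k u \<longlonglongrightarrow> u\<close> follows from the
  finiteness of the same energies.
  To make the sum over the low frequencies converge, every term is normalised to vanish at a
  suitable base point \<open>x0\<close>.

  Of the domain the argument uses a pseudometric with a measure for which balls of radius \<open>r\<close> have
  measure comparable to \<open>r\<^sup>n\<close>, unless they are the whole space.  This is clear for the Euclidean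
  space.  On a bounded Lipschitz domain it follows from an interior ball condition.  On a manifold
  the distance \<open>min d 1\<close> is used.  Charts compare small geodesic balls with Euclidean ones, once it is
  known that a geodesic ball around a point in the core of a chart stays in the chart
  (\<open>far_bound\<close>).  Replacing \<open>d\<close> by \<open>min d 1\<close> changes none of the spaces, because \<open>u\<close> is sufficiently
  integrable on a space of finite measure that is covered by finitely many small sets
  (\<open>frac_min_space_truncated_dist\<close>).
\<close>

section \<open>Dyadic sums and a power mean inequality\<close>

lemma nn_integral_geometric_int:
  assumes "0 < a"
  shows "(\<integral>\<^sup>+ k. ennreal (2 powr (- a * \<bar>real_of_int k\<bar>)) \<partial>count_space (UNIV :: int set))
           \<le> ennreal (2 / (1 - 2 powr (- a)))"
proof -
  let ?f = "\<lambda>k :: int. ennreal (2 powr (- a * \<bar>real_of_int k\<bar>))"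
  let ?q = "2 powr (- a) :: real"
  have q: "0 < ?q" "?q < 1"
    using assms by (auto simp: powr_less_one)
  have half: "(\<integral>\<^sup>+ k. ?f k * indicator A k \<partial>count_space UNIV) = ennreal (1 / (1 - ?q))"
    if "bij_betw h UNIV A" "\<And>j :: nat. \<bar>h j\<bar> = int j" for h A
  proof -
    have "(\<integral>\<^sup>+ k. ?f k * indicator A k \<partial>count_space UNIV) = (\<integral>\<^sup>+ k. ?f k \<partial>count_space A)"
      by (rule nn_integral_count_space_indicator[symmetric]) simp
    also have "\<dots> = (\<integral>\<^sup>+ j. ?f (h j) \<partial>count_space UNIV)"
      by (rule nn_integral_bij_count_space[OF that(1), symmetric])
    also have "\<dots> = (\<integral>\<^sup>+ j. ennreal (?q ^ j) \<partial>count_space UNIV)"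
    proof (rule nn_integral_cong)
      fix j :: nat
      have "\<bar>real_of_int (h j)\<bar> = real j" using that(2)[of j] by linarith
      then show "?f (h j) = ennreal (?q ^ j)"
        by (simp add: powr_realpow[symmetric] powr_powr)
    qed
    also have "\<dots> = (\<Sum>j. ennreal (?q ^ j))"
      by (rule nn_integral_count_space_nat)
    also have "\<dots> = ennreal (1 / (1 - ?q))"
      using q by (intro suminf_ennreal_eq geometric_sums) auto
    finally show ?thesis .
  qed
  have "(\<integral>\<^sup>+ k. ?f k \<partial>count_space UNIV) \<le>
          (\<integral>\<^sup>+ k. ?f k * indicator {0..} k + ?f k * indicator {..0} k \<partial>count_space UNIV)"
    by (rule nn_integral_mono) (auto simp: indicator_def)
  also have "\<dots> = (\<integral>\<^sup>+ k. ?f k * indicator {0..} k \<partial>count_space UNIV)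
                 + (\<integral>\<^sup>+ k. ?f k * indicator {..0} k \<partial>count_space UNIV)"
    by (rule nn_integral_add) auto
  also have "(\<integral>\<^sup>+ k. ?f k * indicator {0..} k \<partial>count_space UNIV) = ennreal (1 / (1 - ?q))"
    by (rule half[of int]) (auto simp: bij_betw_def inj_on_def image_def zero_le_imp_eq_int)
  also have "(\<integral>\<^sup>+ k. ?f k * indicator {..0} k \<partial>count_space UNIV) = ennreal (1 / (1 - ?q))"
    by (rule half[of "\<lambda>j. - int j"]) (auto intro!: bij_betw_byWitness[where f' = "\<lambda>k. nat (- k)"])
  also have "ennreal (1 / (1 - ?q)) + ennreal (1 / (1 - ?q)) = ennreal (2 / (1 - ?q))"
    using q by (subst ennreal_plus[symmetric]) (auto simp: add_divide_distrib[symmetric])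
  finally show ?thesis .
qed

lemma nn_integral_int_shift:
  "(\<integral>\<^sup>+ k. f (k + m) \<partial>count_space (UNIV :: int set)) = (\<integral>\<^sup>+ k. f k \<partial>count_space UNIV)"
  by (rule nn_integral_bij_count_space) (auto intro!: bij_betwI[where g = "\<lambda>k. k - m"])

lemma nn_integral_geometric_int_shift:
  assumes "0 < a"
  shows "(\<integral>\<^sup>+ k. ennreal (2 powr (- a * \<bar>real_of_int (k + m)\<bar>)) \<partial>count_space (UNIV :: int set))
           \<le> ennreal (2 / (1 - 2 powr (- a)))"
  by (subst nn_integral_int_shift[where f = "\<lambda>k. ennreal (2 powr (- a * \<bar>real_of_int k\<bar>))"])
     (rule nn_integral_geometric_int[OF assms])

lemma dyadic_bracket:
  assumes "0 < t"
  obtains m :: int where "2 powr m \<le> t" "t < 2 * 2 powr m"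
proof
  let ?m = "\<lfloor>log 2 t\<rfloor>"
  have "2 powr ?m \<le> 2 powr log 2 t" by (intro powr_mono) auto
  then show "2 powr ?m \<le> t" using assms by simp
  have "2 powr log 2 t < 2 powr (?m + 1)" by (intro powr_less_mono) linarith+
  then show "t < 2 * 2 powr ?m" using assms by (simp add: powr_add)
qed

text \<open>
  A bound for \<open>\<Sum>k. min 1 (2\<^sup>k t) * (2\<^sup>k t) powr - s\<close>: with \<open>2\<^sup>m \<le> t < 2\<^sup>m\<^sup>+\<^sup>1\<close>, the terms decay
  geometrically in \<open>\<bar>k + m\<bar>\<close>, with exponent \<open>s\<close> on one side and \<open>1 - s\<close> on the other.
\<close>

definition ramp_const :: "real \<Rightarrow> real" where
  "ramp_const s = 4 / (1 - 2 powr (- min s (1 - s)))"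

lemma ramp_const_pos: "0 < s \<Longrightarrow> s < 1 \<Longrightarrow> 0 < ramp_const s"
  by (auto simp: ramp_const_def powr_less_one)

lemma dyadic_ramp_sum:
  assumes "0 < s" "s < 1" "0 < t"
  shows "(\<integral>\<^sup>+ k. ennreal (min 1 (2 powr real_of_int k * t) * (2 powr real_of_int k * t) powr (- s)) \<partial>count_space UNIV)
           \<le> ennreal (ramp_const s)"
proof -
  obtain m :: int where m: "2 powr m \<le> t" "t < 2 * 2 powr m"
    using dyadic_bracket[OF \<open>0 < t\<close>] .
  let ?a = "min s (1 - s)"
  have a: "0 < ?a" "?a < 1" using assms by auto
  have bnd: "min 1 (2 powr k * t) * (2 powr k * t) powr (- s) \<le> 2 * 2 powr (- ?a * \<bar>real_of_int (k + m)\<bar>)"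
    (is "?L \<le> _") for k :: int
  proof -
    let ?x = "2 powr k * t"
    have x: "0 < ?x" using assms by simp
    have lo: "2 powr (k + m) \<le> ?x"
      using m by (simp add: powr_add)
    have up: "?x \<le> 2 powr (k + m + 1)"
      using m by (simp add: powr_add)
    show ?thesis
    proof (cases "0 \<le> k + m")
      case True
      have "?L \<le> 1 * ?x powr (- s)"
        by (intro mult_right_mono) auto
      also have "\<dots> \<le> (2 powr (k + m)) powr (- s)"
        using lo assms x by (simp add: powr_mono2')
      also have "\<dots> = 2 powr (- s * (k + m))"
        by (simp add: powr_powr mult.commute)
      also have "\<dots> \<le> 2 powr (- ?a * \<bar>real_of_int (k + m)\<bar>)"
      proof (rule powr_mono)
        have "?a * real_of_int (k + m) \<le> s * real_of_int (k + m)"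
          using True by (intro mult_right_mono) auto
        then show "- s * (k + m) \<le> - ?a * \<bar>real_of_int (k + m)\<bar>"
          using True by simp
      qed auto
      also have "\<dots> \<le> 2 * \<dots>" by simp
      finally show ?thesis .
    next
      case False
      have "?L \<le> ?x * ?x powr (- s)"
        by (intro mult_right_mono) auto
      also have "\<dots> = ?x powr (1 - s)"
        using x by (simp add: powr_diff powr_minus divide_simps)
      also have "\<dots> \<le> (2 powr (k + m + 1)) powr (1 - s)"
        using up assms x by (intro powr_mono2) auto
      also have "\<dots> = 2 powr (1 - s) * 2 powr ((1 - s) * real_of_int (k + m))"
        by (simp add: powr_powr powr_add[symmetric] algebra_simps)
      also have "\<dots> \<le> 2 * 2 powr (- ?a * \<bar>real_of_int (k + m)\<bar>)"
      proof (rule mult_mono)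
        show "2 powr (1 - s) \<le> (2 :: real)"
          using assms powr_mono[of "1 - s" 1 "2 :: real"] by simp
        have "(1 - s) * real_of_int (k + m) \<le> ?a * real_of_int (k + m)"
          using False by (intro mult_right_mono_neg) auto
        moreover have "\<bar>real_of_int (k + m)\<bar> = - real_of_int (k + m)"
          using False by simp
        ultimately have "(1 - s) * real_of_int (k + m) \<le> - ?a * \<bar>real_of_int (k + m)\<bar>"
          by (simp only: mult_minus_left mult_minus_right minus_minus)
        then show "2 powr ((1 - s) * real_of_int (k + m)) \<le> 2 powr (- ?a * \<bar>real_of_int (k + m)\<bar>)"
          by (rule powr_mono) simp
      qed auto
      finally show ?thesis .
    qed
  qed
  have "(\<integral>\<^sup>+ k. ennreal (min 1 (2 powr real_of_int k * t) * (2 powr real_of_int k * t) powr (- s)) \<partial>count_space UNIV)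
      \<le> (\<integral>\<^sup>+ k. ennreal 2 * ennreal (2 powr (- ?a * \<bar>real_of_int (k + m)\<bar>)) \<partial>count_space (UNIV :: int set))"
    by (intro nn_integral_mono) (use bnd in \<open>auto intro!: ennreal_leI simp: ennreal_mult[symmetric] simp del: ennreal_numeral of_int_add\<close>)
  also have "\<dots> = ennreal 2 * (\<integral>\<^sup>+ k. ennreal (2 powr (- ?a * \<bar>real_of_int (k + m)\<bar>)) \<partial>count_space (UNIV :: int set))"
    by (rule nn_integral_cmult) simp
  also have "\<dots> \<le> ennreal 2 * ennreal (2 / (1 - 2 powr (- ?a)))"
    by (intro mult_left_mono nn_integral_geometric_int_shift a) simp
  also have "\<dots> = ennreal (ramp_const s)"
    using a by (subst ennreal_mult[symmetric]) (auto simp: ramp_const_def powr_less_one less_imp_le)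
  finally show ?thesis .
qed

definition tail_const :: "real \<Rightarrow> real" where
  "tail_const a = 4 powr a * (2 / (1 - 2 powr (- a)))"

lemma tail_const_pos: "0 < a \<Longrightarrow> 0 < tail_const a"
  by (auto simp: tail_const_def powr_less_one)

lemma dyadic_tail_sum:
  assumes "0 < a" "0 < t"
  shows "(\<integral>\<^sup>+ k. ennreal (2 powr (a * real_of_int k)) * indicator {k. 2 powr real_of_int k * t < 4} k \<partial>count_space UNIV)
           \<le> ennreal (tail_const a * t powr (- a))"
proof -
  obtain m :: int where m: "2 powr m \<le> 4 / t" "4 / t < 2 * 2 powr m"
    using dyadic_bracket[of "4 / t"] \<open>0 < t\<close> by auto
  let ?b = "(4 / t) powr a"
  have bnd: "ennreal (2 powr (a * real_of_int k)) * indicator {k. 2 powr real_of_int k * t < 4} k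
      \<le> ennreal ?b * ennreal (2 powr (- a * \<bar>real_of_int (k + (- m))\<bar>))" for k :: int
  proof (cases "2 powr real_of_int k * t < 4")
    case True
    then have "2 powr k < 4 / t" using assms by (simp add: field_simps)
    with m have "2 powr real_of_int k < 2 powr real_of_int (m + 1)" by (simp add: powr_add)
    then have "k \<le> m" by (simp del: powr_mult)
    then have "2 powr (a * real_of_int k) = (2 powr m) powr a * 2 powr (- a * \<bar>real_of_int (k + (- m))\<bar>)"
      by (simp add: powr_powr powr_add[symmetric] algebra_simps)
    also have "\<dots> \<le> ?b * 2 powr (- a * \<bar>real_of_int (k + (- m))\<bar>)"
      using m assms by (intro mult_right_mono powr_mono2) auto
    finally show ?thesis using True by (simp add: ennreal_mult[symmetric])
  qed simp
  have "(\<integral>\<^sup>+ k. ennreal (2 powr (a * real_of_int k)) * indicator {k. 2 powr real_of_int k * t < 4} k \<partial>count_space UNIV)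
     \<le> (\<integral>\<^sup>+ k. ennreal ?b * ennreal (2 powr (- a * \<bar>real_of_int (k + (- m))\<bar>)) \<partial>count_space UNIV)"
    by (intro nn_integral_mono bnd)
  also have "\<dots> = ennreal ?b * (\<integral>\<^sup>+ k. ennreal (2 powr (- a * \<bar>real_of_int (k + (- m))\<bar>)) \<partial>count_space UNIV)"
    by (rule nn_integral_cmult) simp
  also have "\<dots> \<le> ennreal ?b * ennreal (2 / (1 - 2 powr (- a)))"
    by (intro mult_left_mono nn_integral_geometric_int_shift assms) simp
  also have "\<dots> = ennreal (tail_const a * t powr (- a))"
    using assms by (subst ennreal_mult[symmetric])
      (auto simp: tail_const_def powr_less_one less_imp_le powr_divide powr_minus divide_simps)
  finally show ?thesis .
qed

lemma linear_le_power_split: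
  fixes t lam p :: real
  assumes "0 \<le> t" "0 < lam" "1 \<le> p"
  shows "t \<le> lam + lam powr (1 - p) * t powr p"
proof (cases "t \<le> lam")
  case True
  then show ?thesis by (simp add: add_increasing2)
next
  case False
  then have "t = t powr (1 - p) * t powr p" using assms by (simp add: powr_add[symmetric])
  also have "\<dots> \<le> lam powr (1 - p) * t powr p"
    using False assms by (intro mult_right_mono powr_mono2') auto
  finally show ?thesis using assms by simp
qed

text \<open>
  A form of Jensen's inequality up to a constant: integrate \<open>t \<le> \<lambda> + \<lambda> powr (1 - p) * t powr p\<close> against
  the weight and choose the best \<open>\<lambda>\<close>.
\<close>

lemma nn_integral_power_mean:
  fixes w :: "'b \<Rightarrow> ennreal" and g :: "'b \<Rightarrow> real"
  assumes p: "1 \<le> p" and C: "0 < C" "(\<integral>\<^sup>+ x. w x \<partial>M) \<le> ennreal C"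
    and [measurable]: "w \<in> borel_measurable M" "g \<in> borel_measurable M"
    and g: "\<And>x. 0 \<le> g x"
    and a: "0 \<le> a" "ennreal a \<le> (\<integral>\<^sup>+ x. w x * ennreal (g x) \<partial>M)"
  shows "ennreal (a powr p) \<le> ennreal (2 powr p * C powr (p - 1)) * (\<integral>\<^sup>+ x. w x * ennreal (g x powr p) \<partial>M)"
proof (cases "(\<integral>\<^sup>+ x. w x * ennreal (g x powr p) \<partial>M) = top")
  case True
  then show ?thesis using C by (simp add: ennreal_mult_top)
next
  case False
  then obtain S where S: "0 \<le> S" "(\<integral>\<^sup>+ x. w x * ennreal (g x powr p) \<partial>M) = ennreal S"
    by (cases "\<integral>\<^sup>+ x. w x * ennreal (g x powr p) \<partial>M") auto
  have key: "a \<le> lam * C + lam powr (1 - p) * S" if "0 < lam" for lam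
  proof -
    have "ennreal a \<le> (\<integral>\<^sup>+ x. w x * ennreal (lam + lam powr (1 - p) * g x powr p) \<partial>M)"
      using a(2) by (rule order.trans)
        (intro nn_integral_mono mult_left_mono ennreal_leI linear_le_power_split g that p, simp)
    also have "\<dots> = (\<integral>\<^sup>+ x. ennreal lam * w x + ennreal (lam powr (1 - p)) * (w x * ennreal (g x powr p)) \<partial>M)"
      using that by (intro nn_integral_cong) (simp add: ennreal_plus ennreal_mult distrib_left mult_ac)
    also have "\<dots> = ennreal lam * (\<integral>\<^sup>+ x. w x \<partial>M) + ennreal (lam powr (1 - p)) * ennreal S"
      by (simp add: nn_integral_add nn_integral_cmult S)
    also have "\<dots> \<le> ennreal lam * ennreal C + ennreal (lam powr (1 - p)) * ennreal S"
      by (intro add_right_mono mult_left_mono C) simp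
    also have "\<dots> = ennreal (lam * C + lam powr (1 - p) * S)"
      using that C S by (simp add: ennreal_plus ennreal_mult)
    finally show ?thesis
      using that C S by (subst (asm) ennreal_le_iff) auto
  qed
  have "a powr p \<le> 2 powr p * C powr (p - 1) * S"
  proof (cases "S = 0")
    case True
    have "a \<le> 0"
    proof (rule ccontr)
      assume "\<not> a \<le> 0"
      then have "0 < a / (2 * C)" using C by simp
      from key[OF this] True C \<open>\<not> a \<le> 0\<close> show False by simp
    qed
    then show ?thesis using a p S C by (simp add: True)
  next
    case False
    \<comment> \<open>This \<open>\<lambda>\<close> makes the two terms of the bound equal.\<close>
    define lam where "lam = (S / C) powr (1 / p)"
    have lam: "0 < lam" "lam powr p = S / C"
      using False S C p by (auto simp: lam_def powr_powr)
    have "lam powr (1 - p) * S = lam * C"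
      using lam C False S by (simp add: powr_diff field_simps)
    with key[OF lam(1)] have "a \<le> 2 * (lam * C)" by linarith
    then have "a powr p \<le> (2 * (lam * C)) powr p"
      using a p by (intro powr_mono2) auto
    also have "\<dots> = 2 powr p * (S / C * C powr p)"
      using lam C by (simp add: powr_mult)
    also have "\<dots> = 2 powr p * C powr (p - 1) * S"
      using C by (simp add: powr_diff)
    finally show ?thesis .
  qed
  then show ?thesis
    using S C by (simp add: S ennreal_mult[symmetric])
qed

section \<open>Ahlfors regular pseudometric measure spaces\<close>

lemma nn_integral_swap_int:
  assumes "sigma_finite_measure M" and [measurable]: "\<And>k. f k \<in> borel_measurable M"
  shows "(\<integral>\<^sup>+ x. \<integral>\<^sup>+ k. f k x \<partial>count_space (UNIV :: int set) \<partial>M) = (\<integral>\<^sup>+ k. \<integral>\<^sup>+ x. f k x \<partial>M \<partial>count_space UNIV)"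
proof -
  interpret pair_sigma_finite "count_space (UNIV :: int set)" M
    using assms(1) by (intro pair_sigma_finite.intro sigma_finite_measure_count_space)
  show ?thesis
    by (rule Fubini') (auto intro: measurable_pair_measure_countable1)
qed

text \<open>
  The lower bound is not required of balls that exhaust the space.  In this form the condition can
  hold on bounded spaces for all radii at once, so that bounded and unbounded spaces are treated
  together.  Distinct points may have distance \<open>0\<close>; as balls shrink to null sets, almost no pair does.
\<close>

locale regular_metric_measure = sigma_finite_measure \<mu> for \<mu> :: "'a measure" +
  fixes \<rho> :: "'a \<Rightarrow> 'a \<Rightarrow> real" and n :: nat and c C :: real
  assumes rho_measurable_pair: "(\<lambda>(x, y). \<rho> x y) \<in> borel_measurable (\<mu> \<Otimes>\<^sub>M \<mu>)"
    and rho_nonneg: "\<And>x y. x \<in> space \<mu> \<Longrightarrow> y \<in> space \<mu> \<Longrightarrow> 0 \<le> \<rho> x y"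
    and rho_refl: "\<And>x. x \<in> space \<mu> \<Longrightarrow> \<rho> x x = 0"
    and rho_sym: "\<And>x y. x \<in> space \<mu> \<Longrightarrow> y \<in> space \<mu> \<Longrightarrow> \<rho> x y = \<rho> y x"
    and rho_triangle: "\<And>x y z. x \<in> space \<mu> \<Longrightarrow> y \<in> space \<mu> \<Longrightarrow> z \<in> space \<mu> \<Longrightarrow> \<rho> x z \<le> \<rho> x y + \<rho> y z"
    and dim_pos: "0 < n" and const_pos: "0 < c" "0 < C"
    and ball_upper: "\<And>x r. x \<in> space \<mu> \<Longrightarrow> 0 < r \<Longrightarrow>
          emeasure \<mu> {y \<in> space \<mu>. \<rho> x y < r} \<le> ennreal (C * r ^ n)"
    and ball_lower: "\<And>x r. x \<in> space \<mu> \<Longrightarrow> 0 < r \<Longrightarrow>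
          (\<forall>y\<in>space \<mu>. \<rho> x y < r) \<or> ennreal (c * r ^ n) \<le> emeasure \<mu> {y \<in> space \<mu>. \<rho> x y < r}"
begin

lemma rho_measurable [measurable (raw)]:
  "f \<in> measurable M \<mu> \<Longrightarrow> g \<in> measurable M \<mu> \<Longrightarrow> (\<lambda>w. \<rho> (f w) (g w)) \<in> borel_measurable M"
  using measurable_compose[OF measurable_Pair rho_measurable_pair, of f M g] by simp

lemma emeasure_ball_scale:
  assumes "x \<in> space \<mu>" "0 < b"
  shows "emeasure \<mu> {y \<in> space \<mu>. 2 powr real_of_int k * \<rho> x y < b} \<le> ennreal (C * b ^ n * 2 powr (- real n * k))"
proof -
  have "{y \<in> space \<mu>. 2 powr real_of_int k * \<rho> x y < b} = {y \<in> space \<mu>. \<rho> x y < b * 2 powr (- real_of_int k)}"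
    by (auto simp: powr_minus field_simps)
  moreover have "(b * 2 powr (- real_of_int k)) ^ n = b ^ n * 2 powr (- real n * k)"
    by (simp add: power_mult_distrib powr_realpow[symmetric] powr_powr mult.commute)
  ultimately show ?thesis
    using ball_upper[OF assms(1), of "b * 2 powr (- real_of_int k)"] assms by (simp add: mult.assoc)
qed

text \<open>
  The points at distance \<open>0\<close> from \<open>x\<close> lie in all balls around \<open>x\<close>, whose measures tend to \<open>0\<close>.
\<close>

lemma AE_rho_pos:
  assumes "x \<in> space \<mu>"
  shows "AE y in \<mu>. 0 < \<rho> x y"
proof (rule AE_I)
  let ?N = "{y \<in> space \<mu>. \<rho> x y \<le> 0}"
  show "{y \<in> space \<mu>. \<not> 0 < \<rho> x y} \<subseteq> ?N" by auto
  show "?N \<in> sets \<mu>" using assms by measurable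
  have "emeasure \<mu> ?N \<le> ennreal (C * r ^ n)" if "0 < r" for r
    using that assms by (intro order.trans[OF emeasure_mono ball_upper[OF assms that]]) auto
  moreover have "((\<lambda>r. ennreal (C * r ^ n)) \<longlongrightarrow> ennreal (C * 0 ^ n)) (at_right 0)"
    by (intro tendsto_intros) 
  moreover have "eventually (\<lambda>r :: real. 0 < r) (at_right 0)"
    by (simp add: eventually_at_right_less)
  ultimately have "emeasure \<mu> ?N \<le> ennreal (C * 0 ^ n)"
    by (intro tendsto_lowerbound) (auto elim!: eventually_mono)
  moreover have "C * 0 ^ n = 0" using dim_pos by simp
  ultimately show "emeasure \<mu> ?N = 0" by simp
qed

sublocale pair: pair_sigma_finite \<mu> \<mu> ..

lemma AE_pair_rho_pos: "AE z in \<mu> \<Otimes>\<^sub>M \<mu>. 0 < \<rho> (fst z) (snd z)"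
  by (rule pair.AE_pair_measure) (auto intro!: AE_I2 AE_rho_pos)

definition ramp_integral_const :: "real \<Rightarrow> real" where
  "ramp_integral_const s = 2 powr (real n + s) * C * ramp_const s"

text \<open>
  Decomposing into dyadic annuli around \<open>x\<close> turns the integral into the sum over scales above: the
  measure \<open>2\<^sup>m\<^sup>n\<close> of the annulus cancels \<open>- n\<close> in the exponent.
\<close>

lemma ramp_integral:
  assumes x: "x \<in> space \<mu>" and s: "0 < s" "s < 1"
  shows "(\<integral>\<^sup>+ y. ennreal (min 1 (2 powr real_of_int k * \<rho> x y) * (2 powr real_of_int k * \<rho> x y) powr (- (real n + s))) \<partial>\<mu>)
           \<le> ennreal (ramp_integral_const s * 2 powr (- real n * k))"
proof -
  define G where "G m = min 1 (2 powr real_of_int (k + m)) * (2 powr real_of_int (k + m - 1)) powr (- (real n + s))" for m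
  have G0: "0 \<le> G m" for m by (simp add: G_def)
  have "ennreal (min 1 (2 powr real_of_int k * \<rho> x y) * (2 powr real_of_int k * \<rho> x y) powr (- (real n + s)))
      \<le> (\<integral>\<^sup>+ m. ennreal (G m) * indicator {y \<in> space \<mu>. \<rho> x y < 2 powr real_of_int m} y \<partial>count_space UNIV)"
    if y: "y \<in> space \<mu>" for y
  proof (cases "\<rho> x y = 0")
    case False
    then have "0 < \<rho> x y" using rho_nonneg[OF x y] by simp
    then obtain m :: int where m: "2 powr m \<le> \<rho> x y" "\<rho> x y < 2 * 2 powr m"
      using dyadic_bracket by blast
    have lt: "\<rho> x y < 2 powr real_of_int (m + 1)" using m by (simp add: powr_add)
    have 1: "2 powr real_of_int k * \<rho> x y \<le> 2 powr real_of_int (k + (m + 1))"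
      using m by (simp add: powr_add)
    have 2: "2 powr real_of_int (k + (m + 1) - 1) \<le> 2 powr real_of_int k * \<rho> x y"
      using m by (simp add: powr_add)
    have "min 1 (2 powr real_of_int k * \<rho> x y) * (2 powr real_of_int k * \<rho> x y) powr (- (real n + s)) \<le> G (m + 1)"
      unfolding G_def using 1 2 s by (intro mult_mono powr_mono2') (auto intro: order.trans)
    then have "ennreal (min 1 (2 powr real_of_int k * \<rho> x y) * (2 powr real_of_int k * \<rho> x y) powr (- (real n + s)))
       \<le> ennreal (G (m + 1)) * indicator {y \<in> space \<mu>. \<rho> x y < 2 powr real_of_int (m + 1)} y"
      using lt y by (auto simp: indicator_def intro: ennreal_leI)
    also have "\<dots> \<le> (\<integral>\<^sup>+ m. ennreal (G m) * indicator {y \<in> space \<mu>. \<rho> x y < 2 powr real_of_int m} y \<partial>count_space UNIV)"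
      by (rule nn_integral_ge_point) simp
    finally show ?thesis .
  qed simp
  then have "(\<integral>\<^sup>+ y. ennreal (min 1 (2 powr real_of_int k * \<rho> x y) * (2 powr real_of_int k * \<rho> x y) powr (- (real n + s))) \<partial>\<mu>)
      \<le> (\<integral>\<^sup>+ y. \<integral>\<^sup>+ m. ennreal (G m) * indicator {y \<in> space \<mu>. \<rho> x y < 2 powr real_of_int m} y \<partial>count_space UNIV \<partial>\<mu>)"
    by (intro nn_integral_mono)
  also have "\<dots> = (\<integral>\<^sup>+ m. \<integral>\<^sup>+ y. ennreal (G m) * indicator {y \<in> space \<mu>. \<rho> x y < 2 powr real_of_int m} y \<partial>\<mu> \<partial>count_space UNIV)"
    using x by (intro nn_integral_swap_int) (auto intro: sigma_finite_measure_axioms)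
  also have "\<dots> = (\<integral>\<^sup>+ m. ennreal (G m) * emeasure \<mu> {y \<in> space \<mu>. \<rho> x y < 2 powr real_of_int m} \<partial>count_space UNIV)"
    using x by (intro nn_integral_cong nn_integral_cmult_indicator) measurable
  also have "\<dots> \<le> (\<integral>\<^sup>+ m. ennreal (2 powr (real n + s) * C * 2 powr (- real n * k)) *
        ennreal (min 1 (2 powr real_of_int m * 2 powr k) * (2 powr real_of_int m * 2 powr k) powr (- s)) \<partial>count_space UNIV)"
  proof (rule nn_integral_mono)
    fix m :: int
    have "G m * (2 powr real_of_int m) ^ n =
        min 1 (2 powr real_of_int m * 2 powr k) * 2 powr ((real n + s) + - real n * k + (m + k) * - s)"
      unfolding G_def by (simp add: powr_realpow[symmetric] powr_powr powr_add[symmetric] algebra_simps)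
    also have "\<dots> = 2 powr (real n + s) * 2 powr (- real n * k) *
        (min 1 (2 powr real_of_int m * 2 powr k) * (2 powr real_of_int m * 2 powr k) powr (- s))"
      by (simp add: powr_powr powr_add[symmetric] mult_ac) (simp add: algebra_simps)
    finally have eq: "G m * (2 powr real_of_int m) ^ n = \<dots>" .
    have "ennreal (G m) * emeasure \<mu> {y \<in> space \<mu>. \<rho> x y < 2 powr real_of_int m}
        \<le> ennreal (G m) * ennreal (C * (2 powr real_of_int m) ^ n)"
      using x by (intro mult_left_mono ball_upper) auto
    also have "\<dots> = ennreal (C * (G m * (2 powr real_of_int m) ^ n))"
      using G0 const_pos by (simp add: ennreal_mult[symmetric] mult_ac)
    also have "\<dots> = ennreal (2 powr (real n + s) * C * 2 powr (- real n * k)) *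
        ennreal (min 1 (2 powr real_of_int m * 2 powr k) * (2 powr real_of_int m * 2 powr k) powr (- s))"
      using const_pos unfolding eq by (subst ennreal_mult[symmetric]) (auto simp: mult_ac)
    finally show "ennreal (G m) * emeasure \<mu> {y \<in> space \<mu>. \<rho> x y < 2 powr real_of_int m} \<le> \<dots>" .
  qed
  also have "\<dots> = ennreal (2 powr (real n + s) * C * 2 powr (- real n * k)) *
      (\<integral>\<^sup>+ m. ennreal (min 1 (2 powr real_of_int m * 2 powr k) * (2 powr real_of_int m * 2 powr k) powr (- s)) \<partial>count_space UNIV)"
    by (rule nn_integral_cmult) simp
  also have "\<dots> \<le> ennreal (2 powr (real n + s) * C * 2 powr (- real n * k)) * ennreal (ramp_const s)"
    using s by (intro mult_left_mono dyadic_ramp_sum) auto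
  also have "\<dots> = ennreal (ramp_integral_const s * 2 powr (- real n * k))"
    using ramp_const_pos[OF s] const_pos
    by (subst ennreal_mult[symmetric]) (auto simp: ramp_integral_const_def mult_ac)
  finally show ?thesis .
qed

definition bump :: "int \<Rightarrow> 'a \<Rightarrow> 'a \<Rightarrow> real" where
  "bump k x y = max 0 (min 1 (2 - 2 * (2 powr real_of_int k * \<rho> x y)))"

definition mass :: "int \<Rightarrow> 'a \<Rightarrow> real" where
  "mass k x = (\<integral>y. bump k x y \<partial>\<mu>)"

definition kern :: "int \<Rightarrow> 'a \<Rightarrow> 'a \<Rightarrow> real" where
  "kern k x y = bump k x y / mass k x"

text \<open>
  At such a scale the whole space looks like a point.  The kernels of this and the next scale are
  then constant, and all differences of kernels vanish.  At all other scales the normalising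
  constants are bounded below.
\<close>

definition small :: "int \<Rightarrow> bool" where
  "small k \<longleftrightarrow> (\<forall>x\<in>space \<mu>. \<forall>y\<in>space \<mu>. 2 powr real_of_int k * \<rho> x y \<le> 1 / 4)"

lemma bump_bounds: "0 \<le> bump k x y" "bump k x y \<le> 1"
  by (auto simp: bump_def)

lemma bump_measurable [measurable (raw)]:
  "f \<in> measurable M \<mu> \<Longrightarrow> g \<in> measurable M \<mu> \<Longrightarrow> (\<lambda>w. bump k (f w) (g w)) \<in> borel_measurable M"
  unfolding bump_def
  by (intro borel_measurable_max borel_measurable_min borel_measurable_diff borel_measurable_times
        borel_measurable_const rho_measurable)

lemma bump_eq_0: "1 \<le> 2 powr real_of_int k * \<rho> x y \<Longrightarrow> bump k x y = 0"
  by (auto simp: bump_def)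

lemma bump_eq_1: "2 powr real_of_int k * \<rho> x y \<le> 1 / 2 \<Longrightarrow> bump k x y = 1"
  by (auto simp: bump_def)

lemma rho_diff_le:
  assumes "x \<in> space \<mu>" "x' \<in> space \<mu>" "y \<in> space \<mu>"
  shows "\<bar>\<rho> x y - \<rho> x' y\<bar> \<le> \<rho> x x'"
  using rho_triangle[of x x' y] rho_triangle[of x' x y] rho_sym[of x x'] assms by auto

lemma bump_diff_le:
  assumes "x \<in> space \<mu>" "x' \<in> space \<mu>" "y \<in> space \<mu>"
  shows "\<bar>bump k x y - bump k x' y\<bar> \<le> 2 * (2 powr real_of_int k * \<rho> x x')"
proof -
  have "\<bar>bump k x y - bump k x' y\<bar> \<le> \<bar>2 * (2 powr real_of_int k * \<rho> x y) - 2 * (2 powr real_of_int k * \<rho> x' y)\<bar>"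
    unfolding bump_def by linarith
  also have "\<dots> = 2 * (2 powr real_of_int k * \<bar>\<rho> x y - \<rho> x' y\<bar>)"
    by (simp only: right_diff_distrib[symmetric] abs_mult) simp
  also have "\<dots> \<le> 2 * (2 powr real_of_int k * \<rho> x x')"
    using rho_diff_le[OF assms] by simp
  finally show ?thesis .
qed

lemma ball_finite:
  assumes "x \<in> space \<mu>"
  shows "emeasure \<mu> {y \<in> space \<mu>. 2 powr real_of_int k * \<rho> x y < b} < top"
proof -
  have "{y \<in> space \<mu>. 2 powr real_of_int k * \<rho> x y < b} \<subseteq> {y \<in> space \<mu>. 2 powr real_of_int k * \<rho> x y < max b 1}"
    by auto
  then have "emeasure \<mu> {y \<in> space \<mu>. 2 powr real_of_int k * \<rho> x y < b} \<le> ennreal (C * max b 1 ^ n * 2 powr (- real n * k))"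
    using assms by (intro order.trans[OF emeasure_mono emeasure_ball_scale]) auto
  also have "\<dots> < top" by simp
  finally show ?thesis .
qed

lemma bump_integrable:
  assumes "x \<in> space \<mu>"
  shows "integrable \<mu> (bump k x)"
proof (rule Bochner_Integration.integrable_bound)
  have "{y \<in> space \<mu>. 2 powr real_of_int k * \<rho> x y < 1} \<in> sets \<mu>"
    using assms by measurable
  then show "integrable \<mu> (indicator {y \<in> space \<mu>. 2 powr real_of_int k * \<rho> x y < 1} :: 'a \<Rightarrow> real)"
    using ball_finite[OF assms, of k 1] by (intro integrable_real_indicator) (simp_all only: infinity_ennreal_def)
  show "AE y in \<mu>. norm (bump k x y) \<le> norm (indicator {y \<in> space \<mu>. 2 powr real_of_int k * \<rho> x y < 1} y :: real)"
  proof (rule AE_I2)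
    fix y assume y: "y \<in> space \<mu>"
    show "norm (bump k x y) \<le> norm (indicator {y \<in> space \<mu>. 2 powr real_of_int k * \<rho> x y < 1} y :: real)"
    proof (cases "2 powr real_of_int k * \<rho> x y < 1")
      case True
      then have "indicator {y \<in> space \<mu>. 2 powr real_of_int k * \<rho> x y < 1} y = (1 :: real)"
        using y by simp
      then show ?thesis using bump_bounds[of k x y] by (simp only: real_norm_def abs_of_nonneg)
    next
      case False
      then have "bump k x y = 0" by (intro bump_eq_0) linarith
      then show ?thesis by simp
    qed
  qed
  show "bump k x \<in> borel_measurable \<mu>"
    by (rule bump_measurable[OF measurable_const[OF assms] measurable_ident_sets[OF refl]])
qed

end

section \<open>Averaging kernels at dyadic scales\<close>

text \<open>
  Whether a set described by \<open>\<rho>\<close> is measurable depends on the membership of its centre in the space;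
  a simplification procedure without that information would search forever.
\<close>

declare [[simproc del: measurable]]

locale nontrivial_regular_metric_measure = regular_metric_measure +
  assumes nontrivial: "emeasure \<mu> (space \<mu>) \<noteq> 0"
begin

lemma ball_sets: "x \<in> space \<mu> \<Longrightarrow> {y \<in> space \<mu>. 2 powr real_of_int k * \<rho> x y < b} \<in> sets \<mu>"
  by measurable

lemma measure_ball_lower:
  assumes x: "x \<in> space \<mu>" and b: "0 < b"
  shows "(\<forall>y\<in>space \<mu>. 2 powr real_of_int k * \<rho> x y < b) \<or>
         c * b ^ n * 2 powr (- real n * k) \<le> measure \<mu> {y \<in> space \<mu>. 2 powr real_of_int k * \<rho> x y < b}"
proof -
  have eq: "{y \<in> space \<mu>. 2 powr real_of_int k * \<rho> x y < b} = {y \<in> space \<mu>. \<rho> x y < b * 2 powr (- real_of_int k)}"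
    by (auto simp: powr_minus field_simps)
  have pw: "(b * 2 powr (- real_of_int k)) ^ n = b ^ n * 2 powr (- real n * k)"
    by (simp add: power_mult_distrib powr_realpow[symmetric] powr_powr mult.commute)
  have "(\<forall>y\<in>space \<mu>. \<rho> x y < b * 2 powr (- real_of_int k)) \<or>
      ennreal (c * (b * 2 powr (- real_of_int k)) ^ n) \<le> emeasure \<mu> {y \<in> space \<mu>. \<rho> x y < b * 2 powr (- real_of_int k)}"
    using b by (intro ball_lower[OF x]) simp
  then show ?thesis
  proof
    assume "\<forall>y\<in>space \<mu>. \<rho> x y < b * 2 powr (- real_of_int k)"
    then show ?thesis by (auto simp: powr_minus field_simps)
  next
    assume "ennreal (c * (b * 2 powr (- real_of_int k)) ^ n) \<le> emeasure \<mu> {y \<in> space \<mu>. \<rho> x y < b * 2 powr (- real_of_int k)}"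
    also have "\<dots> = ennreal (measure \<mu> {y \<in> space \<mu>. 2 powr real_of_int k * \<rho> x y < b})"
      unfolding eq[symmetric] using ball_finite[OF x, of k b] by (intro emeasure_eq_ennreal_measure) (simp only: less_top)
    finally show ?thesis
      unfolding pw by (subst (asm) ennreal_le_iff) (simp_all add: mult.assoc)
  qed
qed

lemma measure_ball_pos:
  assumes x: "x \<in> space \<mu>" and b: "0 < b"
  shows "0 < measure \<mu> {y \<in> space \<mu>. 2 powr real_of_int k * \<rho> x y < b}"
  using measure_ball_lower[OF x b, of k]
proof
  assume "\<forall>y\<in>space \<mu>. 2 powr real_of_int k * \<rho> x y < b"
  then have eq: "{y \<in> space \<mu>. 2 powr real_of_int k * \<rho> x y < b} = space \<mu>" by blast
  with ball_finite[OF x, of k b] have "emeasure \<mu> (space \<mu>) \<noteq> top" by (simp only: less_top)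
  with nontrivial show ?thesis unfolding eq
    by (metis emeasure_eq_ennreal_measure ennreal_0 measure_nonneg order_le_less)
next
  assume "c * b ^ n * 2 powr (- real n * k) \<le> measure \<mu> {y \<in> space \<mu>. 2 powr real_of_int k * \<rho> x y < b}"
  moreover have "0 < c * b ^ n * 2 powr (- real n * k)" using const_pos b by simp
  ultimately show ?thesis by linarith
qed

lemma mass_ge:
  assumes x: "x \<in> space \<mu>" and b: "b \<le> 1 / 2"
  shows "measure \<mu> {y \<in> space \<mu>. 2 powr real_of_int k * \<rho> x y < b} \<le> mass k x"
proof -
  let ?B = "{y \<in> space \<mu>. 2 powr real_of_int k * \<rho> x y < b}"
  have int: "integrable \<mu> (indicator ?B :: 'a \<Rightarrow> real)"
    using ball_sets[OF x, of k b] ball_finite[OF x, of k b]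
    by (intro integrable_real_indicator) (simp_all only: infinity_ennreal_def)
  have "measure \<mu> ?B = (\<integral>y. indicator ?B y \<partial>\<mu>)"
    using ball_sets[OF x, of k b] by (simp only: Bochner_Integration.integral_indicator) (simp add: Int_absorb2 Collect_subset)
  also have "\<dots> \<le> mass k x"
    unfolding mass_def
  proof (rule integral_mono[OF int bump_integrable[OF x]])
    fix y
    show "indicator ?B y \<le> bump k x y"
      using bump_bounds(1)[of k x y] bump_eq_1[of k x y] b by (simp only: indicator_def) auto
  qed
  finally show ?thesis .
qed

lemma mass_pos: "x \<in> space \<mu> \<Longrightarrow> 0 < mass k x"
  using measure_ball_pos[of x "1/2" k] mass_ge[of x "1/2" k] by simp

lemma mass_measurable [measurable]: "mass k \<in> borel_measurable \<mu>"
proof -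
  have "(\<lambda>z. bump k (fst z) (snd z)) \<in> borel_measurable (\<mu> \<Otimes>\<^sub>M \<mu>)" by measurable
  then have "(\<lambda>(x, y). bump k x y) \<in> borel_measurable (\<mu> \<Otimes>\<^sub>M \<mu>)" by (simp only: split_beta')
  from borel_measurable_lebesgue_integral[OF this] show ?thesis
    unfolding mass_def .
qed

lemma kern_nonneg: "x \<in> space \<mu> \<Longrightarrow> 0 \<le> kern k x y"
  unfolding kern_def using mass_pos[of x k] bump_bounds(1)[of k x y] by simp

lemma kern_eq_0: "1 \<le> 2 powr real_of_int k * \<rho> x y \<Longrightarrow> kern k x y = 0"
  unfolding kern_def by (simp add: bump_eq_0)

lemma kern_measurable [measurable (raw)]:
  "f \<in> measurable M \<mu> \<Longrightarrow> g \<in> measurable M \<mu> \<Longrightarrow> (\<lambda>w. kern k (f w) (g w)) \<in> borel_measurable M"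
  unfolding kern_def by (intro borel_measurable_divide bump_measurable measurable_compose[OF _ mass_measurable])

lemma kern_integrable: "x \<in> space \<mu> \<Longrightarrow> integrable \<mu> (kern k x)"
  unfolding kern_def using bump_integrable[of x k] by simp

lemma kern_integral: "x \<in> space \<mu> \<Longrightarrow> (\<integral>y. kern k x y \<partial>\<mu>) = 1"
  unfolding kern_def using mass_pos[of x k] mass_def[of k x] by simp

lemma kern_small:
  assumes "small k" "x \<in> space \<mu>" "x' \<in> space \<mu>" "y \<in> space \<mu>"
  shows "kern k x y = kern k x' y" "kern (k + 1) x y = kern (k + 1) x' y"
proof -
  have 1: "bump j z w = 1" if "z \<in> space \<mu>" "w \<in> space \<mu>" "j = k \<or> j = k + 1" for j z w
  proof (rule bump_eq_1)
    have "2 powr real_of_int k * \<rho> z w \<le> 1 / 4" "0 \<le> 2 powr real_of_int k * \<rho> z w"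
      using assms(1) that rho_nonneg[of z w] by (auto simp: small_def)
    then show "2 powr real_of_int j * \<rho> z w \<le> 1 / 2"
      using that(3) by (auto simp: powr_add)
  qed
  have 2: "mass j x = mass j x'" if "j = k \<or> j = k + 1" for j
    unfolding mass_def using 1 that assms by (intro Bochner_Integration.integral_cong refl) simp
  show "kern k x y = kern k x' y" "kern (k + 1) x y = kern (k + 1) x' y"
    using 1 2 assms by (simp_all add: kern_def)
qed

abbreviation vol :: "int \<Rightarrow> real" where "vol k \<equiv> 2 powr (real n * real_of_int k)"

definition mass_const :: real where "mass_const = c * (1 / 8) ^ n"

lemma mass_const_pos: "0 < mass_const" using const_pos by (simp add: mass_const_def)

lemma mass_lower:
  assumes "\<not> small k" "x \<in> space \<mu>" "j = k \<or> j = k + 1"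
  shows "mass_const / vol k \<le> mass j x"
proof -
  let ?B = "\<lambda>b. {y \<in> space \<mu>. 2 powr real_of_int k * \<rho> x y < b}"
  have "\<not> (\<forall>y\<in>space \<mu>. 2 powr real_of_int k * \<rho> x y < 1 / 8)"
  proof
    assume *: "\<forall>y\<in>space \<mu>. 2 powr real_of_int k * \<rho> x y < 1 / 8"
    have "small k"
      unfolding small_def
    proof safe
      fix y z assume yz: "y \<in> space \<mu>" "z \<in> space \<mu>"
      have "2 powr real_of_int k * \<rho> y z \<le> 2 powr real_of_int k * (\<rho> x y + \<rho> x z)"
        using rho_triangle[of y x z] rho_sym[of x y] yz assms(2) by (intro mult_left_mono) auto
      also have "\<dots> \<le> 1 / 4"
        using bspec[OF *, OF yz(1)] bspec[OF *, OF yz(2)] by (simp add: distrib_left)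
      finally show "2 powr real_of_int k * \<rho> y z \<le> 1 / 4" .
    qed
    with assms show False by simp
  qed
  with measure_ball_lower[OF assms(2), of "1/8" k]
  have "mass_const * 2 powr (- real n * k) \<le> measure \<mu> (?B (1 / 8))"
    unfolding mass_const_def by auto
  also have "?B (1 / 8) = {y \<in> space \<mu>. 2 powr real_of_int j * \<rho> x y < (if j = k then 1 / 8 else 1 / 4)}"
    using assms(3) by (auto simp: powr_add)
  also have "measure \<mu> \<dots> \<le> mass j x"
    using assms by (intro mass_ge) auto
  finally show ?thesis by (simp add: powr_minus divide_inverse)
qed

lemma kern_upper:
  assumes "\<not> small k" "x \<in> space \<mu>" "j = k \<or> j = k + 1"
  shows "kern j x y \<le> vol k / mass_const"
proof -
  have "kern j x y \<le> 1 / mass j x"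
    unfolding kern_def using bump_bounds(2)[of j x y] mass_pos[OF assms(2), of j] by (intro divide_right_mono) auto
  also have "\<dots> \<le> 1 / (mass_const / vol k)"
    using mass_lower[OF assms] mass_pos[OF assms(2), of j] mass_const_pos by (intro divide_left_mono) auto
  finally show ?thesis by simp
qed

lemma mass_diff:
  assumes "x \<in> space \<mu>" "x' \<in> space \<mu>" "j = k \<or> j = k + 1"
  shows "\<bar>mass j x - mass j x'\<bar> \<le> 8 * C / vol k * (2 powr real_of_int k * \<rho> x x')"
proof -
  let ?t = "2 powr real_of_int k * \<rho> x x'"
  let ?B = "\<lambda>x. {y \<in> space \<mu>. 2 powr real_of_int k * \<rho> x y < 1}"
  have ind: "integrable \<mu> (indicator (?B z) :: 'a \<Rightarrow> real)" if "z \<in> space \<mu>" for z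
    using ball_sets[OF that, of k 1] ball_finite[OF that, of k 1]
    by (intro integrable_real_indicator) (simp_all only: infinity_ennreal_def)
  have meas: "measure \<mu> (?B z) \<le> C / vol k" if "z \<in> space \<mu>" for z
  proof -
    have "ennreal (measure \<mu> (?B z)) = emeasure \<mu> (?B z)"
      using ball_finite[OF that, of k 1] by (intro emeasure_eq_ennreal_measure[symmetric]) (simp only: less_top)
    also have "\<dots> \<le> ennreal (C / vol k)"
      using emeasure_ball_scale[OF that, of 1 k] by (simp add: powr_minus divide_inverse)
    finally show ?thesis using const_pos by (subst (asm) ennreal_le_iff) auto
  qed
  have t: "0 \<le> ?t" using rho_nonneg[OF assms(1,2)] by simp
  have "\<bar>mass j x - mass j x'\<bar> = \<bar>\<integral>y. bump j x y - bump j x' y \<partial>\<mu>\<bar>"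
    unfolding mass_def by (subst Bochner_Integration.integral_diff) (auto intro: bump_integrable assms)
  also have "\<dots> \<le> (\<integral>y. \<bar>bump j x y - bump j x' y\<bar> \<partial>\<mu>)"
    by (rule integral_abs_bound)
  also have "\<dots> \<le> (\<integral>y. 4 * ?t * (indicator (?B x) y + indicator (?B x') y) \<partial>\<mu>)"
  proof (rule integral_mono)
    show "integrable \<mu> (\<lambda>y. \<bar>bump j x y - bump j x' y\<bar>)"
      by (intro integrable_abs Bochner_Integration.integrable_diff bump_integrable assms)
    show "integrable \<mu> (\<lambda>y. 4 * ?t * (indicator (?B x) y + indicator (?B x') y))"
      by (intro integrable_mult_right Bochner_Integration.integrable_add ind assms)
    fix y assume y: "y \<in> space \<mu>"
    have pj: "2 powr real_of_int k \<le> 2 powr real_of_int j" "2 powr real_of_int j \<le> 2 * 2 powr real_of_int k"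
      using assms(3) by (auto simp: powr_add)
    show "\<bar>bump j x y - bump j x' y\<bar> \<le> 4 * ?t * (indicator (?B x) y + indicator (?B x') y)"
    proof (cases "y \<in> ?B x \<or> y \<in> ?B x'")
      case True
      have "\<bar>bump j x y - bump j x' y\<bar> \<le> 2 * (2 powr real_of_int j * \<rho> x x')"
        by (rule bump_diff_le[OF assms(1,2) y])
      also have "\<dots> \<le> 4 * ?t * 1"
        using mult_right_mono[OF pj(2) rho_nonneg[OF assms(1,2)]] by (simp add: mult_ac)
      also have "\<dots> \<le> 4 * ?t * (indicator (?B x) y + indicator (?B x') y)"
        using True t by (intro mult_left_mono) (auto simp: indicator_def)
      finally show ?thesis .
    next
      case False
      have "1 \<le> 2 powr real_of_int j * \<rho> z y" if "z \<in> space \<mu>" "y \<notin> ?B z" for z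
        using that y order.trans[OF _ mult_right_mono[OF pj(1) rho_nonneg[of z y]]] by fastforce
      with False assms have "bump j x y = 0" "bump j x' y = 0"
        by (auto intro!: bump_eq_0)
      then show ?thesis using t by simp
    qed
  qed
  also have "\<dots> = 4 * ?t * (measure \<mu> (?B x) + measure \<mu> (?B x'))"
    by (subst integral_mult_right_zero, subst Bochner_Integration.integral_add)
       (use ind assms in \<open>auto simp: Int_absorb2 Collect_subset\<close>)
  also have "\<dots> \<le> 4 * ?t * (C / vol k + C / vol k)"
    using t meas assms by (intro mult_left_mono add_mono) auto
  finally show ?thesis by (simp add: mult_ac)
qed

definition lip_const :: real where "lip_const = 4 / mass_const + 8 * C / mass_const\<^sup>2"

lemma lip_const_pos: "0 < lip_const" using mass_const_pos const_pos by (simp add: lip_const_def add_pos_pos)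

text \<open>
  The Lipschitz constant has two sources: the profile of the kernel and its normalisation.
\<close>

lemma kern_lipschitz:
  assumes "\<not> small k" "x \<in> space \<mu>" "x' \<in> space \<mu>" "y \<in> space \<mu>" "j = k \<or> j = k + 1"
  shows "\<bar>kern j x y - kern j x' y\<bar> \<le> lip_const * vol k * (2 powr real_of_int k * \<rho> x x')"
proof -
  let ?t = "2 powr real_of_int k * \<rho> x x'"
  let ?b = "bump j x y" and ?b' = "bump j x' y" and ?m = "mass j x" and ?m' = "mass j x'"
  have t: "0 \<le> ?t" using rho_nonneg[OF assms(2,3)] by simp
  have m: "0 < ?m" "0 < ?m'" using mass_pos assms by auto
  have inv: "1 / ?m \<le> vol k / mass_const" "1 / ?m' \<le> vol k / mass_const"
  proof -
    have "1 / mass j z \<le> 1 / (mass_const / vol k)" if "z \<in> space \<mu>" for z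
      using mass_lower[OF assms(1) that assms(5)] mass_pos[OF that, of j] mass_const_pos by (intro divide_left_mono) auto
    then show "1 / ?m \<le> vol k / mass_const" "1 / ?m' \<le> vol k / mass_const" using assms by auto
  qed
  have "kern j x y - kern j x' y = (?b - ?b') * (1 / ?m) + ?b' * ((?m' - ?m) * (1 / ?m) * (1 / ?m'))"
    using m by (simp add: kern_def field_simps)
  then have "\<bar>kern j x y - kern j x' y\<bar> \<le> \<bar>?b - ?b'\<bar> * (1 / ?m) + ?b' * (\<bar>?m - ?m'\<bar> * (1 / ?m) * (1 / ?m'))"
    using m bump_bounds(1)[of j x' y]
    by (auto simp: abs_mult intro!: order.trans[OF abs_triangle_ineq] simp: abs_minus_commute)
  also have "\<dots> \<le> (4 * ?t) * (vol k / mass_const) + 1 * ((8 * C / vol k * ?t) * (vol k / mass_const) * (vol k / mass_const))"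
  proof (intro add_mono mult_mono inv)
    have "2 powr real_of_int j \<le> 2 * 2 powr real_of_int k"
      using assms(5) by (auto simp: powr_add)
    from mult_right_mono[OF this rho_nonneg[OF assms(2,3)]] bump_diff_le[OF assms(2-4), of j]
    show "\<bar>?b - ?b'\<bar> \<le> 4 * ?t" by simp
    show "\<bar>?m - ?m'\<bar> \<le> 8 * C / vol k * ?t"
      by (rule mass_diff[OF assms(2,3,5)])
    show "?b' \<le> 1" by (rule bump_bounds)
  qed (use t m mass_const_pos const_pos bump_bounds(1)[of j x' y] in auto)
  also have "\<dots> = lip_const * vol k * ?t"
    using mass_const_pos by (simp add: lip_const_def field_simps power2_eq_square)
  finally show ?thesis .
qed

text \<open>
  The window of \<open>x\<close> at scale \<open>k\<close> is wider by a factor two than the support of the kernel, so that it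
  still contains that support after a small displacement of \<open>x\<close>.
\<close>

definition win :: "int \<Rightarrow> 'a \<Rightarrow> 'a \<times> 'a \<Rightarrow> real" where
  "win k x yz = (if 2 powr real_of_int k * \<rho> x (fst yz) < 2 \<and> 2 powr real_of_int k * \<rho> x (snd yz) < 2 then 1 else 0)"

definition kern_prod :: "int \<Rightarrow> 'a \<Rightarrow> 'a \<times> 'a \<Rightarrow> real" where
  "kern_prod k x yz = kern (k + 1) x (fst yz) * kern k x (snd yz)"

text \<open>
  A common constant for the trivial bound and the Lipschitz bound of \<open>kern_prod\<close>.
\<close>

definition kap_const :: real where "kap_const = 2 * lip_const / mass_const + 1 / mass_const\<^sup>2"

definition ramp_win :: "int \<Rightarrow> 'a \<Rightarrow> 'a \<Rightarrow> 'a \<times> 'a \<Rightarrow> real" where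
  "ramp_win k x x' yz = min 1 (2 powr real_of_int k * \<rho> x x') * (vol k)\<^sup>2 * (win k x yz + win k x' yz)"

lemma kap_const_pos: "0 < kap_const" using lip_const_pos mass_const_pos by (simp add: kap_const_def add_pos_pos)

lemma win_nonneg: "0 \<le> win k x yz" by (simp add: win_def)

lemma ramp_win_nonneg: "x \<in> space \<mu> \<Longrightarrow> x' \<in> space \<mu> \<Longrightarrow> 0 \<le> ramp_win k x x' yz"
  using rho_nonneg[of x x'] by (simp add: ramp_win_def win_nonneg)

lemma kern_prod_diff:
  assumes x: "x \<in> space \<mu>" "x' \<in> space \<mu>" and yz: "yz \<in> space (\<mu> \<Otimes>\<^sub>M \<mu>)"
  shows "\<bar>kern_prod k x yz - kern_prod k x' yz\<bar> \<le> kap_const * ramp_win k x x' yz"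
proof -
  obtain y z where yz': "yz = (y, z)" "y \<in> space \<mu>" "z \<in> space \<mu>"
    using yz by (auto simp: space_pair_measure)
  let ?t = "2 powr real_of_int k * \<rho> x x'"
  have t: "0 \<le> ?t" using rho_nonneg[OF x] by simp
  show ?thesis
  proof (cases "small k")
    case True
    then have "kern_prod k x yz = kern_prod k x' yz"
      using kern_small[OF True x yz'(2)] kern_small[OF True x yz'(3)] by (simp add: kern_prod_def yz')
    then show ?thesis using kap_const_pos ramp_win_nonneg[OF x, of k yz] by simp
  next
    case False
    let ?D = "vol k / mass_const"
    have D: "0 < ?D" using mass_const_pos by simp
    have kb: "0 \<le> kern j w v \<and> kern j w v \<le> ?D" if "w = x \<or> w = x'" "j = k \<or> j = k + 1" for j w v
      using kern_nonneg[of w j v] kern_upper[OF False, of w j v] that x by auto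
    have kz: "kern_prod k w yz = 0" if "w = x \<or> w = x'" "win k w yz = 0" for w
    proof -
      have "1 \<le> 2 powr real_of_int (k + 1) * \<rho> w y \<or> 1 \<le> 2 powr real_of_int k * \<rho> w z"
        using that(2) by (auto simp: win_def yz' powr_add split: if_splits)
      then show ?thesis by (auto simp: kern_prod_def yz' kern_eq_0)
    qed
    have kb': "0 \<le> kern_prod k w yz \<and> kern_prod k w yz \<le> ?D * ?D" if "w = x \<or> w = x'" for w
    proof -
      have "0 \<le> kern (k + 1) w (fst yz)" "kern (k + 1) w (fst yz) \<le> ?D"
        "0 \<le> kern k w (snd yz)" "kern k w (snd yz) \<le> ?D"
        using kb[OF that, of "k + 1" "fst yz"] kb[OF that, of k "snd yz"] by auto
      then show ?thesis unfolding kern_prod_def by (intro conjI mult_nonneg_nonneg mult_mono) auto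
    qed
    have le1: "\<bar>kern_prod k x yz - kern_prod k x' yz\<bar> \<le> kap_const * (vol k)\<^sup>2 * 1"
    proof -
      have "\<bar>kern_prod k x yz - kern_prod k x' yz\<bar> \<le> ?D * ?D"
        using kb'[of x] kb'[of x'] by auto
      also have "\<dots> = (1 / mass_const\<^sup>2) * (vol k)\<^sup>2" by (simp add: power2_eq_square)
      also have "\<dots> \<le> kap_const * (vol k)\<^sup>2"
        using lip_const_pos mass_const_pos by (intro mult_right_mono) (auto simp: kap_const_def)
      finally show ?thesis by simp
    qed
    have le2: "\<bar>kern_prod k x yz - kern_prod k x' yz\<bar> \<le> kap_const * (vol k)\<^sup>2 * ?t"
    proof -
      have "kern_prod k x yz - kern_prod k x' yz = (kern (k + 1) x y - kern (k + 1) x' y) * kern k x z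
          + kern (k + 1) x' y * (kern k x z - kern k x' z)"
        by (simp add: kern_prod_def yz' algebra_simps)
      then have "\<bar>kern_prod k x yz - kern_prod k x' yz\<bar> \<le> \<bar>kern (k + 1) x y - kern (k + 1) x' y\<bar> * kern k x z
          + kern (k + 1) x' y * \<bar>kern k x z - kern k x' z\<bar>"
        using kb[of x k z] kb[of x' "k + 1" y]
        by (auto simp: abs_mult intro!: order.trans[OF abs_triangle_ineq])
      also have "\<dots> \<le> (lip_const * vol k * ?t) * ?D + ?D * (lip_const * vol k * ?t)"
        using kb[of x k z] kb[of x' "k + 1" y] D
        by (intro add_mono mult_mono kern_lipschitz False x yz') (auto simp: t lip_const_pos less_imp_le)
      also have "\<dots> = (2 * lip_const / mass_const) * (vol k)\<^sup>2 * ?t"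
        using mass_const_pos by (simp add: power2_eq_square field_simps)
      also have "\<dots> \<le> kap_const * (vol k)\<^sup>2 * ?t"
        using mass_const_pos t by (intro mult_right_mono) (auto simp: kap_const_def)
      finally show ?thesis .
    qed
    show ?thesis
    proof (cases "win k x yz = 0 \<and> win k x' yz = 0")
      case True
      then show ?thesis using kz by (simp add: ramp_win_def)
    next
      case False
      then have w: "1 \<le> win k x yz + win k x' yz" by (auto simp: win_def split: if_splits)
      have "\<bar>kern_prod k x yz - kern_prod k x' yz\<bar> \<le> kap_const * (vol k)\<^sup>2 * min 1 ?t"
        using le1 le2 by (simp add: min_def)
      also have "\<dots> \<le> kap_const * (vol k)\<^sup>2 * min 1 ?t * (win k x yz + win k x' yz)"
        using mult_left_mono[OF w, of "kap_const * (vol k)\<^sup>2 * min 1 ?t"] kap_const_pos t by simp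
      finally show ?thesis by (simp add: ramp_win_def mult_ac)
    qed
  qed
qed

text \<open>
  The analogue of \<open>kern_prod_diff\<close> for a mixed product; it serves to show that averages over large balls
  around two points become equal.
\<close>

lemma kern_diff_prod:
  assumes x: "x \<in> space \<mu>" "x' \<in> space \<mu>" and yz: "yz \<in> space (\<mu> \<Otimes>\<^sub>M \<mu>)"
    and t1: "2 powr real_of_int k * \<rho> x x' < 1"
  shows "\<bar>(kern k x (fst yz) - kern k x' (fst yz)) * kern k x' (snd yz)\<bar> \<le> kap_const * ramp_win k x x' yz"
proof -
  obtain y z where yz': "yz = (y, z)" "y \<in> space \<mu>" "z \<in> space \<mu>"
    using yz by (auto simp: space_pair_measure)
  let ?t = "2 powr real_of_int k * \<rho> x x'"
  have t: "0 \<le> ?t" using rho_nonneg[OF x] by simp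
  show ?thesis
  proof (cases "small k \<or> win k x' yz = 0")
    case True
    have "(kern k x y - kern k x' y) * kern k x' z = 0"
    proof (cases "small k")
      case True
      then show ?thesis using kern_small[OF True x yz'(2)] by simp
    next
      case False
      then have "2 \<le> 2 powr real_of_int k * \<rho> x' y \<or> 1 \<le> 2 powr real_of_int k * \<rho> x' z"
        using True by (auto simp: win_def yz' split: if_splits)
      moreover have "kern k x y = 0 \<and> kern k x' y = 0" if "2 \<le> 2 powr real_of_int k * \<rho> x' y"
      proof -
        have "2 powr real_of_int k * \<rho> x' y \<le> 2 powr real_of_int k * (\<rho> x x' + \<rho> x y)"
          using rho_triangle[of x' x y] rho_sym[of x x'] x yz' by (intro mult_left_mono) auto
        then have "1 \<le> 2 powr real_of_int k * \<rho> x y" using that t1 by (simp add: distrib_left)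
        then show ?thesis using that by (auto intro!: kern_eq_0)
      qed
      ultimately show ?thesis by (auto simp: kern_eq_0)
    qed
    then show ?thesis using kap_const_pos ramp_win_nonneg[OF x, of k yz] by (simp only: yz' fst_conv snd_conv) simp
  next
    case False
    then have w: "1 \<le> win k x yz + win k x' yz" by (auto simp: win_def split: if_splits)
    have "\<bar>(kern k x y - kern k x' y) * kern k x' z\<bar> \<le> (lip_const * vol k * ?t) * (vol k / mass_const)"
      unfolding abs_mult
      using False kern_nonneg[OF x(2), of k z] kern_upper[OF _ x(2), of k k z] t lip_const_pos
      by (intro mult_mono kern_lipschitz x yz') auto
    also have "\<dots> = (lip_const / mass_const) * (vol k)\<^sup>2 * ?t"
      by (simp add: power2_eq_square)
    also have "\<dots> \<le> kap_const * (vol k)\<^sup>2 * ?t"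
      using mass_const_pos t lip_const_pos by (intro mult_right_mono) (auto simp: kap_const_def field_simps)
    also have "\<dots> \<le> kap_const * (vol k)\<^sup>2 * ?t * (win k x yz + win k x' yz)"
      using mult_left_mono[OF w, of "kap_const * (vol k)\<^sup>2 * ?t"] kap_const_pos t by simp
    also have "?t = min 1 ?t" using t1 by simp
    finally show ?thesis by (simp add: ramp_win_def yz' mult_ac)
  qed
qed

lemma win_measurable [measurable (raw)]:
  assumes f: "f \<in> measurable M \<mu>" and g: "g \<in> measurable M (\<mu> \<Otimes>\<^sub>M \<mu>)"
  shows "(\<lambda>w. win k (f w) (g w)) \<in> borel_measurable M"
proof -
  have [measurable]: "(\<lambda>w. \<rho> (f w) (fst (g w))) \<in> borel_measurable M" "(\<lambda>w. \<rho> (f w) (snd (g w))) \<in> borel_measurable M"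
    using f g by (auto intro!: rho_measurable measurable_compose[OF g measurable_fst] measurable_compose[OF g measurable_snd])
  show ?thesis unfolding win_def by measurable
qed

lemma kern_prod_measurable [measurable (raw)]:
  assumes f: "f \<in> measurable M \<mu>" and g: "g \<in> measurable M (\<mu> \<Otimes>\<^sub>M \<mu>)"
  shows "(\<lambda>w. kern_prod k (f w) (g w)) \<in> borel_measurable M"
  unfolding kern_prod_def
  by (intro borel_measurable_times kern_measurable f measurable_compose[OF g measurable_fst] measurable_compose[OF g measurable_snd])

lemma ramp_win_measurable [measurable (raw)]:
  assumes "f \<in> measurable M \<mu>" "f' \<in> measurable M \<mu>" "g \<in> measurable M (\<mu> \<Otimes>\<^sub>M \<mu>)"
  shows "(\<lambda>w. ramp_win k (f w) (f' w) (g w)) \<in> borel_measurable M"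
  unfolding ramp_win_def using assms
  by (intro borel_measurable_times borel_measurable_min borel_measurable_add borel_measurable_const
        borel_measurable_power rho_measurable win_measurable)

end

section \<open>Oscillation and energy\<close>

lemma nn_integral_cmult_add:
  fixes f g :: "'b \<Rightarrow> ennreal"
  assumes [measurable]: "f \<in> borel_measurable M" "g \<in> borel_measurable M"
  shows "(\<integral>\<^sup>+ x. a * (f x + g x) \<partial>M) = a * ((\<integral>\<^sup>+ x. f x \<partial>M) + (\<integral>\<^sup>+ x. g x \<partial>M))"
  by (subst nn_integral_cmult, measurable) (simp add: nn_integral_add assms)

context nontrivial_regular_metric_measure
begin

abbreviation PP :: "('a \<times> 'a) measure" where "PP \<equiv> \<mu> \<Otimes>\<^sub>M \<mu>"

lemma sigma_finite_PP: "sigma_finite_measure PP"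
  using pair.P.sigma_finite_measure_axioms .

text \<open>
  The family \<open>F\<close> assigns to each scale \<open>k\<close> a function on pairs of points.  Only pairs at distance less
  than \<open>4 * 2 powr - k\<close> can share a window at that scale.
\<close>

definition energy :: "real \<Rightarrow> real \<Rightarrow> (int \<Rightarrow> 'a \<times> 'a \<Rightarrow> real) \<Rightarrow> ennreal" where
  "energy s p F = (\<integral>\<^sup>+ k. \<integral>\<^sup>+ yz. ennreal (2 powr ((real n + s * p) * real_of_int k) * \<bar>F k yz\<bar> powr p) *
      indicator {yz. 2 powr real_of_int k * \<rho> (fst yz) (snd yz) < 4} yz \<partial>PP \<partial>count_space UNIV)"

definition win_const :: real where "win_const = 2 * (C * 2 ^ n)\<^sup>2"

lemma win_const_pos: "0 < win_const" using const_pos by (simp add: win_const_def)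

lemma win_integral:
  assumes x: "x \<in> space \<mu>"
  shows "(\<integral>\<^sup>+ yz. ennreal (win k x yz) \<partial>PP) \<le> ennreal ((C * 2 ^ n / vol k)\<^sup>2)"
proof -
  let ?B = "{y \<in> space \<mu>. 2 powr real_of_int k * \<rho> x y < 2}"
  have "(\<integral>\<^sup>+ yz. ennreal (win k x yz) \<partial>PP) = (\<integral>\<^sup>+ yz. indicator (?B \<times> ?B) yz \<partial>PP)"
    by (intro nn_integral_cong) (auto simp: win_def indicator_def space_pair_measure)
  also have "\<dots> = emeasure PP (?B \<times> ?B)"
    using ball_sets[OF x] by (intro nn_integral_indicator pair_measureI) auto
  also have "\<dots> = emeasure \<mu> ?B * emeasure \<mu> ?B"
    using ball_sets[OF x] by (intro emeasure_pair_measure_Times) auto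
  also have "\<dots> \<le> ennreal (C * 2 ^ n / vol k) * ennreal (C * 2 ^ n / vol k)"
    using emeasure_ball_scale[OF x, of 2 k]
    by (intro mult_mono) (auto simp: powr_minus divide_inverse)
  also have "\<dots> = ennreal ((C * 2 ^ n / vol k)\<^sup>2)"
    using const_pos by (subst ennreal_mult[symmetric]) (auto simp: power2_eq_square)
  finally show ?thesis .
qed

lemma win_sum_integral:
  assumes x: "x \<in> space \<mu>" "x' \<in> space \<mu>"
  shows "(\<integral>\<^sup>+ yz. ennreal ((vol k)\<^sup>2 * (win k x yz + win k x' yz)) \<partial>PP) \<le> ennreal win_const"
proof -
  have [measurable]: "win k z \<in> borel_measurable PP" if "z \<in> space \<mu>" for z
    by (rule win_measurable[OF measurable_const[OF that] measurable_ident_sets[OF refl]])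
  have "(\<integral>\<^sup>+ yz. ennreal ((vol k)\<^sup>2 * (win k x yz + win k x' yz)) \<partial>PP)
      = (\<integral>\<^sup>+ yz. ennreal ((vol k)\<^sup>2) * (ennreal (win k x yz) + ennreal (win k x' yz)) \<partial>PP)"
    by (intro nn_integral_cong) (simp add: ennreal_mult win_nonneg)
  also have "\<dots> = ennreal ((vol k)\<^sup>2) * ((\<integral>\<^sup>+ yz. ennreal (win k x yz) \<partial>PP) + (\<integral>\<^sup>+ yz. ennreal (win k x' yz) \<partial>PP))"
  proof -
    have "(\<lambda>yz. ennreal (win k x yz)) \<in> borel_measurable PP" "(\<lambda>yz. ennreal (win k x' yz)) \<in> borel_measurable PP"
      using x by measurable
    then show ?thesis by (rule nn_integral_cmult_add)
  qed
  also have "\<dots> \<le> ennreal ((vol k)\<^sup>2) * (ennreal ((C * 2 ^ n / vol k)\<^sup>2) + ennreal ((C * 2 ^ n / vol k)\<^sup>2))"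
    by (intro mult_left_mono add_mono win_integral x) simp
  also have "\<dots> = ennreal win_const"
    by (simp add: ennreal_plus[symmetric] ennreal_mult[symmetric] win_const_def power_divide del: ennreal_plus)
  finally show ?thesis .
qed

text \<open>
  The factor \<open>min 1 \<tau> * \<tau> powr - s\<close> makes this a finite measure on scales and pairs, uniformly in \<open>x\<close>
  and \<open>x'\<close>; the remaining \<open>\<tau> powr s\<close> is put on the integrand.
\<close>

definition weight :: "real \<Rightarrow> 'a \<Rightarrow> 'a \<Rightarrow> int \<times> 'a \<times> 'a \<Rightarrow> ennreal" where
  "weight s x x' = (\<lambda>(k, yz). ennreal (ramp_win k x x' yz * (2 powr real_of_int k * \<rho> x x') powr (- s)))"

abbreviation K3 :: "(int \<times> 'a \<times> 'a) measure" where "K3 \<equiv> count_space UNIV \<Otimes>\<^sub>M PP"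

lemma measurable_K3: "(\<And>k. (\<lambda>yz. f (k, yz)) \<in> measurable PP N) \<Longrightarrow> f \<in> measurable K3 N"
  by (rule measurable_pair_measure_countable1) auto

lemma nn_integral_K3:
  assumes "f \<in> borel_measurable K3"
  shows "(\<integral>\<^sup>+ w. f w \<partial>K3) = (\<integral>\<^sup>+ k. \<integral>\<^sup>+ yz. f (k, yz) \<partial>PP \<partial>count_space UNIV)"
  using sigma_finite_measure.nn_integral_fst[OF sigma_finite_PP assms] by simp

lemma ramp_win_measurable1: "x \<in> space \<mu> \<Longrightarrow> x' \<in> space \<mu> \<Longrightarrow> ramp_win k x x' \<in> borel_measurable PP"
  by (rule ramp_win_measurable[OF measurable_const measurable_const measurable_ident_sets[OF refl]])

lemma weight_measurable:
  assumes x: "x \<in> space \<mu>" "x' \<in> space \<mu>"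
  shows "weight s x x' \<in> borel_measurable K3"
  unfolding weight_def
  by (rule measurable_K3) (use ramp_win_measurable1[OF x] in \<open>simp only: prod.case, measurable\<close>)

lemma weight_integral:
  assumes x: "x \<in> space \<mu>" "x' \<in> space \<mu>" and pos: "0 < \<rho> x x'" and s: "0 < s" "s < 1"
  shows "(\<integral>\<^sup>+ w. weight s x x' w \<partial>K3) \<le> ennreal (ramp_const s * win_const)"
proof -
  let ?t = "\<lambda>k. 2 powr real_of_int k * \<rho> x x'"
  have [measurable]: "win k z \<in> borel_measurable PP" if "z \<in> space \<mu>" for z k
    by (rule win_measurable[OF measurable_const[OF that] measurable_ident_sets[OF refl]])
  have "(\<integral>\<^sup>+ w. weight s x x' w \<partial>K3) = (\<integral>\<^sup>+ k. \<integral>\<^sup>+ yz. weight s x x' (k, yz) \<partial>PP \<partial>count_space UNIV)"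
    by (rule nn_integral_K3[OF weight_measurable[OF x]])
  also have "\<dots> = (\<integral>\<^sup>+ k. \<integral>\<^sup>+ yz. ennreal (min 1 (?t k) * ?t k powr (- s)) *
        ennreal ((vol k)\<^sup>2 * (win k x yz + win k x' yz)) \<partial>PP \<partial>count_space UNIV)"
    using pos by (intro nn_integral_cong) (simp add: weight_def ramp_win_def ennreal_mult[symmetric] win_nonneg mult_ac)
  also have "\<dots> = (\<integral>\<^sup>+ k. ennreal (min 1 (?t k) * ?t k powr (- s)) *
        (\<integral>\<^sup>+ yz. ennreal ((vol k)\<^sup>2 * (win k x yz + win k x' yz)) \<partial>PP) \<partial>count_space UNIV)"
    using x by (intro nn_integral_cong nn_integral_cmult) measurable
  also have "\<dots> \<le> (\<integral>\<^sup>+ k. ennreal (min 1 (?t k) * ?t k powr (- s)) * ennreal win_const \<partial>count_space UNIV)"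
    by (intro nn_integral_mono mult_left_mono win_sum_integral x) simp
  also have "\<dots> = (\<integral>\<^sup>+ k. ennreal (min 1 (?t k) * ?t k powr (- s)) \<partial>count_space UNIV) * ennreal win_const"
    by (rule nn_integral_multc) simp
  also have "\<dots> \<le> ennreal (ramp_const s) * ennreal win_const"
    by (intro mult_right_mono dyadic_ramp_sum s pos) simp
  also have "\<dots> = ennreal (ramp_const s * win_const)"
    using ramp_const_pos[OF s] win_const_pos by (simp add: ennreal_mult)
  finally show ?thesis .
qed

text \<open>
  This dominates the difference at \<open>x\<close> and \<open>x'\<close> of every superposition of kernels with density \<open>F\<close>.
\<close>

definition osc :: "(int \<Rightarrow> 'a \<times> 'a \<Rightarrow> real) \<Rightarrow> 'a \<Rightarrow> 'a \<Rightarrow> ennreal" where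
  "osc F x x' = (\<integral>\<^sup>+ w. ennreal (ramp_win (fst w) x x' (snd w) * \<bar>F (fst w) (snd w)\<bar>) \<partial>K3)"

definition pow_osc :: "real \<Rightarrow> real \<Rightarrow> (int \<Rightarrow> 'a \<times> 'a \<Rightarrow> real) \<Rightarrow> 'a \<Rightarrow> 'a \<Rightarrow> ennreal" where
  "pow_osc s p F x x' = (\<integral>\<^sup>+ w. weight s x x' w *
      ennreal (((2 powr real_of_int (fst w) * \<rho> x x') powr s * \<bar>F (fst w) (snd w)\<bar>) powr p) \<partial>K3)"

lemma osc_eq_weight:
  assumes x: "x \<in> space \<mu>" "x' \<in> space \<mu>" and pos: "0 < \<rho> x x'"
  shows "osc F x x' = (\<integral>\<^sup>+ w. weight s x x' w *
      ennreal ((2 powr real_of_int (fst w) * \<rho> x x') powr s * \<bar>F (fst w) (snd w)\<bar>) \<partial>K3)"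
  unfolding osc_def
proof (rule nn_integral_cong)
  fix w :: "int \<times> 'a \<times> 'a"
  let ?t = "2 powr real_of_int (fst w) * \<rho> x x'"
  have "?t powr (- s) * ?t powr s = 1" using pos by (simp add: powr_add[symmetric])
  then have "ramp_win (fst w) x x' (snd w) * \<bar>F (fst w) (snd w)\<bar> =
      (ramp_win (fst w) x x' (snd w) * ?t powr (- s)) * (?t powr s * \<bar>F (fst w) (snd w)\<bar>)"
    by (simp only: mult_ac)
  then show "ennreal (ramp_win (fst w) x x' (snd w) * \<bar>F (fst w) (snd w)\<bar>) = weight s x x' w * ennreal (?t powr s * \<bar>F (fst w) (snd w)\<bar>)"
    using ramp_win_nonneg[OF x] by (simp add: weight_def split_beta ennreal_mult[symmetric])
qed

lemma F_measurable_K3: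
  assumes "\<And>k. F k \<in> borel_measurable PP"
  shows "(\<lambda>w. F (fst w) (snd w)) \<in> borel_measurable K3"
  by (rule measurable_K3) (use assms in simp)

lemma scale_measurable_K3: "(\<lambda>w. 2 powr real_of_int (fst w)) \<in> borel_measurable K3"
  by (rule measurable_K3) measurable

lemma osc_power_le:
  assumes x: "x \<in> space \<mu>" "x' \<in> space \<mu>" and pos: "0 < \<rho> x x'" and s: "0 < s" "s < 1" and p: "1 \<le> p"
    and F: "\<And>k. F k \<in> borel_measurable PP" and a: "0 \<le> a" "ennreal a \<le> osc F x x'"
  shows "ennreal (a powr p) \<le> ennreal (2 powr p * (ramp_const s * win_const) powr (p - 1)) * pow_osc s p F x x'"
  unfolding pow_osc_def
proof (rule nn_integral_power_mean[OF p _ weight_integral[OF x pos s]])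
  show "0 < ramp_const s * win_const" using ramp_const_pos[OF s] win_const_pos by simp
  show "weight s x x' \<in> borel_measurable K3" by (rule weight_measurable[OF x])
  show "(\<lambda>w. (2 powr real_of_int (fst w) * \<rho> x x') powr s * \<bar>F (fst w) (snd w)\<bar>) \<in> borel_measurable K3"
    using F_measurable_K3[OF F] scale_measurable_K3 by measurable
  show "ennreal a \<le> (\<integral>\<^sup>+ w. weight s x x' w *
      ennreal ((2 powr real_of_int (fst w) * \<rho> x x') powr s * \<bar>F (fst w) (snd w)\<bar>) \<partial>K3)"
    using a(2) osc_eq_weight[OF x pos] by simp
qed (use a in auto)

text \<open>
  On a finite measure the first moment is finite as soon as the \<open>p\<close>-th moment is.
\<close>

lemma osc_finite:
  assumes x: "x \<in> space \<mu>" "x' \<in> space \<mu>" and pos: "0 < \<rho> x x'" and s: "0 < s" "s < 1" and p: "1 \<le> p"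
    and F: "\<And>k. F k \<in> borel_measurable PP" and fin: "pow_osc s p F x x' < top"
  shows "osc F x x' < top"
proof -
  let ?g = "\<lambda>w. (2 powr real_of_int (fst w) * \<rho> x x') powr s * \<bar>F (fst w) (snd w)\<bar>"
  have [measurable]: "?g \<in> borel_measurable K3" "weight s x x' \<in> borel_measurable K3"
    using F_measurable_K3[OF F] scale_measurable_K3 weight_measurable[OF x] by measurable
  have "osc F x x' = (\<integral>\<^sup>+ w. weight s x x' w * ennreal (?g w) \<partial>K3)"
    by (rule osc_eq_weight[OF x pos])
  also have "\<dots> \<le> (\<integral>\<^sup>+ w. weight s x x' w + weight s x x' w * ennreal (?g w powr p) \<partial>K3)"
  proof (rule nn_integral_mono)
    fix w :: "int \<times> 'a \<times> 'a"
    have "?g w \<le> 1 + ?g w powr p"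
      using linear_le_power_split[of "?g w" 1 p] p by simp
    then have "ennreal (?g w) \<le> ennreal (1 + ?g w powr p)" by (rule ennreal_leI)
    then have "ennreal (?g w) \<le> 1 + ennreal (?g w powr p)"
      by (subst (asm) ennreal_plus) simp_all
    from mult_left_mono[OF this, of "weight s x x' w"]
    show "weight s x x' w * ennreal (?g w) \<le> weight s x x' w + weight s x x' w * ennreal (?g w powr p)"
      by (simp add: distrib_left)
  qed
  also have "\<dots> = (\<integral>\<^sup>+ w. weight s x x' w \<partial>K3) + pow_osc s p F x x'"
    unfolding pow_osc_def by (rule nn_integral_add) measurable
  also have "\<dots> < top"
    using weight_integral[OF x pos s] fin by (auto simp: less_top intro: le_less_trans)
  finally show ?thesis .
qed

definition inner_const :: "real \<Rightarrow> real" where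
  "inner_const s = 2 * (C * 2 ^ n) * ramp_integral_const s"

lemma win_le_near:
  assumes "x \<in> space \<mu>" "yz \<in> space PP"
  shows "win k x yz \<le> indicator {x. 2 powr real_of_int k * \<rho> (fst yz) x < 2} x *
            indicator {yz. 2 powr real_of_int k * \<rho> (fst yz) (snd yz) < 4} yz"
proof (cases "win k x yz = 0")
  case False
  then have w: "2 powr real_of_int k * \<rho> x (fst yz) < 2" "2 powr real_of_int k * \<rho> x (snd yz) < 2"
    by (auto simp: win_def split: if_splits)
  have sp: "fst yz \<in> space \<mu>" "snd yz \<in> space \<mu>" using assms by (auto simp: space_pair_measure)
  have "2 powr real_of_int k * \<rho> (fst yz) (snd yz) \<le> 2 powr real_of_int k * (\<rho> x (fst yz) + \<rho> x (snd yz))"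
    using rho_triangle[of "fst yz" x "snd yz"] rho_sym[of x "fst yz"] sp assms by (intro mult_left_mono) auto
  also have "\<dots> < 4" using w by (simp add: distrib_left)
  finally show ?thesis using w rho_sym[OF assms(1) sp(1)] by (simp add: win_def)
qed (simp add: indicator_def)

text \<open>
  If \<open>x\<close> carries the window, the integral in \<open>x'\<close> costs \<open>2 powr (- n k)\<close> and the integral in \<open>x\<close> costs
  the measure of a ball; the two together cancel the factor \<open>(vol k)\<^sup>2\<close> of the kernels.
\<close>

lemma ramp_win_inner_integral:
  assumes yz: "yz \<in> space PP" and s: "0 < s" "s < 1"
  shows "(\<integral>\<^sup>+ xx. ennreal (ramp_win k (fst xx) (snd xx) yz *
            (2 powr real_of_int k * \<rho> (fst xx) (snd xx)) powr (- (real n + s))) \<partial>PP)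
      \<le> ennreal (inner_const s) * indicator {yz. 2 powr real_of_int k * \<rho> (fst yz) (snd yz) < 4} yz"
proof -
  define r where "r xx = ennreal (min 1 (2 powr real_of_int k * \<rho> (fst xx) (snd xx)) *
      (2 powr real_of_int k * \<rho> (fst xx) (snd xx)) powr (- (real n + s)))" for xx
  let ?I = "indicator {yz. 2 powr real_of_int k * \<rho> (fst yz) (snd yz) < 4} yz :: ennreal"
  let ?A = "ramp_integral_const s" and ?y = "fst yz"
  have y: "?y \<in> space \<mu>" using yz by (auto simp: space_pair_measure)
  have A: "0 < ?A" using ramp_const_pos[OF s] const_pos by (simp add: ramp_integral_const_def)
  have win_m [measurable]: "(\<lambda>x. win k x yz) \<in> borel_measurable \<mu>"
    by (rule win_measurable[OF measurable_ident_sets[OF refl] measurable_const[OF yz]])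
  have rm [measurable]: "r \<in> borel_measurable PP" unfolding r_def by measurable
  have r_int: "(\<integral>\<^sup>+ x'. r (x, x') \<partial>\<mu>) \<le> ennreal (?A / vol k)" if "x \<in> space \<mu>" for x
    using ramp_integral[OF that s, of k] by (simp add: r_def powr_minus divide_inverse)
  have r_sym: "r (x, x') = r (x', x)" if "x \<in> space \<mu>" "x' \<in> space \<mu>" for x x'
    using rho_sym[OF that] by (simp add: r_def)
  have win_int: "(\<integral>\<^sup>+ x. ennreal (win k x yz) \<partial>\<mu>) \<le> ennreal (C * 2 ^ n / vol k) * ?I"
  proof -
    have "(\<integral>\<^sup>+ x. ennreal (win k x yz) \<partial>\<mu>) \<le> (\<integral>\<^sup>+ x. indicator {x \<in> space \<mu>. 2 powr real_of_int k * \<rho> ?y x < 2} x * ?I \<partial>\<mu>)"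
    proof (rule nn_integral_mono)
      fix x assume x: "x \<in> space \<mu>"
      show "ennreal (win k x yz) \<le> indicator {x \<in> space \<mu>. 2 powr real_of_int k * \<rho> ?y x < 2} x * ?I"
        using win_le_near[OF x yz, of k] x by (auto simp: indicator_def ennreal_neg split: if_splits)
    qed
    also have "\<dots> = emeasure \<mu> {x \<in> space \<mu>. 2 powr real_of_int k * \<rho> ?y x < 2} * ?I"
      using ball_sets[OF y, of k 2] by (subst nn_integral_multc) (auto intro: borel_measurable_indicator)
    also have "\<dots> \<le> ennreal (C * 2 ^ n / vol k) * ?I"
      using emeasure_ball_scale[OF y, of 2 k] by (intro mult_right_mono) (auto simp: powr_minus divide_inverse)
    finally show ?thesis .
  qed
  have half: "(\<integral>\<^sup>+ x. \<integral>\<^sup>+ x'. ennreal (win k x yz) * r (x, x') \<partial>\<mu> \<partial>\<mu>) \<le> ennreal (?A / vol k) * (ennreal (C * 2 ^ n / vol k) * ?I)"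
  proof -
    have "(\<integral>\<^sup>+ x. \<integral>\<^sup>+ x'. ennreal (win k x yz) * r (x, x') \<partial>\<mu> \<partial>\<mu>)
        = (\<integral>\<^sup>+ x. ennreal (win k x yz) * (\<integral>\<^sup>+ x'. r (x, x') \<partial>\<mu>) \<partial>\<mu>)"
      by (intro nn_integral_cong nn_integral_cmult) measurable
    also have "\<dots> \<le> (\<integral>\<^sup>+ x. ennreal (win k x yz) * ennreal (?A / vol k) \<partial>\<mu>)"
      by (intro nn_integral_mono mult_left_mono r_int) auto
    also have "\<dots> = ennreal (?A / vol k) * (\<integral>\<^sup>+ x. ennreal (win k x yz) \<partial>\<mu>)"
      by (subst nn_integral_multc, measurable) (simp add: mult.commute)
    also have "\<dots> \<le> ennreal (?A / vol k) * (ennreal (C * 2 ^ n / vol k) * ?I)"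
      by (intro mult_left_mono win_int) simp
    finally show ?thesis .
  qed
  have 1: "(\<integral>\<^sup>+ xx. ennreal (win k (fst xx) yz) * r xx \<partial>PP) \<le> ennreal (?A / vol k) * (ennreal (C * 2 ^ n / vol k) * ?I)"
  proof -
    have "(\<lambda>xx. ennreal (win k (fst xx) yz) * r xx) \<in> borel_measurable PP" using yz rm by measurable
    from nn_integral_fst[OF this] half show ?thesis by simp
  qed
  have 2: "(\<integral>\<^sup>+ xx. ennreal (win k (snd xx) yz) * r xx \<partial>PP) \<le> ennreal (?A / vol k) * (ennreal (C * 2 ^ n / vol k) * ?I)"
  proof -
    have "(\<integral>\<^sup>+ xx. ennreal (win k (snd xx) yz) * r xx \<partial>PP) = (\<integral>\<^sup>+ x. \<integral>\<^sup>+ x'. ennreal (win k x yz) * r (x', x) \<partial>\<mu> \<partial>\<mu>)"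
    proof -
      have "(\<lambda>(x', x). ennreal (win k x yz) * r (x', x)) \<in> borel_measurable PP" using yz rm by measurable
      from pair.nn_integral_snd[OF this] show ?thesis by (simp add: split_beta')
    qed
    also have "\<dots> = (\<integral>\<^sup>+ x. \<integral>\<^sup>+ x'. ennreal (win k x yz) * r (x, x') \<partial>\<mu> \<partial>\<mu>)"
      using r_sym by (intro nn_integral_cong) simp
    finally show ?thesis using half by simp
  qed
  have "(\<integral>\<^sup>+ xx. ennreal (ramp_win k (fst xx) (snd xx) yz *
            (2 powr real_of_int k * \<rho> (fst xx) (snd xx)) powr (- (real n + s))) \<partial>PP)
      = (\<integral>\<^sup>+ xx. ennreal ((vol k)\<^sup>2) * (ennreal (win k (fst xx) yz) * r xx + ennreal (win k (snd xx) yz) * r xx) \<partial>PP)"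
  proof (rule nn_integral_cong)
    fix xx assume "xx \<in> space PP"
    then have "0 \<le> 2 powr real_of_int k * \<rho> (fst xx) (snd xx)"
      using rho_nonneg[of "fst xx" "snd xx"] by (auto simp: space_pair_measure)
    then show "ennreal (ramp_win k (fst xx) (snd xx) yz * (2 powr real_of_int k * \<rho> (fst xx) (snd xx)) powr (- (real n + s)))
       = ennreal ((vol k)\<^sup>2) * (ennreal (win k (fst xx) yz) * r xx + ennreal (win k (snd xx) yz) * r xx)"
      by (simp only: r_def ramp_win_def distrib_right[symmetric])
         (simp add: win_nonneg ennreal_mult[symmetric] ennreal_plus[symmetric] mult_ac del: ennreal_plus)
  qed
  also have "\<dots> = ennreal ((vol k)\<^sup>2) * ((\<integral>\<^sup>+ xx. ennreal (win k (fst xx) yz) * r xx \<partial>PP) + (\<integral>\<^sup>+ xx. ennreal (win k (snd xx) yz) * r xx \<partial>PP))"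
  proof -
    have "(\<lambda>xx. ennreal (win k (fst xx) yz) * r xx) \<in> borel_measurable PP" "(\<lambda>xx. ennreal (win k (snd xx) yz) * r xx) \<in> borel_measurable PP"
      using yz rm by measurable
    then show ?thesis by (rule nn_integral_cmult_add)
  qed
  also have "\<dots> \<le> ennreal ((vol k)\<^sup>2) * (ennreal (?A / vol k) * (ennreal (C * 2 ^ n / vol k) * ?I) + ennreal (?A / vol k) * (ennreal (C * 2 ^ n / vol k) * ?I))"
    by (intro mult_left_mono add_mono 1 2) simp
  also have "\<dots> = (ennreal ((vol k)\<^sup>2) * (ennreal (?A / vol k) * ennreal (C * 2 ^ n / vol k)) * 2) * ?I"
    by (simp add: mult_2_right[symmetric] distrib_left mult_ac)
  also have "ennreal ((vol k)\<^sup>2) * (ennreal (?A / vol k) * ennreal (C * 2 ^ n / vol k)) = ennreal (?A * (C * 2 ^ n))"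
    using A const_pos by (simp add: ennreal_mult[symmetric] power2_eq_square)
  also have "ennreal (?A * (C * 2 ^ n)) * 2 = ennreal (inner_const s)"
    using A const_pos by (simp add: inner_const_def ennreal_mult'' mult_ac)
  finally show ?thesis .
qed

end

section \<open>From finite energy to fractional Sobolev functions\<close>

lemma borel_measurable_nn_integral_int:
  fixes f :: "int \<Rightarrow> 'b \<Rightarrow> ennreal"
  assumes "\<And>k. f k \<in> borel_measurable M"
  shows "(\<lambda>x. \<integral>\<^sup>+ k. f k x \<partial>count_space UNIV) \<in> borel_measurable M"
proof (rule sigma_finite_measure.borel_measurable_nn_integral[OF sigma_finite_measure_count_space])
  have "(\<lambda>z. f (snd z) (fst z)) \<in> borel_measurable (M \<Otimes>\<^sub>M count_space UNIV)"
    by (rule measurable_compose_countable[where f = "\<lambda>k z. f k (fst z)"])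
       (auto intro: measurable_compose[OF measurable_fst assms] measurable_snd)
  then show "(\<lambda>(x, k). f k x) \<in> borel_measurable (M \<Otimes>\<^sub>M count_space UNIV)"
    by (simp only: split_beta')
qed

lemma frac_quotient_real:
  assumes "0 < r" "d x y = ennreal r"
  shows "frac_quotient d n s p u x y = ennreal (\<bar>u x - u y\<bar> powr p * r powr (- (real n + s * p)))"
  using assms powr_minus[of r "real n + s * p"]
  by (simp add: frac_quotient_def ennreal_powr_def divide_ennreal divide_inverse)

context nontrivial_regular_metric_measure
begin

lemma AE_fst_snd:
  assumes "AE x in \<mu>. P x"
  shows "AE xx in PP. P (fst xx)" "AE xx in PP. P (snd xx)"
proof -
  from assms obtain N where N: "{x \<in> space \<mu>. \<not> P x} \<subseteq> N" "emeasure \<mu> N = 0" "N \<in> sets \<mu>"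
    by (rule AE_E)
  have notN: "AE x in \<mu>. x \<notin> N"
    using N by (intro AE_not_in) auto
  have "AE xx in PP. fst xx \<notin> N"
  proof (rule pair.AE_pair_measure)
    show "{xx \<in> space PP. fst xx \<notin> N} \<in> sets PP" using N(3) by measurable
  qed (use notN in auto)
  with AE_space show "AE xx in PP. P (fst xx)"
    by eventually_elim (use N(1) in \<open>auto simp: space_pair_measure\<close>)
  have "AE xx in PP. snd xx \<notin> N"
  proof (rule pair.AE_pair_measure)
    show "{xx \<in> space PP. snd xx \<notin> N} \<in> sets PP" using N(3) by measurable
  qed (use notN in auto)
  with AE_space show "AE xx in PP. P (snd xx)"
    by eventually_elim (use N(1) in \<open>auto simp: space_pair_measure\<close>)
qed

text \<open>
  Tonelli's theorem, with the integration over \<open>x\<close> and \<open>x'\<close> carried out first.  The function \<open>E\<close> makes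
  the integrand measurable; where \<open>\<rho>\<close> vanishes it is only an upper bound.
\<close>

lemma pow_osc_integral:
  assumes s: "0 < s" "s < 1" and F [measurable]: "\<And>k. F k \<in> borel_measurable PP"
  obtains E where "E \<in> borel_measurable PP"
    "\<And>xx. xx \<in> space PP \<Longrightarrow> pow_osc s p F (fst xx) (snd xx) * ennreal (\<rho> (fst xx) (snd xx) powr (- (real n + s * p))) \<le> E xx"
    "(\<integral>\<^sup>+ xx. E xx \<partial>PP) \<le> ennreal (inner_const s) * energy s p F"
proof
  define f where "f k yz = ennreal (2 powr ((real n + s * p) * real_of_int k) * \<bar>F k yz\<bar> powr p)" for k yz
  define g where "g k xx yz = ennreal (ramp_win k (fst xx) (snd xx) yz *
            (2 powr real_of_int k * \<rho> (fst xx) (snd xx)) powr (- (real n + s)))" for k xx yz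
  let ?E = "\<lambda>xx. \<integral>\<^sup>+ k. \<integral>\<^sup>+ yz. f k yz * g k xx yz \<partial>PP \<partial>count_space (UNIV :: int set)"
  have fm [measurable]: "f k \<in> borel_measurable PP" for k unfolding f_def by measurable
  have gm: "(\<lambda>w. g k (fst w) (snd w)) \<in> borel_measurable (PP \<Otimes>\<^sub>M PP)" for k
    unfolding g_def by measurable
  have gm1 [measurable]: "g k xx \<in> borel_measurable PP" if "xx \<in> space PP" for k xx
    using measurable_compose[OF measurable_Pair1'[OF that] gm, of k] by simp
  have gm2 [measurable]: "(\<lambda>xx. g k xx yz) \<in> borel_measurable PP" if "yz \<in> space PP" for k yz
    using measurable_compose[OF measurable_Pair2'[OF that] gm, of k] by simp
  have fgm: "(\<lambda>(xx, yz). f k yz * g k xx yz) \<in> borel_measurable (PP \<Otimes>\<^sub>M PP)" for k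
    using gm[of k] by (simp only: split_beta') measurable
  have inner_m: "(\<lambda>xx. \<integral>\<^sup>+ yz. f k yz * g k xx yz \<partial>PP) \<in> borel_measurable PP" for k
    by (rule sigma_finite_measure.borel_measurable_nn_integral[OF sigma_finite_PP fgm])
  show "?E \<in> borel_measurable PP"
    by (rule borel_measurable_nn_integral_int[OF inner_m])
  show "pow_osc s p F (fst xx) (snd xx) * ennreal (\<rho> (fst xx) (snd xx) powr (- (real n + s * p))) \<le> ?E xx"
    if xx: "xx \<in> space PP" for xx
  proof (cases "\<rho> (fst xx) (snd xx) = 0")
    case False
    let ?r = "\<rho> (fst xx) (snd xx)"
    have x: "fst xx \<in> space \<mu>" "snd xx \<in> space \<mu>" using xx by (auto simp: space_pair_measure)
    have r: "0 < ?r" using False rho_nonneg[OF x] by simp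
    let ?h = "\<lambda>w. weight s (fst xx) (snd xx) w *
      ennreal (((2 powr real_of_int (fst w) * ?r) powr s * \<bar>F (fst w) (snd w)\<bar>) powr p)"
    have hm: "?h \<in> borel_measurable K3"
      using weight_measurable[OF x, of s] F_measurable_K3[OF F] scale_measurable_K3 by measurable
    have hm2: "(\<lambda>yz. ?h (k, yz)) \<in> borel_measurable PP" for k
      using measurable_compose[OF measurable_Pair1'[of k "count_space UNIV"] hm] by simp
    have "pow_osc s p F (fst xx) (snd xx) * ennreal (?r powr (- (real n + s * p)))
        = (\<integral>\<^sup>+ w. ?h w * ennreal (?r powr (- (real n + s * p))) \<partial>K3)"
      unfolding pow_osc_def by (rule nn_integral_multc[symmetric]) (rule hm)
    also have "\<dots> = (\<integral>\<^sup>+ k. \<integral>\<^sup>+ yz. ?h (k, yz) * ennreal (?r powr (- (real n + s * p))) \<partial>PP \<partial>count_space UNIV)"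
      by (rule nn_integral_K3) (use hm in measurable)
    also have "\<dots> = ?E xx"
    proof (intro nn_integral_cong)
      fix k yz
      let ?t = "2 powr real_of_int k * ?r"
      have t: "0 < ?t" using r by simp
      have "?r = ?t * 2 powr (- real_of_int k)" by (simp add: powr_minus)
      from arg_cong[OF this, of "\<lambda>z. z powr (- (real n + s * p))"]
      have "?r powr (- (real n + s * p)) = (?t * 2 powr (- real_of_int k)) powr (- (real n + s * p))" .
      also have "\<dots> = ?t powr (- (real n + s * p)) * 2 powr ((real n + s * p) * real_of_int k)"
        using t by (subst powr_mult) (auto simp: powr_powr algebra_simps)
      finally have rr: "?r powr (- (real n + s * p)) = \<dots>" .
      have "?t powr (- s) * (?t powr s) powr p * ?t powr (- (real n + s * p)) = ?t powr (- (real n + s))"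
        by (simp add: powr_powr powr_add[symmetric] algebra_simps)
      then have "(ramp_win k (fst xx) (snd xx) yz * ?t powr (- s)) * (?t powr s * \<bar>F k yz\<bar>) powr p * ?r powr (- (real n + s * p))
        = (2 powr ((real n + s * p) * real_of_int k) * \<bar>F k yz\<bar> powr p) * (ramp_win k (fst xx) (snd xx) yz * ?t powr (- (real n + s)))"
        unfolding rr by (subst powr_mult) (auto simp: mult_ac)
      then show "?h (k, yz) * ennreal (?r powr (- (real n + s * p))) = f k yz * g k xx yz"
        using ramp_win_nonneg[OF x, of k yz]
        by (simp add: weight_def f_def g_def ennreal_mult[symmetric])
    qed
    finally show ?thesis by simp
  qed simp
  have "(\<integral>\<^sup>+ xx. ?E xx \<partial>PP) = (\<integral>\<^sup>+ k. \<integral>\<^sup>+ xx. \<integral>\<^sup>+ yz. f k yz * g k xx yz \<partial>PP \<partial>PP \<partial>count_space UNIV)"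
    by (rule nn_integral_swap_int[OF sigma_finite_PP inner_m])
  also have "\<dots> = (\<integral>\<^sup>+ k. \<integral>\<^sup>+ yz. \<integral>\<^sup>+ xx. f k yz * g k xx yz \<partial>PP \<partial>PP \<partial>count_space UNIV)"
  proof (rule nn_integral_cong)
    fix k
    have "pair_sigma_finite PP PP"
      by (intro pair_sigma_finite.intro sigma_finite_PP)
    from pair_sigma_finite.Fubini'[OF this fgm, of k]
    show "(\<integral>\<^sup>+ xx. \<integral>\<^sup>+ yz. f k yz * g k xx yz \<partial>PP \<partial>PP) = (\<integral>\<^sup>+ yz. \<integral>\<^sup>+ xx. f k yz * g k xx yz \<partial>PP \<partial>PP)"
      by simp
  qed
  also have "\<dots> \<le> (\<integral>\<^sup>+ k. \<integral>\<^sup>+ yz. ennreal (inner_const s) * (f k yz * indicator {yz. 2 powr real_of_int k * \<rho> (fst yz) (snd yz) < 4} yz) \<partial>PP \<partial>count_space UNIV)"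
  proof (intro nn_integral_mono)
    fix k yz assume yz: "yz \<in> space PP"
    have "(\<integral>\<^sup>+ xx. f k yz * g k xx yz \<partial>PP) = f k yz * (\<integral>\<^sup>+ xx. g k xx yz \<partial>PP)"
      by (rule nn_integral_cmult[OF gm2[OF yz]])
    also have "\<dots> \<le> f k yz * (ennreal (inner_const s) * indicator {yz. 2 powr real_of_int k * \<rho> (fst yz) (snd yz) < 4} yz)"
      unfolding g_def by (intro mult_left_mono ramp_win_inner_integral yz s) simp
    finally show "(\<integral>\<^sup>+ xx. f k yz * g k xx yz \<partial>PP) \<le> ennreal (inner_const s) * (f k yz * indicator {yz. 2 powr real_of_int k * \<rho> (fst yz) (snd yz) < 4} yz)"
      by (simp only: mult_ac)
  qed
  also have "\<dots> = (\<integral>\<^sup>+ k. ennreal (inner_const s) * (\<integral>\<^sup>+ yz. f k yz * indicator {yz. 2 powr real_of_int k * \<rho> (fst yz) (snd yz) < 4} yz \<partial>PP) \<partial>count_space UNIV)"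
    by (intro nn_integral_cong nn_integral_cmult) measurable
  also have "\<dots> = ennreal (inner_const s) * energy s p F"
    unfolding energy_def f_def by (rule nn_integral_cmult) simp
  finally show "(\<integral>\<^sup>+ xx. ?E xx \<partial>PP) \<le> ennreal (inner_const s) * energy s p F" .
qed

lemma AE_pow_osc_finite:
  assumes s: "0 < s" "s < 1" and F: "\<And>k. F k \<in> borel_measurable PP" and fin: "energy s p F < top"
  shows "AE xx in PP. pow_osc s p F (fst xx) (snd xx) < top"
proof -
  obtain E where E: "E \<in> borel_measurable PP"
    "\<And>xx. xx \<in> space PP \<Longrightarrow> pow_osc s p F (fst xx) (snd xx) * ennreal (\<rho> (fst xx) (snd xx) powr (- (real n + s * p))) \<le> E xx"
    "(\<integral>\<^sup>+ xx. E xx \<partial>PP) \<le> ennreal (inner_const s) * energy s p F"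
    by (rule pow_osc_integral[where F = F and p = p, OF s F]) (rule that)
  have "(\<integral>\<^sup>+ xx. E xx \<partial>PP) \<noteq> \<infinity>"
    using E(3) fin by (auto simp: top_unique ennreal_mult_eq_top_iff)
  then have "AE xx in PP. E xx \<noteq> \<infinity>"
    by (rule nn_integral_PInf_AE[OF E(1)])
  with AE_pair_rho_pos AE_space[of PP] show ?thesis
  proof eventually_elim
    case (elim xx)
    have "pow_osc s p F (fst xx) (snd xx) * ennreal (\<rho> (fst xx) (snd xx) powr (- (real n + s * p))) \<noteq> top"
      using E(2)[OF elim(2)] elim(3) by (auto simp: top_unique)
    then show ?case using elim(1) by (auto simp: ennreal_mult_eq_top_iff less_top)
  qed
qed

text \<open>
  The superposition, over all scales and pairs, of the kernels with density \<open>F\<close>, normalised to vanish at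
  \<open>x0\<close>.  A single integral over \<open>count_space UNIV \<Otimes>\<^sub>M PP\<close> gives measurability and differences at once.
\<close>

definition superposition :: "(int \<Rightarrow> 'a \<times> 'a \<Rightarrow> real) \<Rightarrow> 'a \<Rightarrow> 'a \<Rightarrow> real" where
  "superposition F x0 x = (\<integral>w. (kern_prod (fst w) x (snd w) - kern_prod (fst w) x0 (snd w)) * F (fst w) (snd w) \<partial>K3)"

lemma kern_prod_diff_measurable_K3:
  assumes x: "x \<in> space \<mu>" "x' \<in> space \<mu>" and F [measurable]: "\<And>k. F k \<in> borel_measurable PP"
  shows "(\<lambda>w. (kern_prod (fst w) x (snd w) - kern_prod (fst w) x' (snd w)) * F (fst w) (snd w)) \<in> borel_measurable K3"
  by (rule measurable_K3) (use x in \<open>simp only: fst_conv snd_conv, measurable\<close>)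

lemma kern_prod_diff_integral:
  assumes x: "x \<in> space \<mu>" "x' \<in> space \<mu>" and F [measurable]: "\<And>k. F k \<in> borel_measurable PP"
  shows "(\<integral>\<^sup>+ w. ennreal \<bar>(kern_prod (fst w) x (snd w) - kern_prod (fst w) x' (snd w)) * F (fst w) (snd w)\<bar> \<partial>K3) \<le> ennreal kap_const * osc F x x'"
proof -
  have m: "(\<lambda>w. ennreal (ramp_win (fst w) x x' (snd w) * \<bar>F (fst w) (snd w)\<bar>)) \<in> borel_measurable K3"
    by (rule measurable_K3) (use x in \<open>simp only: fst_conv snd_conv, measurable\<close>)
  have "(\<integral>\<^sup>+ w. ennreal \<bar>(kern_prod (fst w) x (snd w) - kern_prod (fst w) x' (snd w)) * F (fst w) (snd w)\<bar> \<partial>K3)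
      \<le> (\<integral>\<^sup>+ w. ennreal kap_const * ennreal (ramp_win (fst w) x x' (snd w) * \<bar>F (fst w) (snd w)\<bar>) \<partial>K3)"
  proof (rule nn_integral_mono)
    fix w assume "w \<in> space K3"
    then have "snd w \<in> space PP" by (auto simp: space_pair_measure)
    from mult_right_mono[OF kern_prod_diff[OF x this], of "\<bar>F (fst w) (snd w)\<bar>" "fst w"]
    show "ennreal \<bar>(kern_prod (fst w) x (snd w) - kern_prod (fst w) x' (snd w)) * F (fst w) (snd w)\<bar>
        \<le> ennreal kap_const * ennreal (ramp_win (fst w) x x' (snd w) * \<bar>F (fst w) (snd w)\<bar>)"
      using kap_const_pos ramp_win_nonneg[OF x] by (simp add: ennreal_mult[symmetric] abs_mult mult.assoc ennreal_leI)
  qed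
  also have "\<dots> = ennreal kap_const * osc F x x'"
    unfolding osc_def by (rule nn_integral_cmult[OF m])
  finally show ?thesis .
qed

lemma kern_prod_diff_integrable:
  assumes x: "x \<in> space \<mu>" "x' \<in> space \<mu>" and F: "\<And>k. F k \<in> borel_measurable PP" and fin: "osc F x x' < top"
  shows "integrable K3 (\<lambda>w. (kern_prod (fst w) x (snd w) - kern_prod (fst w) x' (snd w)) * F (fst w) (snd w))"
proof (rule integrableI_bounded[OF kern_prod_diff_measurable_K3[OF x F]])
  show "(\<integral>\<^sup>+ w. ennreal (norm ((kern_prod (fst w) x (snd w) - kern_prod (fst w) x' (snd w)) * F (fst w) (snd w))) \<partial>K3) < \<infinity>"
    using le_less_trans[OF kern_prod_diff_integral[where F = F, OF x F], of top] fin
    by (simp add: ennreal_mult_less_top del: abs_mult)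
qed

lemma superposition_measurable:
  assumes x0: "x0 \<in> space \<mu>" and F [measurable]: "\<And>k. F k \<in> borel_measurable PP"
  shows "superposition F x0 \<in> borel_measurable \<mu>"
proof -
  have sf: "sigma_finite_measure K3"
  proof -
    interpret K: pair_sigma_finite "count_space (UNIV :: int set)" PP
      by (intro pair_sigma_finite.intro sigma_finite_PP sigma_finite_measure_count_space)
    show ?thesis by (rule K.P.sigma_finite_measure_axioms)
  qed
  have "(\<lambda>z. (kern_prod (fst (snd z)) (fst z) (snd (snd z)) - kern_prod (fst (snd z)) x0 (snd (snd z))) * F (fst (snd z)) (snd (snd z)))
      \<in> borel_measurable (\<mu> \<Otimes>\<^sub>M K3)"
    by (rule measurable_compose_countable[where g = "\<lambda>z. fst (snd z)" and
      f = "\<lambda>k z. (kern_prod k (fst z) (snd (snd z)) - kern_prod k x0 (snd (snd z))) * F k (snd (snd z))"])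
      (use x0 in measurable)
  then have "(\<lambda>(x, w). (kern_prod (fst w) x (snd w) - kern_prod (fst w) x0 (snd w)) * F (fst w) (snd w)) \<in> borel_measurable (\<mu> \<Otimes>\<^sub>M K3)"
    by (simp only: split_beta')
  from sigma_finite_measure.borel_measurable_lebesgue_integral[OF sf this]
  show ?thesis unfolding superposition_def .
qed

lemma superposition_diff:
  assumes x: "x \<in> space \<mu>" "x' \<in> space \<mu>" "x0 \<in> space \<mu>" and F: "\<And>k. F k \<in> borel_measurable PP"
    and fin: "osc F x x0 < top" "osc F x' x0 < top"
  shows "ennreal \<bar>superposition F x0 x - superposition F x0 x'\<bar> \<le> ennreal kap_const * osc F x x'"
proof -
  let ?h = "\<lambda>x w. (kern_prod (fst w) x (snd w) - kern_prod (fst w) x0 (snd w)) * F (fst w) (snd w)"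
  have int: "integrable K3 (?h x)" "integrable K3 (?h x')"
    using kern_prod_diff_integrable[where F = F, OF _ _ F] x fin by auto
  have "superposition F x0 x - superposition F x0 x' = (\<integral>w. ?h x w - ?h x' w \<partial>K3)"
    unfolding superposition_def by (rule Bochner_Integration.integral_diff[OF int, symmetric])
  then have "ennreal \<bar>superposition F x0 x - superposition F x0 x'\<bar> = ennreal (norm (\<integral>w. ?h x w - ?h x' w \<partial>K3))" by simp
  also have "\<dots> \<le> (\<integral>\<^sup>+ w. ennreal (norm (?h x w - ?h x' w)) \<partial>K3)"
    by (rule integral_norm_bound_ennreal) (intro Bochner_Integration.integrable_diff int)
  also have "\<dots> = (\<integral>\<^sup>+ w. ennreal \<bar>(kern_prod (fst w) x (snd w) - kern_prod (fst w) x' (snd w)) * F (fst w) (snd w)\<bar> \<partial>K3)"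
    by (intro nn_integral_cong) (simp add: algebra_simps)
  also have "\<dots> \<le> ennreal kap_const * osc F x x'"
    by (rule kern_prod_diff_integral[OF x(1,2) F])
  finally show ?thesis .
qed

abbreviation edist :: "'a \<Rightarrow> 'a \<Rightarrow> ennreal" where "edist \<equiv> \<lambda>x y. ennreal (\<rho> x y)"

text \<open>
  Where both values are given by absolutely convergent integrals, their difference is bounded by the
  oscillation, whose \<open>p\<close>-th power is bounded by \<open>pow_osc\<close>, whose integral is bounded by the energy.
\<close>

lemma superposition_in_frac_sobolev:
  assumes s: "0 < s" "s < 1" and p: "1 \<le> p" and F: "\<And>k. F k \<in> borel_measurable PP"
    and fin: "energy s p F < top" and x0: "x0 \<in> space \<mu>" and ae: "AE x in \<mu>. osc F x x0 < top"
  shows "superposition F x0 \<in> frac_sobolev \<mu> edist n s p"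
proof -
  obtain E where E: "E \<in> borel_measurable PP"
    "\<And>xx. xx \<in> space PP \<Longrightarrow> pow_osc s p F (fst xx) (snd xx) * ennreal (\<rho> (fst xx) (snd xx) powr (- (real n + s * p))) \<le> E xx"
    "(\<integral>\<^sup>+ xx. E xx \<partial>PP) \<le> ennreal (inner_const s) * energy s p F"
    by (rule pow_osc_integral[where F = F and p = p, OF s F]) (rule that)
  let ?A = "ennreal (kap_const powr p) * ennreal (2 powr p * (ramp_const s * win_const) powr (p - 1))"
  let ?v = "superposition F x0"
  have "AE xx in PP. (case xx of (x, y) \<Rightarrow> frac_quotient edist n s p ?v x y) \<le> ?A * E xx"
    using AE_pair_rho_pos AE_fst_snd[OF ae] AE_space[of PP]
  proof eventually_elim
    case (elim xx)
    obtain x y where xx: "xx = (x, y)" by (cases xx)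
    have x: "x \<in> space \<mu>" "y \<in> space \<mu>" using elim(4) xx by (auto simp: space_pair_measure)
    have pos: "0 < \<rho> x y" and o: "osc F x x0 < top" "osc F y x0 < top"
      using elim xx by auto
    let ?a = "\<bar>?v x - ?v y\<bar> / kap_const" and ?c = "ennreal (\<rho> x y powr (- (real n + s * p)))"
    have "ennreal kap_const * ennreal ?a \<le> ennreal kap_const * osc F x y"
      using superposition_diff[OF x x0 F o] kap_const_pos by (simp add: ennreal_mult[symmetric])
    then have "ennreal ?a \<le> osc F x y"
      using kap_const_pos by (subst (asm) ennreal_mult_le_mult_iff) auto
    then have le: "ennreal (?a powr p) \<le> ennreal (2 powr p * (ramp_const s * win_const) powr (p - 1)) * pow_osc s p F x y"
      using kap_const_pos by (intro osc_power_le x pos s p F) auto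
    have "frac_quotient edist n s p ?v x y = ennreal (\<bar>?v x - ?v y\<bar> powr p) * ?c"
      by (simp add: frac_quotient_real[where d = edist, OF pos] ennreal_mult)
    also have "\<bar>?v x - ?v y\<bar> powr p = kap_const powr p * ?a powr p"
      using kap_const_pos by (simp add: powr_divide)
    also have "ennreal (kap_const powr p * ?a powr p) * ?c = ennreal (kap_const powr p) * ennreal (?a powr p) * ?c"
      by (simp add: ennreal_mult)
    also have "\<dots> \<le> ennreal (kap_const powr p) * (ennreal (2 powr p * (ramp_const s * win_const) powr (p - 1)) * pow_osc s p F x y) * ?c"
      by (intro mult_right_mono mult_left_mono le) auto
    also have "\<dots> = ?A * (pow_osc s p F x y * ?c)" by (simp only: mult_ac)
    also have "\<dots> \<le> ?A * E xx"
      using E(2)[OF elim(4)] by (intro mult_left_mono) (auto simp: xx)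
    finally show ?case by (simp add: xx)
  qed
  then have "(\<integral>\<^sup>+ (x, y). frac_quotient edist n s p ?v x y \<partial>PP) \<le> (\<integral>\<^sup>+ xx. ?A * E xx \<partial>PP)"
    by (intro nn_integral_mono_AE) (simp add: split_beta')
  also have "\<dots> = ?A * (\<integral>\<^sup>+ xx. E xx \<partial>PP)"
    by (rule nn_integral_cmult[OF E(1)])
  also have "\<dots> \<le> ?A * (ennreal (inner_const s) * energy s p F)"
    by (intro mult_left_mono E) simp
  also have "\<dots> < top"
    using fin by (simp add: ennreal_mult_less_top)
  finally show ?thesis
    using superposition_measurable[OF x0 F] by (simp add: frac_sobolev_def)
qed

end

section \<open>The telescoping identity\<close>

lemma nn_integral_int_tendsto_0:
  fixes T :: "int \<Rightarrow> ennreal" and h :: "nat \<Rightarrow> int"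
  assumes fin: "(\<integral>\<^sup>+ k. T k \<partial>count_space UNIV) < top" and h: "inj h"
  shows "(\<lambda>N. T (h N)) \<longlonglongrightarrow> 0"
proof -
  have "(\<Sum>N. T (h N)) = (\<integral>\<^sup>+ N. T (h N) \<partial>count_space UNIV)"
    by (rule nn_integral_count_space_nat[symmetric])
  also have "\<dots> = (\<integral>\<^sup>+ k. T k \<partial>count_space (range h))"
    using h by (intro nn_integral_bij_count_space) (simp add: bij_betw_def)
  also have "\<dots> = (\<integral>\<^sup>+ k. T k * indicator (range h) k \<partial>count_space UNIV)"
    by (rule nn_integral_count_space_indicator) simp
  also have "\<dots> \<le> (\<integral>\<^sup>+ k. T k \<partial>count_space UNIV)"
    by (intro nn_integral_mono) (auto simp: indicator_def)
  finally have sum: "(\<Sum>N. T (h N)) < top" using fin by (rule le_less_trans)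
  have each: "T (h N) < top" for N
  proof -
    have "T (h N) \<le> (\<integral>\<^sup>+ k. T k \<partial>count_space UNIV)"
      by (rule nn_integral_ge_point) simp
    then show ?thesis using fin by (rule le_less_trans)
  qed
  define r where "r N = enn2real (T (h N))" for N
  have r: "T (h N) = ennreal (r N)" "0 \<le> r N" for N
    using each[of N] by (auto simp: r_def)
  have "summable r"
    using sum r by (intro summable_suminf_not_top) (auto simp: less_top)
  then have "r \<longlonglongrightarrow> 0" by (rule summable_LIMSEQ_zero)
  then have "(\<lambda>N. ennreal (r N)) \<longlonglongrightarrow> ennreal 0" by (rule tendsto_ennrealI)
  then show ?thesis by (simp add: r)
qed

lemma integral_count_int_limit:
  fixes S :: "int \<Rightarrow> real"
  assumes "integrable (count_space UNIV) S"
  shows "(\<lambda>N. \<Sum>k\<in>{- int N..<int N}. S k) \<longlonglongrightarrow> (\<integral>k. S k \<partial>count_space UNIV)"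
proof -
  have "(\<lambda>N. \<integral>k. indicator {- int N..<int N} k * S k \<partial>count_space UNIV) \<longlonglongrightarrow> (\<integral>k. S k \<partial>count_space UNIV)"
  proof (rule integral_dominated_convergence[where w = "\<lambda>k. \<bar>S k\<bar>"])
    show "integrable (count_space UNIV) (\<lambda>k. \<bar>S k\<bar>)" using assms by (rule integrable_abs)
    show "AE k in count_space UNIV. (\<lambda>N. indicator {- int N..<int N} k * S k) \<longlonglongrightarrow> S k"
    proof (rule AE_I2)
      fix k :: int
      have "eventually (\<lambda>N. indicator {- int N..<int N} k * S k = S k) sequentially"
        using eventually_gt_at_top[of "nat \<bar>k\<bar>"]
      proof eventually_elim
        case (elim N)
        then have "k \<in> {- int N..<int N}" by auto
        then show ?case by simp
      qed
      then show "(\<lambda>N. indicator {- int N..<int N} k * S k) \<longlonglongrightarrow> S k"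
        by (rule tendsto_eventually)
    qed
  qed (auto simp: indicator_def)
  moreover have "(\<integral>k. indicator {- int N..<int N} k * S k \<partial>count_space UNIV) = (\<Sum>k\<in>{- int N..<int N}. S k)" for N
  proof -
    have fin: "finite {k. indicator {- int N..<int N} k * S k \<noteq> 0}"
      by (rule finite_subset[of _ "{- int N..<int N}"]) (auto simp: indicator_def)
    have "(\<integral>k. indicator {- int N..<int N} k * S k \<partial>count_space UNIV) = (\<Sum>k | indicator {- int N..<int N} k * S k \<noteq> 0. indicator {- int N..<int N} k * S k)"
      using fin by (subst lebesgue_integral_count_space_finite_support) auto
    also have "\<dots> = (\<Sum>k\<in>{- int N..<int N}. S k)"
      by (rule sum.mono_neutral_cong_left) (auto simp: indicator_def)
    finally show ?thesis .
  qed
  ultimately show ?thesis by simp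
qed

context nontrivial_regular_metric_measure
begin

lemma product_integral:
  fixes f g :: "'a \<Rightarrow> real"
  assumes f: "integrable \<mu> f" and g: "integrable \<mu> g"
  shows "integrable PP (\<lambda>z. f (fst z) * g (snd z))"
    and "(\<integral>z. f (fst z) * g (snd z) \<partial>PP) = (\<integral>y. f y \<partial>\<mu>) * (\<integral>z. g z \<partial>\<mu>)"
proof -
  have [measurable]: "f \<in> borel_measurable \<mu>" "g \<in> borel_measurable \<mu>" using f g by auto
  have m: "(\<lambda>(y, z). f y * g z) \<in> borel_measurable PP" by measurable
  have int: "integrable PP (\<lambda>(y, z). f y * g z)"
  proof (rule pair.Fubini_integrable[OF m])
    have "(\<lambda>y. \<integral>z. norm (f y * g z) \<partial>\<mu>) = (\<lambda>y. \<bar>f y\<bar> * (\<integral>z. \<bar>g z\<bar> \<partial>\<mu>))"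
      by (simp add: abs_mult)
    then show "integrable \<mu> (\<lambda>y. \<integral>z. norm (case (y, z) of (y, z) \<Rightarrow> f y * g z) \<partial>\<mu>)"
      using f by simp
    show "AE y in \<mu>. integrable \<mu> (\<lambda>z. case (y, z) of (y, z) \<Rightarrow> f y * g z)"
      using g by simp
  qed
  then show "integrable PP (\<lambda>z. f (fst z) * g (snd z))" by (simp add: split_beta')
  from pair.integral_fst'[OF int]
  show "(\<integral>z. f (fst z) * g (snd z) \<partial>PP) = (\<integral>y. f y \<partial>\<mu>) * (\<integral>z. g z \<partial>\<mu>)"
    by (simp add: split_beta')
qed

definition pair_diff :: "('a \<Rightarrow> real) \<Rightarrow> 'a \<times> 'a \<Rightarrow> real" where
  "pair_diff u yz = u (fst yz) - u (snd yz)"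

definition avg_dev :: "('a \<Rightarrow> real) \<Rightarrow> int \<Rightarrow> 'a \<Rightarrow> real" where
  "avg_dev u k x = (\<integral>y. kern k x y * (u y - u x) \<partial>\<mu>)"

definition averageable :: "('a \<Rightarrow> real) \<Rightarrow> 'a \<Rightarrow> bool" where
  "averageable u x \<longleftrightarrow> (\<forall>k. integrable \<mu> (\<lambda>y. kern k x y * (u y - u x))) \<and> (\<lambda>N. avg_dev u (int N) x) \<longlonglongrightarrow> 0"

lemma kern_prod_integral:
  assumes x: "x \<in> space \<mu>" and av: "averageable u x"
  shows "integrable PP (\<lambda>yz. kern_prod k x yz * pair_diff u yz)"
    and "(\<integral>yz. kern_prod k x yz * pair_diff u yz \<partial>PP) = avg_dev u (k + 1) x - avg_dev u k x"
proof -
  let ?a = "\<lambda>j y. kern j x y * (u y - u x)"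
  have a: "integrable \<mu> (?a j)" for j using av by (simp add: averageable_def)
  have eq: "kern_prod k x yz * pair_diff u yz = ?a (k + 1) (fst yz) * kern k x (snd yz) - kern (k + 1) x (fst yz) * ?a k (snd yz)" for yz
    by (simp add: kern_prod_def pair_diff_def algebra_simps)
  note int = product_integral[OF a[of "k + 1"] kern_integrable[OF x, of k]]
    product_integral[OF kern_integrable[OF x, of "k + 1"] a[of k]]
  show "integrable PP (\<lambda>yz. kern_prod k x yz * pair_diff u yz)"
    unfolding eq by (intro Bochner_Integration.integrable_diff int)
  show "(\<integral>yz. kern_prod k x yz * pair_diff u yz \<partial>PP) = avg_dev u (k + 1) x - avg_dev u k x"
    unfolding eq by (subst Bochner_Integration.integral_diff) (use int kern_integral[OF x] in \<open>auto simp: avg_dev_def\<close>)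
qed

lemma average_diff_integral:
  assumes x: "x \<in> space \<mu>" "x0 \<in> space \<mu>" and av: "averageable u x" "averageable u x0"
  shows "(\<integral>yz. (kern k x (fst yz) - kern k x0 (fst yz)) * kern k x0 (snd yz) * pair_diff u yz \<partial>PP)
     = (avg_dev u k x + u x) - (avg_dev u k x0 + u x0)"
proof -
  let ?f = "\<lambda>y. (kern k x y - kern k x0 y) * (u y - u x0)"
  let ?b = "\<lambda>z. kern k x0 z * (u z - u x0)"
  let ?K = "\<lambda>y. kern k x y - kern k x0 y"
  have ax: "integrable \<mu> (\<lambda>y. kern k x y * (u y - u x))" and b: "integrable \<mu> ?b"
    using av by (auto simp: averageable_def)
  note ki = kern_integrable[OF x(1), of k] kern_integrable[OF x(2), of k]
  have feq: "?f = (\<lambda>y. kern k x y * (u y - u x) + kern k x y * (u x - u x0) - ?b y)"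
    by (auto simp: algebra_simps)
  have f: "integrable \<mu> ?f"
    unfolding feq by (intro Bochner_Integration.integrable_diff Bochner_Integration.integrable_add ax b integrable_mult_left ki)
  have fint: "(\<integral>y. ?f y \<partial>\<mu>) = avg_dev u k x + (u x - u x0) - avg_dev u k x0"
    unfolding feq avg_dev_def
    by (subst Bochner_Integration.integral_diff, (intro Bochner_Integration.integrable_add ax b integrable_mult_left ki)+,
        subst Bochner_Integration.integral_add, (intro ax integrable_mult_left ki)+) (simp add: kern_integral x)
  have K: "integrable \<mu> ?K" by (intro Bochner_Integration.integrable_diff ki)
  have Kint: "(\<integral>y. ?K y \<partial>\<mu>) = 0"
    by (subst Bochner_Integration.integral_diff[OF ki]) (simp add: kern_integral x)
  have eq: "(kern k x (fst yz) - kern k x0 (fst yz)) * kern k x0 (snd yz) * pair_diff u yz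
      = ?f (fst yz) * kern k x0 (snd yz) - ?K (fst yz) * ?b (snd yz)" for yz
    by (simp add: pair_diff_def algebra_simps)
  note int = product_integral[OF f ki(2)] product_integral[OF K b]
  show ?thesis
    unfolding eq by (subst Bochner_Integration.integral_diff[OF int(1,3)])
      (simp add: int(2,4) fint Kint kern_integral x)
qed

text \<open>
  The differences are bounded, up to a constant, by the terms of the convergent series that defines the
  oscillation.
\<close>

lemma average_diff_tendsto_0:
  assumes x: "x \<in> space \<mu>" "x0 \<in> space \<mu>" and av: "averageable u x" "averageable u x0"
    and u [measurable]: "u \<in> borel_measurable \<mu>" and fin: "osc (\<lambda>_. pair_diff u) x x0 < top"
  shows "(\<lambda>N. (avg_dev u (- int N) x + u x) - (avg_dev u (- int N) x0 + u x0)) \<longlonglongrightarrow> 0"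
proof -
  let ?R = "\<lambda>k. (avg_dev u k x + u x) - (avg_dev u k x0 + u x0)"
  define T where "T k = (\<integral>\<^sup>+ yz. ennreal (ramp_win k x x0 yz * \<bar>pair_diff u yz\<bar>) \<partial>PP)" for k
  have dum [measurable]: "pair_diff u \<in> borel_measurable PP" unfolding pair_diff_def by measurable
  have rm [measurable]: "ramp_win k x x0 \<in> borel_measurable PP" for k by (rule ramp_win_measurable1[OF x])
  have "osc (\<lambda>_. pair_diff u) x x0 = (\<integral>\<^sup>+ k. T k \<partial>count_space UNIV)"
    unfolding osc_def T_def
    by (subst nn_integral_K3) (auto intro!: measurable_K3 borel_measurable_times measurable_compose[OF _ measurable_ennreal] borel_measurable_abs dum rm)
  with fin have "(\<integral>\<^sup>+ k. T k \<partial>count_space UNIV) < top" by simp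
  from nn_integral_int_tendsto_0[OF this, of "\<lambda>N. - int N"]
  have T0: "(\<lambda>N. T (- int N)) \<longlonglongrightarrow> 0" by (simp add: inj_def)
  have bound: "ennreal \<bar>?R k\<bar> \<le> ennreal kap_const * T k" if k: "2 powr real_of_int k * \<rho> x x0 < 1" for k
  proof -
    let ?g = "\<lambda>yz. (kern k x (fst yz) - kern k x0 (fst yz)) * kern k x0 (snd yz) * pair_diff u yz"
    have gm: "?g \<in> borel_measurable PP" using x by measurable
    have le: "(\<integral>\<^sup>+ yz. ennreal (norm (?g yz)) \<partial>PP) \<le> ennreal kap_const * T k"
    proof -
      have "(\<integral>\<^sup>+ yz. ennreal (norm (?g yz)) \<partial>PP) \<le> (\<integral>\<^sup>+ yz. ennreal kap_const * ennreal (ramp_win k x x0 yz * \<bar>pair_diff u yz\<bar>) \<partial>PP)"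
      proof (rule nn_integral_mono)
        fix yz assume yz: "yz \<in> space PP"
        from mult_right_mono[OF kern_diff_prod[OF x yz k], of "\<bar>pair_diff u yz\<bar>"]
        show "ennreal (norm (?g yz)) \<le> ennreal kap_const * ennreal (ramp_win k x x0 yz * \<bar>pair_diff u yz\<bar>)"
          using kap_const_pos ramp_win_nonneg[OF x] by (simp add: ennreal_mult[symmetric] abs_mult mult.assoc ennreal_leI)
      qed
      also have "\<dots> = ennreal kap_const * T k"
        unfolding T_def by (rule nn_integral_cmult) measurable
      finally show ?thesis .
    qed
    have "?R k = (\<integral>yz. ?g yz \<partial>PP)" by (rule average_diff_integral[OF x av, symmetric])
    then have "ennreal \<bar>?R k\<bar> = ennreal (norm (\<integral>yz. ?g yz \<partial>PP))" by simp
    also have "\<dots> \<le> (\<integral>\<^sup>+ yz. ennreal (norm (?g yz)) \<partial>PP)"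
    proof (cases "integrable PP ?g")
      case True
      then show ?thesis by (rule integral_norm_bound_ennreal)
    next
      case False
      then show ?thesis by (simp add: not_integrable_integral_eq)
    qed
    also note le
    finally show ?thesis .
  qed
  have "eventually (\<lambda>N. 2 powr real_of_int (- int N) * \<rho> x x0 < 1) sequentially"
  proof -
    have "(\<lambda>N. (1 / 2 :: real) ^ N * \<rho> x x0) \<longlonglongrightarrow> 0 * \<rho> x x0"
      by (intro tendsto_intros) auto
    then have "eventually (\<lambda>N. (1 / 2 :: real) ^ N * \<rho> x x0 < 1) sequentially"
      by (intro order_tendstoD(2)) auto
    moreover have "2 powr real_of_int (- int N) = (1 / 2 :: real) ^ N" for N
      using powr_realpow[of 2 N] by (simp add: powr_minus_divide power_one_over)
    ultimately show ?thesis by (simp only:)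
  qed
  then have ev: "eventually (\<lambda>N. ennreal \<bar>?R (- int N)\<bar> \<le> ennreal kap_const * T (- int N)) sequentially"
    by eventually_elim (rule bound)
  have "(\<lambda>N. ennreal kap_const * T (- int N)) \<longlonglongrightarrow> ennreal kap_const * 0"
    by (intro ennreal_tendsto_cmult T0) simp
  then have "(\<lambda>N. ennreal \<bar>?R (- int N)\<bar>) \<longlonglongrightarrow> 0"
    by (intro tendsto_sandwich[OF _ ev tendsto_const]) auto
  then have "(\<lambda>N. \<bar>?R (- int N)\<bar>) \<longlonglongrightarrow> 0"
    using tendsto_ennrealD[of "\<lambda>N. \<bar>?R (- int N)\<bar>" 0 sequentially] by simp
  then show ?thesis by (rule tendsto_rabs_zero_cancel)
qed

text \<open>
  The integral over pairs at scale \<open>k\<close> is a difference of two consecutive averages, normalised at \<open>x0\<close>.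
  In the symmetric partial sums the upper ends tend to \<open>u x - u x0\<close> and the lower ends to \<open>0\<close>.
\<close>

lemma superposition_telescope:
  assumes x: "x \<in> space \<mu>" "x0 \<in> space \<mu>" and av: "averageable u x" "averageable u x0"
    and u [measurable]: "u \<in> borel_measurable \<mu>" and fin: "osc (\<lambda>_. pair_diff u) x x0 < top"
  shows "superposition (\<lambda>_. pair_diff u) x0 x = u x - u x0"
proof -
  have dum [measurable]: "pair_diff u \<in> borel_measurable PP" unfolding pair_diff_def by measurable
  let ?h = "\<lambda>w. (kern_prod (fst w) x (snd w) - kern_prod (fst w) x0 (snd w)) * pair_diff u (snd w)"
  let ?S = "\<lambda>k. avg_dev u (k + 1) x - avg_dev u k x - (avg_dev u (k + 1) x0 - avg_dev u k x0)"
  have int: "integrable K3 ?h"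
    using kern_prod_diff_integrable[where F = "\<lambda>_. pair_diff u", OF x dum fin] .
  then have int': "integrable K3 (\<lambda>(k, yz). ?h (k, yz))" by (simp add: split_beta')
  have S: "(\<integral>yz. ?h (k, yz) \<partial>PP) = ?S k" for k
  proof -
    have "(\<lambda>yz. ?h (k, yz)) = (\<lambda>yz. kern_prod k x yz * pair_diff u yz - kern_prod k x0 yz * pair_diff u yz)"
      by (simp add: algebra_simps)
    then show ?thesis
      using kern_prod_integral[OF x(1) av(1), of k] kern_prod_integral[OF x(2) av(2), of k] by simp
  qed
  interpret K: pair_sigma_finite "count_space (UNIV :: int set)" PP
    by (intro pair_sigma_finite.intro sigma_finite_PP sigma_finite_measure_count_space)
  have Sint: "integrable (count_space UNIV) ?S"
    using K.integrable_fst'[OF int] by (simp only: S)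
  have "superposition (\<lambda>_. pair_diff u) x0 x = (\<integral>k. ?S k \<partial>count_space UNIV)"
    unfolding superposition_def using K.integral_fst'[OF int] by (simp only: S)
  then have lim1: "(\<lambda>N. \<Sum>k\<in>{- int N..<int N}. ?S k) \<longlonglongrightarrow> superposition (\<lambda>_. pair_diff u) x0 x"
    using integral_count_int_limit[OF Sint] by simp
  have tele: "(\<Sum>k\<in>{- int N..<int N}. f (k + 1) - f k) = f (int N) - f (- int N)" for f :: "int \<Rightarrow> real" and N
  proof (induction N)
    case (Suc N)
    have "{- int (Suc N)..<int (Suc N)} = insert (- int (Suc N)) (insert (int N) {- int N..<int N})" by auto
    then show ?case using Suc by (simp add: add.commute)
  qed simp
  have sumS: "(\<Sum>k\<in>{- int N..<int N}. ?S k) = avg_dev u (int N) x - avg_dev u (int N) x0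
      - (((avg_dev u (- int N) x + u x) - (avg_dev u (- int N) x0 + u x0)) - (u x - u x0))" for N
    using tele[of "\<lambda>k. avg_dev u k x - avg_dev u k x0" N] by (simp add: algebra_simps)
  have "(\<lambda>N. \<Sum>k\<in>{- int N..<int N}. ?S k) \<longlonglongrightarrow> 0 - 0 - (0 - (u x - u x0))"
    unfolding sumS using av
    by (intro tendsto_diff tendsto_const average_diff_tendsto_0 x u fin) (auto simp: averageable_def)
  from LIMSEQ_unique[OF lim1 this] show ?thesis by simp
qed

end

section \<open>Splitting by the cheapest exponent\<close>

context nontrivial_regular_metric_measure
begin

lemma AE_exists:
  assumes "AE x in \<mu>. P x"
  obtains x where "x \<in> space \<mu>" "P x"
proof -
  from assms obtain N where N: "{x \<in> space \<mu>. \<not> P x} \<subseteq> N" "emeasure \<mu> N = 0" "N \<in> sets \<mu>"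
    by (rule AE_E)
  have "\<exists>x\<in>space \<mu>. P x"
  proof (rule ccontr)
    assume "\<not> (\<exists>x\<in>space \<mu>. P x)"
    then have "emeasure \<mu> (space \<mu>) \<le> emeasure \<mu> N"
      using N by (intro emeasure_mono) auto
    then show False using nontrivial N by simp
  qed
  then show ?thesis using that by blast
qed

lemma eventually_not_small: "eventually (\<lambda>N. \<not> small (int N)) sequentially"
proof -
  obtain x where x: "x \<in> space \<mu>" using AE_exists[of "\<lambda>_. True"] by auto
  obtain y where y: "y \<in> space \<mu>" "0 < \<rho> x y" using AE_exists[OF AE_rho_pos[OF x]] .
  obtain N0 where "1 / \<rho> x y < 2 ^ N0" using real_arch_pow[of 2 "1 / \<rho> x y"] by auto
  then have N0: "1 < \<rho> x y * 2 ^ N0" using y(2) by (simp add: field_simps)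
  have "eventually (\<lambda>N. 1 < \<rho> x y * 2 ^ N) sequentially"
    using eventually_ge_at_top[of N0]
  proof eventually_elim
    case (elim N)
    have "\<rho> x y * 2 ^ N0 \<le> \<rho> x y * 2 ^ N"
      using elim y(2) by (intro mult_left_mono power_increasing) auto
    then show ?case using N0 by linarith
  qed
  then show ?thesis
  proof eventually_elim
    case (elim N)
    then have "1 < 2 powr real_of_int (int N) * \<rho> x y"
      by (simp add: powr_realpow mult.commute)
    then show ?case using x y(1) unfolding small_def by fastforce
  qed
qed

lemma osc_sym:
  assumes "x \<in> space \<mu>" "x' \<in> space \<mu>"
  shows "osc F x x' = osc F x' x"
  using rho_sym[OF assms] by (simp add: osc_def ramp_win_def add.commute)

lemma frac_sobolev_cong_AE:
  assumes v: "v \<in> frac_sobolev \<mu> edist n s p" and w: "w \<in> borel_measurable \<mu>" and ae: "AE x in \<mu>. w x = v x + a"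
  shows "w \<in> frac_sobolev \<mu> edist n s p"
proof -
  have "(\<integral>\<^sup>+ (x, y). frac_quotient edist n s p w x y \<partial>PP) = (\<integral>\<^sup>+ (x, y). frac_quotient edist n s p v x y \<partial>PP)"
  proof (rule nn_integral_cong_AE)
    show "AE xx in PP. (case xx of (x, y) \<Rightarrow> frac_quotient edist n s p w x y) = (case xx of (x, y) \<Rightarrow> frac_quotient edist n s p v x y)"
      using AE_fst_snd[OF ae] by eventually_elim (simp add: frac_quotient_def split_beta')
  qed
  with v w show ?thesis by (simp add: frac_sobolev_def)
qed

end

locale min_decomposition = nontrivial_regular_metric_measure \<mu> \<rho> n c C
  for \<mu> :: "'a measure" and \<rho> n c C +
  fixes l :: nat and s p :: "nat \<Rightarrow> real" and u :: "'a \<Rightarrow> real"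
  assumes l: "1 \<le> l"
    and s: "\<And>i. i \<in> {1..l} \<Longrightarrow> 0 < s i" "\<And>i. i \<in> {1..l} \<Longrightarrow> s i < 1"
    and p: "\<And>i. i \<in> {1..l} \<Longrightarrow> 1 \<le> p i"
    and u: "u \<in> frac_min_space \<mu> edist n l s p"
begin

lemma u_measurable [measurable]: "u \<in> borel_measurable \<mu>"
  using u by (simp add: frac_min_space_def)

lemma pair_diff_measurable [measurable]: "pair_diff u \<in> borel_measurable PP"
  unfolding pair_diff_def by measurable

definition cost :: "nat \<Rightarrow> int \<Rightarrow> 'a \<times> 'a \<Rightarrow> real" where
  "cost j k yz = 2 powr (s j * p j * real_of_int k) * \<bar>pair_diff u yz\<bar> powr p j"

text \<open>
  The smallest index of minimal cost, described by finitely many inequalities to keep it measurable.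
\<close>

definition cheapest :: "nat \<Rightarrow> int \<Rightarrow> 'a \<times> 'a \<Rightarrow> bool" where
  "cheapest i k yz \<longleftrightarrow> (\<forall>j\<in>{1..l}. cost i k yz \<le> cost j k yz) \<and> (\<forall>j\<in>{1..<i}. cost i k yz < cost j k yz)"

definition piece :: "nat \<Rightarrow> int \<Rightarrow> 'a \<times> 'a \<Rightarrow> real" where
  "piece i k yz = (if cheapest i k yz then pair_diff u yz else 0)"

lemma piece_measurable [measurable]: "piece i k \<in> borel_measurable PP"
proof -
  have [measurable]: "cost j k \<in> borel_measurable PP" for j k unfolding cost_def by measurable
  show ?thesis unfolding piece_def cheapest_def by measurable
qed

lemma piece_sum: "(\<Sum>i=1..l. piece i k yz) = pair_diff u yz"
proof -
  let ?c = "\<lambda>j. cost j k yz"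
  let ?I = "{i\<in>{1..l}. \<forall>j\<in>{1..l}. ?c i \<le> ?c j}"
  have "finite (?c ` {1..l})" "?c ` {1..l} \<noteq> {}" using l by auto
  from Min_in[OF this] obtain i where "i \<in> {1..l}" "?c i = Min (?c ` {1..l})" by auto
  then have "i \<in> ?I" by auto
  then have ne: "?I \<noteq> {}" by blast
  define i0 where "i0 = Min ?I"
  have i0: "i0 \<in> ?I" unfolding i0_def by (rule Min_in) (use ne in auto)
  have i0_le: "i0 \<le> i" if "i \<in> ?I" for i unfolding i0_def by (rule Min_le) (use that in auto)
  have iff: "cheapest i k yz \<longleftrightarrow> i = i0" if i: "i \<in> {1..l}" for i
  proof
    assume ch: "cheapest i k yz"
    then have "i \<in> ?I" using i by (auto simp: cheapest_def)
    then have "i0 \<le> i" by (rule i0_le)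
    moreover have "\<not> i0 < i"
    proof
      assume "i0 < i"
      then have "?c i < ?c i0" using ch i0 by (auto simp: cheapest_def)
      moreover have "?c i0 \<le> ?c i" using i0 i by auto
      ultimately show False by simp
    qed
    ultimately show "i = i0" by simp
  next
    assume eq: "i = i0"
    have "?c i0 < ?c j" if j: "j \<in> {1..<i0}" for j
    proof (rule ccontr)
      assume "\<not> ?c i0 < ?c j"
      then have "\<forall>j'\<in>{1..l}. ?c j \<le> ?c j'" using i0 by (auto intro: order.trans)
      then have "j \<in> ?I" using j i0 by auto
      then show False using i0_le[of j] j by auto
    qed
    then show "cheapest i k yz" using i0 eq by (auto simp: cheapest_def)
  qed
  have "(\<Sum>i=1..l. piece i k yz) = (\<Sum>i=1..l. if i = i0 then pair_diff u yz else 0)"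
    by (intro sum.cong refl) (simp add: piece_def iff)
  also have "\<dots> = pair_diff u yz" using i0 by (simp add: sum.delta)
  finally show ?thesis .
qed

definition eterm :: "nat \<Rightarrow> int \<Rightarrow> 'a \<times> 'a \<Rightarrow> ennreal" where
  "eterm i k yz = ennreal (2 powr ((real n + s i * p i) * real_of_int k) * \<bar>piece i k yz\<bar> powr p i) *
      indicator {yz. 2 powr real_of_int k * \<rho> (fst yz) (snd yz) < 4} yz"

lemma eterm_measurable [measurable]: "eterm i k \<in> borel_measurable PP"
  unfolding eterm_def by measurable

definition tconst :: real where "tconst = (\<Sum>j=1..l. tail_const (real n + s j * p j))"

lemma exponent_pos: "j \<in> {1..l} \<Longrightarrow> 0 < real n + s j * p j"
  using dim_pos s[of j] p[of j] by (intro add_pos_nonneg) (auto intro: mult_nonneg_nonneg)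

lemma tconst_ge: "j \<in> {1..l} \<Longrightarrow> tail_const (real n + s j * p j) \<le> tconst"
  unfolding tconst_def
  by (rule member_le_sum[where f = "\<lambda>j. tail_const (real n + s j * p j)"])
     (auto intro!: less_imp_le tail_const_pos exponent_pos)

lemma tconst_pos: "0 < tconst"
  using tconst_ge[of 1] tail_const_pos[OF exponent_pos[of 1]] l by auto

text \<open>
  Since \<open>i\<close> is the cheapest index, its cost can be replaced by the cost of any \<open>j\<close>; what is left is a
  geometric series in \<open>k\<close>, dominated by the smallest scale at which the pair is still visible.
\<close>

lemma eterm_sum_le:
  assumes i: "i \<in> {1..l}" and j: "j \<in> {1..l}" and pos: "0 < \<rho> (fst yz) (snd yz)"
  shows "(\<integral>\<^sup>+ k. eterm i k yz \<partial>count_space UNIV) \<le> ennreal tconst * frac_quotient edist n (s j) (p j) u (fst yz) (snd yz)"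
proof -
  let ?a = "real n + s j * p j" and ?r = "\<rho> (fst yz) (snd yz)" and ?D = "\<bar>pair_diff u yz\<bar> powr p j"
  let ?I = "\<lambda>k. indicator {k. 2 powr real_of_int k * ?r < 4} k :: ennreal"
  have "(\<integral>\<^sup>+ k. eterm i k yz \<partial>count_space UNIV) \<le> (\<integral>\<^sup>+ k. ennreal ?D * (ennreal (2 powr (?a * real_of_int k)) * ?I k) \<partial>count_space UNIV)"
  proof (rule nn_integral_mono)
    fix k :: int
    have "2 powr ((real n + s i * p i) * real_of_int k) * \<bar>piece i k yz\<bar> powr p i \<le> ?D * 2 powr (?a * real_of_int k)"
    proof (cases "cheapest i k yz")
      case True
      have "2 powr ((real n + s i * p i) * real_of_int k) * \<bar>piece i k yz\<bar> powr p i = 2 powr (real n * real_of_int k) * cost i k yz"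
        using True by (simp add: piece_def cost_def distrib_right powr_add)
      also have "\<dots> \<le> 2 powr (real n * real_of_int k) * cost j k yz"
        using True j by (intro mult_left_mono) (auto simp: cheapest_def)
      also have "\<dots> = ?D * 2 powr (?a * real_of_int k)"
        by (simp add: cost_def distrib_right powr_add)
      finally show ?thesis .
    next
      case False
      then show ?thesis using p[OF i] by (simp add: piece_def)
    qed
    then show "eterm i k yz \<le> ennreal ?D * (ennreal (2 powr (?a * real_of_int k)) * ?I k)"
      by (auto simp: eterm_def indicator_def ennreal_mult[symmetric] intro: ennreal_leI)
  qed
  also have "\<dots> = ennreal ?D * (\<integral>\<^sup>+ k. ennreal (2 powr (?a * real_of_int k)) * ?I k \<partial>count_space UNIV)"
    by (rule nn_integral_cmult) simp
  also have "\<dots> \<le> ennreal ?D * ennreal (tail_const ?a * ?r powr (- ?a))"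
    by (intro mult_left_mono dyadic_tail_sum exponent_pos j pos) simp
  also have "\<dots> \<le> ennreal ?D * ennreal (tconst * ?r powr (- ?a))"
    by (intro mult_left_mono ennreal_leI mult_right_mono tconst_ge j) auto
  also have "\<dots> = ennreal tconst * frac_quotient edist n (s j) (p j) u (fst yz) (snd yz)"
    using tconst_pos by (simp add: frac_quotient_real[where d = edist, OF pos] ennreal_mult[symmetric] pair_diff_def mult_ac)
  finally show ?thesis .
qed

lemma energy_eq: "energy (s i) (p i) (piece i) = (\<integral>\<^sup>+ yz. \<integral>\<^sup>+ k. eterm i k yz \<partial>count_space UNIV \<partial>PP)"
  unfolding energy_def eterm_def[symmetric]
  by (rule nn_integral_swap_int[OF sigma_finite_PP eterm_measurable, symmetric])

text \<open>
  The preceding bound holds for all \<open>j\<close>, in particular for the one that attains the minimum.  The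
  constant stands on the left because the right-hand side need not be measurable.
\<close>

lemma energy_finite:
  assumes i: "i \<in> {1..l}"
  shows "energy (s i) (p i) (piece i) < top"
proof -
  let ?m = "\<lambda>x y. MIN j\<in>{1..l}. frac_quotient edist n (s j) (p j) u x y"
  have m: "(\<lambda>yz. \<integral>\<^sup>+ k. eterm i k yz \<partial>count_space UNIV) \<in> borel_measurable PP"
    by (rule borel_measurable_nn_integral_int[OF eterm_measurable])
  have "ennreal (1 / tconst) * energy (s i) (p i) (piece i) = (\<integral>\<^sup>+ yz. ennreal (1 / tconst) * (\<integral>\<^sup>+ k. eterm i k yz \<partial>count_space UNIV) \<partial>PP)"
    unfolding energy_eq by (rule nn_integral_cmult[OF m, symmetric])
  also have "\<dots> \<le> (\<integral>\<^sup>+ (x, y). ?m x y \<partial>PP)"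
  proof (rule nn_integral_mono_AE)
    show "AE yz in PP. ennreal (1 / tconst) * (\<integral>\<^sup>+ k. eterm i k yz \<partial>count_space UNIV) \<le> (case yz of (x, y) \<Rightarrow> ?m x y)"
      using AE_pair_rho_pos
    proof eventually_elim
      case (elim yz)
      let ?q = "\<lambda>j. frac_quotient edist n (s j) (p j) u (fst yz) (snd yz)"
      have "finite (?q ` {1..l})" "?q ` {1..l} \<noteq> {}" using l by auto
      from Min_in[OF this] obtain j where j: "j \<in> {1..l}" "?m (fst yz) (snd yz) = ?q j" by auto
      have "ennreal (1 / tconst) * (\<integral>\<^sup>+ k. eterm i k yz \<partial>count_space UNIV) \<le> ennreal (1 / tconst) * (ennreal tconst * ?q j)"
        by (intro mult_left_mono eterm_sum_le i j elim) simp
      also have "\<dots> = ?q j"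
        using tconst_pos by (simp add: mult.assoc[symmetric] ennreal_mult[symmetric])
      finally show ?case using j by (simp add: split_beta')
    qed
  qed
  also have "\<dots> < top" using u by (simp add: frac_min_space_def)
  finally show ?thesis using tconst_pos by (auto simp: ennreal_mult_less_top)
qed

definition row :: "nat \<Rightarrow> int \<Rightarrow> 'a \<Rightarrow> ennreal" where
  "row i k x = (\<integral>\<^sup>+ y. eterm i k (x, y) \<partial>\<mu>)"

lemma AE_row_finite:
  assumes i: "i \<in> {1..l}"
  shows "AE x in \<mu>. (\<integral>\<^sup>+ k. row i k x \<partial>count_space UNIV) < top"
proof -
  have m: "(\<lambda>yz. \<integral>\<^sup>+ k. eterm i k yz \<partial>count_space UNIV) \<in> borel_measurable PP"
    by (rule borel_measurable_nn_integral_int[OF eterm_measurable])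
  have "(\<integral>\<^sup>+ x. \<integral>\<^sup>+ y. \<integral>\<^sup>+ k. eterm i k (x, y) \<partial>count_space UNIV \<partial>\<mu> \<partial>\<mu>) = energy (s i) (p i) (piece i)"
    unfolding energy_eq by (rule nn_integral_fst[OF m])
  then have "(\<integral>\<^sup>+ x. \<integral>\<^sup>+ y. \<integral>\<^sup>+ k. eterm i k (x, y) \<partial>count_space UNIV \<partial>\<mu> \<partial>\<mu>) \<noteq> \<infinity>"
    using energy_finite[OF i] by simp
  moreover have "(\<lambda>x. \<integral>\<^sup>+ y. \<integral>\<^sup>+ k. eterm i k (x, y) \<partial>count_space UNIV \<partial>\<mu>) \<in> borel_measurable \<mu>"
    using m by (intro borel_measurable_nn_integral) (simp add: split_beta')
  ultimately have "AE x in \<mu>. (\<integral>\<^sup>+ y. \<integral>\<^sup>+ k. eterm i k (x, y) \<partial>count_space UNIV \<partial>\<mu>) \<noteq> \<infinity>"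
    by (intro nn_integral_PInf_AE)
  with AE_space show ?thesis
  proof eventually_elim
    case (elim x)
    have "(\<integral>\<^sup>+ y. \<integral>\<^sup>+ k. eterm i k (x, y) \<partial>count_space UNIV \<partial>\<mu>) = (\<integral>\<^sup>+ k. row i k x \<partial>count_space UNIV)"
      unfolding row_def
    proof (rule nn_integral_swap_int[OF sigma_finite_measure_axioms])
      show "(\<lambda>y. eterm i k (x, y)) \<in> borel_measurable \<mu>" for k
        by (rule measurable_compose[OF measurable_Pair1'[OF elim(1)] eterm_measurable])
    qed
    then show ?case using elim by (simp add: less_top)
  qed
qed

text \<open>
  Splitting at the level \<open>\<lambda>\<close> bounds the first moment by \<open>\<lambda>\<close> and a \<open>p\<close>-th moment that belongs to the
  energy.
\<close>

lemma kern_piece_integral: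
  assumes i: "i \<in> {1..l}" and x: "x \<in> space \<mu>" and M: "\<And>y. y \<in> space \<mu> \<Longrightarrow> kern k x y \<le> M" "0 \<le> M" and lam: "0 < lam"
  shows "(\<integral>\<^sup>+ y. ennreal (kern k x y * \<bar>piece i k (x, y)\<bar>) \<partial>\<mu>) \<le>
    ennreal lam + ennreal (lam powr (1 - p i) * M * 2 powr (- (real n + s i * p i) * real_of_int k)) * row i k x"
proof -
  let ?e = "(real n + s i * p i) * real_of_int k"
  let ?B = "lam powr (1 - p i) * M * 2 powr (- (real n + s i * p i) * real_of_int k)"
  have em: "(\<lambda>y. eterm i k (x, y)) \<in> borel_measurable \<mu>"
    by (rule measurable_compose[OF measurable_Pair1'[OF x] eterm_measurable])
  have km: "kern k x \<in> borel_measurable \<mu>" using kern_integrable[OF x] by auto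
  have "(\<integral>\<^sup>+ y. ennreal (kern k x y * \<bar>piece i k (x, y)\<bar>) \<partial>\<mu>) \<le> (\<integral>\<^sup>+ y. ennreal lam * ennreal (kern k x y) + ennreal ?B * eterm i k (x, y) \<partial>\<mu>)"
  proof (rule nn_integral_mono)
    fix y assume y: "y \<in> space \<mu>"
    let ?f = "\<bar>piece i k (x, y)\<bar>" and ?k = "kern k x y"
    have k0: "0 \<le> ?k" by (rule kern_nonneg[OF x])
    show "ennreal (?k * ?f) \<le> ennreal lam * ennreal ?k + ennreal ?B * eterm i k (x, y)"
    proof (cases "2 powr real_of_int k * \<rho> x y < 4")
      case True
      have "?k * ?f \<le> ?k * (lam + lam powr (1 - p i) * ?f powr p i)"
        by (intro mult_left_mono linear_le_power_split lam p i k0) simp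
      also have "\<dots> = lam * ?k + lam powr (1 - p i) * ?f powr p i * ?k"
        by (simp add: algebra_simps)
      also have "\<dots> \<le> lam * ?k + lam powr (1 - p i) * ?f powr p i * M"
        by (intro add_left_mono mult_left_mono M y) auto
      also have "lam powr (1 - p i) * ?f powr p i * M = ?B * (2 powr ?e * ?f powr p i)"
      proof -
        have one: "2 powr (- (real n + s i * p i) * real_of_int k) * 2 powr ?e = 1"
          by (simp add: powr_add[symmetric] distrib_right[symmetric])
        have "?B * (2 powr ?e * ?f powr p i) = (lam powr (1 - p i) * ?f powr p i * M) *
            (2 powr (- (real n + s i * p i) * real_of_int k) * 2 powr ?e)"
          by (simp only: mult_ac)
        also have "\<dots> = lam powr (1 - p i) * ?f powr p i * M"
          by (simp only: one mult_1_right)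
        finally show ?thesis by (rule sym)
      qed
      finally have "ennreal (?k * ?f) \<le> ennreal (lam * ?k + ?B * (2 powr ?e * ?f powr p i))"
        by (rule ennreal_leI)
      also have "\<dots> = ennreal lam * ennreal ?k + ennreal ?B * eterm i k (x, y)"
        using True lam k0 M(2) by (simp add: eterm_def ennreal_mult[symmetric])
      finally show ?thesis .
    next
      case False
      then show ?thesis by (simp add: kern_eq_0)
    qed
  qed
  also have "\<dots> = ennreal lam * (\<integral>\<^sup>+ y. ennreal (kern k x y) \<partial>\<mu>) + ennreal ?B * row i k x"
  proof -
    have km': "(\<lambda>y. ennreal (kern k x y)) \<in> borel_measurable \<mu>"
      by (rule measurable_compose[OF km measurable_ennreal])
    have "(\<integral>\<^sup>+ y. ennreal lam * ennreal (kern k x y) + ennreal ?B * eterm i k (x, y) \<partial>\<mu>)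
       = (\<integral>\<^sup>+ y. ennreal lam * ennreal (kern k x y) \<partial>\<mu>) + (\<integral>\<^sup>+ y. ennreal ?B * eterm i k (x, y) \<partial>\<mu>)"
      by (intro nn_integral_add borel_measurable_times_ennreal borel_measurable_const km' em)
    then show ?thesis unfolding row_def by (simp only: nn_integral_cmult[OF km'] nn_integral_cmult[OF em])
  qed
  also have "(\<integral>\<^sup>+ y. ennreal (kern k x y) \<partial>\<mu>) = 1"
    using kern_integral[OF x, of k] kern_nonneg[OF x] by (subst nn_integral_eq_integral[OF kern_integrable[OF x]]) auto
  finally show ?thesis by simp
qed

lemma kern_pair_diff_le:
  assumes x: "x \<in> space \<mu>"
  shows "(\<integral>\<^sup>+ y. ennreal (norm (kern k x y * (u y - u x))) \<partial>\<mu>) \<le> (\<Sum>i=1..l. \<integral>\<^sup>+ y. ennreal (kern k x y * \<bar>piece i k (x, y)\<bar>) \<partial>\<mu>)"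
proof -
  have km: "kern k x \<in> borel_measurable \<mu>" using kern_integrable[OF x] by auto
  have pm: "(\<lambda>y. piece i k (x, y)) \<in> borel_measurable \<mu>" for i
    by (rule measurable_compose[OF measurable_Pair1'[OF x] piece_measurable])
  have "(\<integral>\<^sup>+ y. ennreal (norm (kern k x y * (u y - u x))) \<partial>\<mu>) \<le> (\<integral>\<^sup>+ y. (\<Sum>i=1..l. ennreal (kern k x y * \<bar>piece i k (x, y)\<bar>)) \<partial>\<mu>)"
  proof (rule nn_integral_mono)
    fix y
    have "norm (kern k x y * (u y - u x)) = kern k x y * \<bar>\<Sum>i=1..l. piece i k (x, y)\<bar>"
      using kern_nonneg[OF x, of k y] by (simp only: piece_sum) (simp add: pair_diff_def abs_mult abs_minus_commute)
    also have "\<dots> \<le> kern k x y * (\<Sum>i=1..l. \<bar>piece i k (x, y)\<bar>)"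
      by (intro mult_left_mono sum_abs kern_nonneg[OF x])
    finally have "ennreal (norm (kern k x y * (u y - u x))) \<le> ennreal (\<Sum>i=1..l. kern k x y * \<bar>piece i k (x, y)\<bar>)"
      by (simp add: sum_distrib_left ennreal_leI)
    also have "\<dots> = (\<Sum>i=1..l. ennreal (kern k x y * \<bar>piece i k (x, y)\<bar>))"
      using kern_nonneg[OF x, of k y] by (intro sum_ennreal[symmetric]) simp
    finally show "ennreal (norm (kern k x y * (u y - u x))) \<le> \<dots>" .
  qed
  also have "\<dots> = (\<Sum>i=1..l. \<integral>\<^sup>+ y. ennreal (kern k x y * \<bar>piece i k (x, y)\<bar>) \<partial>\<mu>)"
    by (intro nn_integral_sum) (use km pm in measurable)
  finally show ?thesis .
qed

text \<open>
  The rows are the terms of a convergent series and tend to \<open>0\<close>, so the limit superior of the mean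
  deviation is at most a multiple of \<open>\<lambda>\<close>, for every \<open>\<lambda> > 0\<close>.
\<close>

lemma averageable_if_rows_finite:
  assumes x: "x \<in> space \<mu>" and rows: "\<And>i. i \<in> {1..l} \<Longrightarrow> (\<integral>\<^sup>+ k. row i k x \<partial>count_space UNIV) < top"
  shows "averageable u x"
proof -
  have row_fin: "row i k x < top" if "i \<in> {1..l}" for i k
  proof -
    have "row i k x \<le> (\<integral>\<^sup>+ k. row i k x \<partial>count_space UNIV)"
      by (rule nn_integral_ge_point) simp
    then show ?thesis using rows[OF that] by (rule le_less_trans)
  qed
  have km: "kern k x \<in> borel_measurable \<mu>" for k using kern_integrable[OF x] by auto
  have int: "integrable \<mu> (\<lambda>y. kern k x y * (u y - u x))" for k
  proof (rule integrableI_bounded)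
    show "(\<lambda>y. kern k x y * (u y - u x)) \<in> borel_measurable \<mu>" using km by measurable
    let ?M = "1 / mass k x"
    have M: "kern k x y \<le> ?M" for y
      using bump_bounds(2)[of k x y] mass_pos[OF x, of k] unfolding kern_def by (intro divide_right_mono) auto
    have M0: "0 \<le> ?M" using mass_pos[OF x, of k] by simp
    have "(\<integral>\<^sup>+ y. ennreal (norm (kern k x y * (u y - u x))) \<partial>\<mu>) \<le> (\<Sum>i=1..l. \<integral>\<^sup>+ y. ennreal (kern k x y * \<bar>piece i k (x, y)\<bar>) \<partial>\<mu>)"
      by (rule kern_pair_diff_le[OF x])
    also have "\<dots> \<le> (\<Sum>i=1..l. ennreal 1 + ennreal (1 powr (1 - p i) * ?M * 2 powr (- (real n + s i * p i) * real_of_int k)) * row i k x)"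
      by (intro sum_mono kern_piece_integral x M M0) auto
    also have "\<dots> < top"
      using row_fin by (auto simp: ennreal_mult_less_top)
    finally show "(\<integral>\<^sup>+ y. ennreal (norm (kern k x y * (u y - u x))) \<partial>\<mu>) < \<infinity>" by simp
  qed
  moreover have "(\<lambda>N. avg_dev u (int N) x) \<longlonglongrightarrow> 0"
  proof (rule tendstoI)
    fix e :: real assume e: "0 < e"
    \<comment> \<open>The \<open>l\<close> indices together then contribute \<open>e / 2\<close>.\<close>
    define lam where "lam = e / (2 * real l)"
    have lam: "0 < lam" "real l * lam = e / 2" using e l by (auto simp: lam_def)
    define b where "b i = lam powr (1 - p i) / mass_const" for i
    let ?R = "\<lambda>N. \<Sum>i=1..l. ennreal lam + ennreal (b i) * row i (int N) x"
    have "?R \<longlonglongrightarrow> (\<Sum>i=1..l. ennreal lam + ennreal (b i) * 0)"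
      by (intro tendsto_sum tendsto_add tendsto_const ennreal_tendsto_cmult nn_integral_int_tendsto_0 rows) (auto simp: inj_def)
    also have "(\<Sum>i=1..l. ennreal lam + ennreal (b i) * 0) = ennreal (e / 2)"
      using lam(1) by (simp add: ennreal_of_nat_eq_real_of_nat ennreal_mult[symmetric] lam(2)[symmetric])
    finally have "eventually (\<lambda>N. ?R N < ennreal e) sequentially"
      using e by (intro order_tendstoD(2)) (auto simp: ennreal_less_iff)
    with eventually_not_small show "eventually (\<lambda>N. dist (avg_dev u (int N) x) 0 < e) sequentially"
    proof eventually_elim
      case (elim N)
      let ?k = "int N"
      have "ennreal \<bar>avg_dev u ?k x\<bar> \<le> (\<integral>\<^sup>+ y. ennreal (norm (kern ?k x y * (u y - u x))) \<partial>\<mu>)"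
        using integral_norm_bound_ennreal[OF int[of ?k]] by (simp add: avg_dev_def)
      also have "\<dots> \<le> (\<Sum>i=1..l. \<integral>\<^sup>+ y. ennreal (kern ?k x y * \<bar>piece i ?k (x, y)\<bar>) \<partial>\<mu>)"
        by (rule kern_pair_diff_le[OF x])
      also have "\<dots> \<le> ?R N"
      proof (rule sum_mono)
        fix i assume i: "i \<in> {1..l}"
        have M: "kern ?k x y \<le> vol ?k / mass_const" for y
          by (rule kern_upper[OF elim(1) x]) simp
        have M0: "0 \<le> vol ?k / mass_const" using mass_const_pos by simp
        have "vol ?k * 2 powr (- (real n + s i * p i) * real_of_int ?k) = 2 powr (- (s i * p i * real N))"
          by (simp add: powr_add[symmetric] algebra_simps)
        also have "\<dots> \<le> 2 powr 0"
          using s[OF i] p[OF i] by (intro powr_mono) auto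
        finally have 1: "vol ?k * 2 powr (- (real n + s i * p i) * real_of_int ?k) \<le> 1" by simp
        have "lam powr (1 - p i) * (vol ?k / mass_const) * 2 powr (- (real n + s i * p i) * real_of_int ?k)
          = b i * (vol ?k * 2 powr (- (real n + s i * p i) * real_of_int ?k))"
          by (simp add: b_def)
        also have "\<dots> \<le> b i * 1"
          using mass_const_pos by (intro mult_left_mono 1) (simp add: b_def)
        finally have 2: "ennreal (lam powr (1 - p i) * (vol ?k / mass_const) * 2 powr (- (real n + s i * p i) * real_of_int ?k)) \<le> ennreal (b i)"
          by (intro ennreal_leI) simp
        have "(\<integral>\<^sup>+ y. ennreal (kern ?k x y * \<bar>piece i ?k (x, y)\<bar>) \<partial>\<mu>) \<le> ennreal lam +
           ennreal (lam powr (1 - p i) * (vol ?k / mass_const) * 2 powr (- (real n + s i * p i) * real_of_int ?k)) * row i ?k x"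
          by (rule kern_piece_integral[OF i x M M0 lam(1)])
        also have "\<dots> \<le> ennreal lam + ennreal (b i) * row i ?k x"
          by (intro add_left_mono mult_right_mono 2) simp
        finally show "(\<integral>\<^sup>+ y. ennreal (kern ?k x y * \<bar>piece i ?k (x, y)\<bar>) \<partial>\<mu>) \<le> \<dots>" .
      qed
      also note elim(2)
      finally show ?case by (simp add: ennreal_less_iff dist_real_def)
    qed
  qed
  ultimately show ?thesis by (simp add: averageable_def)
qed

lemma osc_pair_diff_le:
  assumes x: "x \<in> space \<mu>" "x' \<in> space \<mu>"
  shows "osc (\<lambda>_. pair_diff u) x x' \<le> (\<Sum>i=1..l. osc (piece i) x x')"
proof -
  have m: "(\<lambda>w. ennreal (ramp_win (fst w) x x' (snd w) * \<bar>piece i (fst w) (snd w)\<bar>)) \<in> borel_measurable K3" for i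
    by (rule measurable_K3) (use x in \<open>simp only: fst_conv snd_conv, measurable\<close>)
  have "osc (\<lambda>_. pair_diff u) x x' \<le> (\<integral>\<^sup>+ w. (\<Sum>i=1..l. ennreal (ramp_win (fst w) x x' (snd w) * \<bar>piece i (fst w) (snd w)\<bar>)) \<partial>K3)"
    unfolding osc_def
  proof (rule nn_integral_mono)
    fix w :: "int \<times> 'a \<times> 'a"
    let ?r = "ramp_win (fst w) x x' (snd w)"
    have "?r * \<bar>pair_diff u (snd w)\<bar> = ?r * \<bar>\<Sum>i=1..l. piece i (fst w) (snd w)\<bar>" by (simp only: piece_sum)
    also have "\<dots> \<le> ?r * (\<Sum>i=1..l. \<bar>piece i (fst w) (snd w)\<bar>)"
      by (intro mult_left_mono sum_abs ramp_win_nonneg x)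
    finally have "ennreal (?r * \<bar>pair_diff u (snd w)\<bar>) \<le> ennreal (\<Sum>i=1..l. ?r * \<bar>piece i (fst w) (snd w)\<bar>)"
      by (simp add: sum_distrib_left ennreal_leI)
    also have "\<dots> = (\<Sum>i=1..l. ennreal (?r * \<bar>piece i (fst w) (snd w)\<bar>))"
      using ramp_win_nonneg[OF x] by (intro sum_ennreal[symmetric]) simp
    finally show "ennreal (?r * \<bar>pair_diff u (snd w)\<bar>) \<le> \<dots>" .
  qed
  also have "\<dots> = (\<Sum>i=1..l. osc (piece i) x x')"
    unfolding osc_def by (rule nn_integral_sum[OF m])
  finally show ?thesis .
qed

lemma superposition_sum:
  assumes x: "x \<in> space \<mu>" "x0 \<in> space \<mu>" and fin: "\<And>i. i \<in> {1..l} \<Longrightarrow> osc (piece i) x x0 < top"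
  shows "superposition (\<lambda>_. pair_diff u) x0 x = (\<Sum>i=1..l. superposition (piece i) x0 x)"
proof -
  let ?d = "\<lambda>w. kern_prod (fst w) x (snd w) - kern_prod (fst w) x0 (snd w)"
  have "superposition (\<lambda>_. pair_diff u) x0 x = (\<integral>w. (\<Sum>i=1..l. ?d w * piece i (fst w) (snd w)) \<partial>K3)"
    unfolding superposition_def by (intro Bochner_Integration.integral_cong refl) (simp only: sum_distrib_left[symmetric] piece_sum)
  also have "\<dots> = (\<Sum>i=1..l. superposition (piece i) x0 x)"
    unfolding superposition_def
    by (rule Bochner_Integration.integral_sum) (intro kern_prod_diff_integrable x piece_measurable fin)
  finally show ?thesis .
qed

text \<open>
  The identity \<open>\<Sum>i. v i = u - u x0\<close> holds almost everywhere only.  The first summand is changed on a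
  null set and by a constant, neither of which affects its seminorm.
\<close>

theorem min_space_decomposition: "u \<in> frac_sobolev_sum \<mu> edist n l s p"
proof -
  have "AE xx in PP. \<forall>i\<in>{1..l}. pow_osc (s i) (p i) (piece i) (fst xx) (snd xx) < top"
    by (intro eventually_ball_finite ballI AE_pow_osc_finite s piece_measurable energy_finite) auto
  with AE_pair_rho_pos AE_space
  have "AE xx in PP. fst xx \<in> space \<mu> \<and> snd xx \<in> space \<mu> \<and> (\<forall>i\<in>{1..l}. osc (piece i) (snd xx) (fst xx) < top)"
  proof eventually_elim
    case (elim xx)
    then have sp: "fst xx \<in> space \<mu>" "snd xx \<in> space \<mu>" by (auto simp: space_pair_measure)
    have "osc (piece i) (fst xx) (snd xx) < top" if "i \<in> {1..l}" for i
      using elim(3) that by (intro osc_finite[OF sp elim(1) s(1)[OF that] s(2)[OF that] p[OF that] piece_measurable]) auto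
    then show ?case using sp osc_sym[OF sp] by simp
  qed
  from pair.AE_pair[OF this]
  have osc_ae: "AE x0 in \<mu>. AE x in \<mu>. x0 \<in> space \<mu> \<and> x \<in> space \<mu> \<and> (\<forall>i\<in>{1..l}. osc (piece i) x x0 < top)"
    by simp
  have av_ae: "AE x in \<mu>. averageable u x"
  proof -
    have "AE x in \<mu>. \<forall>i\<in>{1..l}. (\<integral>\<^sup>+ k. row i k x \<partial>count_space UNIV) < top"
      by (intro eventually_ball_finite ballI AE_row_finite) auto
    with AE_space show ?thesis
      by eventually_elim (rule averageable_if_rows_finite, auto)
  qed
  obtain x0 where x0: "x0 \<in> space \<mu>" "averageable u x0"
    "AE x in \<mu>. x0 \<in> space \<mu> \<and> x \<in> space \<mu> \<and> (\<forall>i\<in>{1..l}. osc (piece i) x x0 < top)"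
    using AE_exists[OF eventually_conj[OF av_ae osc_ae]] by blast
  let ?v = "\<lambda>i. superposition (piece i) x0"
  have v: "?v i \<in> frac_sobolev \<mu> edist n (s i) (p i)" if i: "i \<in> {1..l}" for i
  proof (rule superposition_in_frac_sobolev)
    show "AE x in \<mu>. osc (piece i) x x0 < top" using x0(3) by eventually_elim (use i in auto)
  qed (use i x0 s p energy_finite piece_measurable in auto)
  have sum_ae: "AE x in \<mu>. (\<Sum>i=1..l. ?v i x) = u x - u x0"
    using x0(3) av_ae
  proof eventually_elim
    case (elim x)
    then have x: "x \<in> space \<mu>" and o: "\<And>i. i \<in> {1..l} \<Longrightarrow> osc (piece i) x x0 < top" by auto
    have "osc (\<lambda>_. pair_diff u) x x0 < top"
      using o by (intro le_less_trans[OF osc_pair_diff_le[OF x x0(1)]]) auto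
    then have "superposition (\<lambda>_. pair_diff u) x0 x = u x - u x0"
      using elim by (intro superposition_telescope x x0 u_measurable) auto
    then show ?case using superposition_sum[OF x x0(1) o] by simp
  qed
  \<comment> \<open>Only the first summand absorbs the constant \<open>u x0\<close> and the exceptional null set.\<close>
  define w where "w i = (if i = 1 then (\<lambda>x. u x - (\<Sum>i=2..l. ?v i x)) else ?v i)" for i :: nat
  have split: "(\<Sum>i=1..l. f i) = f 1 + (\<Sum>i=2..l. f i)" for f :: "nat \<Rightarrow> real"
    using l sum.atLeast_Suc_atMost[of 1 l f] by (simp add: numeral_2_eq_2)
  have vm: "?v i \<in> borel_measurable \<mu>" for i
    by (rule superposition_measurable[OF x0(1) piece_measurable])
  have w1: "w 1 \<in> frac_sobolev \<mu> edist n (s 1) (p 1)"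
  proof (rule frac_sobolev_cong_AE)
    show "?v 1 \<in> frac_sobolev \<mu> edist n (s 1) (p 1)" using l by (intro v) simp
    show "w 1 \<in> borel_measurable \<mu>"
      unfolding w_def using vm by (simp, measurable)
    show "AE x in \<mu>. w 1 x = ?v 1 x + u x0"
      using sum_ae
    proof eventually_elim
      case (elim x)
      then have "?v 1 x + (\<Sum>i=2..l. ?v i x) = u x - u x0" by (simp only: split)
      then show ?case by (simp add: w_def)
    qed
  qed
  have "w i \<in> frac_sobolev \<mu> edist n (s i) (p i)" if i: "i \<in> {1..l}" for i
    using w1 v[OF i] by (cases "i = 1") (auto simp: w_def)
  moreover have "u x = (\<Sum>i=1..l. w i x)" for x
    by (simp only: split) (simp add: w_def)
  ultimately show ?thesis
    unfolding frac_sobolev_sum_def by blast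
qed

end

section \<open>The two spaces on a regular space, and on Euclidean space\<close>

lemma frac_quotient_scale:
  assumes "\<bar>u x - u y\<bar> \<le> K * \<bar>v x - v y\<bar>" "0 \<le> K" "0 \<le> p"
  shows "frac_quotient d n s p u x y \<le> ennreal (K powr p) * frac_quotient d n s p v x y"
proof -
  have "\<bar>u x - u y\<bar> powr p \<le> (K * \<bar>v x - v y\<bar>) powr p"
    using assms by (intro powr_mono2) auto
  also have "\<dots> = K powr p * \<bar>v x - v y\<bar> powr p"
    using assms by (simp add: powr_mult)
  finally have "ennreal (\<bar>u x - u y\<bar> powr p) \<le> ennreal (K powr p) * ennreal (\<bar>v x - v y\<bar> powr p)"
    by (simp add: ennreal_mult[symmetric] ennreal_leI)
  then show ?thesis
    unfolding frac_quotient_def ennreal_times_divide by (rule divide_right_mono_ennreal)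
qed

lemma Min_frac_quotient_sum_le:
  assumes l: "1 \<le> l" and p: "\<And>i. i \<in> {1..l} \<Longrightarrow> 0 \<le> p i"
    and u: "u x = (\<Sum>i=1..l. v i x)" "u y = (\<Sum>i=1..l. v i y)"
  shows "(MIN i\<in>{1..l}. frac_quotient d n (s i) (p i) u x y)
     \<le> (\<Sum>i=1..l. ennreal (real l powr p i) * frac_quotient d n (s i) (p i) (v i) x y)"
proof -
  let ?a = "\<lambda>i. \<bar>v i x - v i y\<bar>"
  have "finite (?a ` {1..l})" "?a ` {1..l} \<noteq> {}" using l by auto
  from Max_in[OF this] obtain j where j: "j \<in> {1..l}" "?a j = Max (?a ` {1..l})" by auto
  have "\<bar>u x - u y\<bar> = \<bar>\<Sum>i=1..l. v i x - v i y\<bar>" by (simp only: u sum_subtractf)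
  also have "\<dots> \<le> (\<Sum>i=1..l. ?a i)" by (rule sum_abs)
  also have "\<dots> \<le> (\<Sum>i=1..l. ?a j)" unfolding j(2) by (intro sum_mono Max_ge) auto
  also have "\<dots> = real l * ?a j" by simp
  finally have le: "\<bar>u x - u y\<bar> \<le> real l * ?a j" .
  have "(MIN i\<in>{1..l}. frac_quotient d n (s i) (p i) u x y) \<le> frac_quotient d n (s j) (p j) u x y"
    using j by (intro Min_le) auto
  also have "\<dots> \<le> ennreal (real l powr p j) * frac_quotient d n (s j) (p j) (v j) x y"
    by (intro frac_quotient_scale le p j) auto
  also have "\<dots> \<le> (\<Sum>i=1..l. ennreal (real l powr p i) * frac_quotient d n (s i) (p i) (v i) x y)"
    using j(1) by (intro member_le_sum[where f = "\<lambda>i. ennreal (real l powr p i) * frac_quotient d n (s i) (p i) (v i) x y"]) auto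
  finally show ?thesis .
qed

lemma frac_sobolev_sum_measurable:
  assumes "u \<in> frac_sobolev_sum M d n l s p"
  shows "u \<in> borel_measurable M"
proof -
  from assms obtain v where v: "\<And>i. i \<in> {1..l} \<Longrightarrow> v i \<in> frac_sobolev M d n (s i) (p i)"
    "\<And>x. x \<in> space M \<Longrightarrow> u x = (\<Sum>i=1..l. v i x)" unfolding frac_sobolev_sum_def by blast
  have "(\<lambda>x. \<Sum>i=1..l. v i x) \<in> borel_measurable M"
    using v(1) by (intro borel_measurable_sum) (auto simp: frac_sobolev_def)
  then show ?thesis using v(2) by (simp cong: measurable_cong)
qed

context regular_metric_measure
begin

abbreviation rdist :: "'a \<Rightarrow> 'a \<Rightarrow> ennreal" where "rdist \<equiv> \<lambda>x y. ennreal (\<rho> x y)"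

lemma frac_quotient_measurable:
  assumes [measurable]: "v \<in> borel_measurable \<mu>"
  shows "(\<lambda>(x, y). frac_quotient rdist m s p v x y) \<in> borel_measurable (\<mu> \<Otimes>\<^sub>M \<mu>)"
proof -
  have "(\<lambda>z. ennreal (\<bar>v (fst z) - v (snd z)\<bar> powr p) / ennreal (\<rho> (fst z) (snd z) powr (real m + s * p)))
      \<in> borel_measurable (\<mu> \<Otimes>\<^sub>M \<mu>)"
    by measurable
  moreover have "frac_quotient rdist m s p v (fst z) (snd z) =
      ennreal (\<bar>v (fst z) - v (snd z)\<bar> powr p) / ennreal (\<rho> (fst z) (snd z) powr (real m + s * p))"
    if "z \<in> space (\<mu> \<Otimes>\<^sub>M \<mu>)" for z
    using that rho_nonneg by (auto simp: frac_quotient_def ennreal_powr_def space_pair_measure)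
  ultimately show ?thesis
    by (subst measurable_cong[where g = "\<lambda>z. ennreal (\<bar>v (fst z) - v (snd z)\<bar> powr p) / ennreal (\<rho> (fst z) (snd z) powr (real m + s * p))"])
       (auto simp: split_beta')
qed

lemma frac_sobolev_sum_subset_min:
  assumes l: "1 \<le> l" and p: "\<And>i. i \<in> {1..l} \<Longrightarrow> 0 \<le> p i"
  shows "frac_sobolev_sum \<mu> rdist m l s p \<subseteq> frac_min_space \<mu> rdist m l s p"
proof
  fix u assume uS: "u \<in> frac_sobolev_sum \<mu> rdist m l s p"
  then obtain v where v: "\<And>i. i \<in> {1..l} \<Longrightarrow> v i \<in> frac_sobolev \<mu> rdist m (s i) (p i)"
    "\<And>x. x \<in> space \<mu> \<Longrightarrow> u x = (\<Sum>i=1..l. v i x)" unfolding frac_sobolev_sum_def by blast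
  let ?q = "\<lambda>i z. frac_quotient rdist m (s i) (p i) (v i) (fst z) (snd z)"
  have qm: "?q i \<in> borel_measurable (\<mu> \<Otimes>\<^sub>M \<mu>)" if "i \<in> {1..l}" for i
    using frac_quotient_measurable[of "v i" m "s i" "p i"] v(1)[OF that]
    by (simp add: frac_sobolev_def split_beta')
  have qfin: "(\<integral>\<^sup>+ z. ?q i z \<partial>(\<mu> \<Otimes>\<^sub>M \<mu>)) < top" if "i \<in> {1..l}" for i
    using v(1)[OF that] by (simp add: frac_sobolev_def split_beta')
  have "(\<integral>\<^sup>+ (x, y). (MIN i\<in>{1..l}. frac_quotient rdist m (s i) (p i) u x y) \<partial>(\<mu> \<Otimes>\<^sub>M \<mu>))
      \<le> (\<integral>\<^sup>+ z. (\<Sum>i=1..l. ennreal (real l powr p i) * ?q i z) \<partial>(\<mu> \<Otimes>\<^sub>M \<mu>))"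
  proof (rule nn_integral_mono)
    fix z assume "z \<in> space (\<mu> \<Otimes>\<^sub>M \<mu>)"
    then have "fst z \<in> space \<mu>" "snd z \<in> space \<mu>" by (auto simp: space_pair_measure)
    from Min_frac_quotient_sum_le[where p = p, OF l p v(2)[OF this(1)] v(2)[OF this(2)]]
    show "(case z of (x, y) \<Rightarrow> MIN i\<in>{1..l}. frac_quotient rdist m (s i) (p i) u x y) \<le> (\<Sum>i=1..l. ennreal (real l powr p i) * ?q i z)"
      unfolding split_beta by blast
  qed
  also have "\<dots> = (\<Sum>i=1..l. \<integral>\<^sup>+ z. ennreal (real l powr p i) * ?q i z \<partial>(\<mu> \<Otimes>\<^sub>M \<mu>))"
    using qm by (intro nn_integral_sum borel_measurable_times_ennreal borel_measurable_const) auto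
  also have "\<dots> = (\<Sum>i=1..l. ennreal (real l powr p i) * (\<integral>\<^sup>+ z. ?q i z \<partial>(\<mu> \<Otimes>\<^sub>M \<mu>)))"
    by (intro sum.cong refl nn_integral_cmult qm)
  also have "\<dots> < top"
    using qfin by (auto simp: ennreal_mult_less_top)
  finally show "u \<in> frac_min_space \<mu> rdist m l s p"
    using frac_sobolev_sum_measurable[OF uS] by (simp add: frac_min_space_def)
qed

text \<open>
  On a space of measure zero the function \<open>u\<close> itself is a decomposition.
\<close>

theorem frac_sobolev_sum_eq_min_space:
  assumes l: "1 \<le> l" and s: "\<And>i. i \<in> {1..l} \<Longrightarrow> 0 < s i \<and> s i < 1" and p: "\<And>i. i \<in> {1..l} \<Longrightarrow> 1 \<le> p i"
  shows "frac_sobolev_sum \<mu> rdist n l s p = frac_min_space \<mu> rdist n l s p"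
proof
  show "frac_sobolev_sum \<mu> rdist n l s p \<subseteq> frac_min_space \<mu> rdist n l s p"
    by (intro frac_sobolev_sum_subset_min l order.trans[OF zero_le_one p])
  show "frac_min_space \<mu> rdist n l s p \<subseteq> frac_sobolev_sum \<mu> rdist n l s p"
  proof
    fix u assume u: "u \<in> frac_min_space \<mu> rdist n l s p"
    show "u \<in> frac_sobolev_sum \<mu> rdist n l s p"
    proof (cases "emeasure \<mu> (space \<mu>) = 0")
      case True
      have "space \<mu> \<times> space \<mu> \<in> null_sets (\<mu> \<Otimes>\<^sub>M \<mu>)"
        using True by (intro null_setsI) (auto simp: emeasure_pair_measure_Times)
      then have ae: "AE z in \<mu> \<Otimes>\<^sub>M \<mu>. False"
        by (rule AE_I') (auto simp: space_pair_measure)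
      have all: "w \<in> frac_sobolev \<mu> rdist n t q" if "w \<in> borel_measurable \<mu>" for w t q
      proof -
        have "(\<integral>\<^sup>+ (x, y). frac_quotient rdist n t q w x y \<partial>(\<mu> \<Otimes>\<^sub>M \<mu>)) = (\<integral>\<^sup>+ z. 0 \<partial>(\<mu> \<Otimes>\<^sub>M \<mu>))"
          by (rule nn_integral_cong_AE) (use ae in \<open>eventually_elim, simp\<close>)
        with that show ?thesis by (simp add: frac_sobolev_def)
      qed
      define v where "v i = (if i = 1 then u else (\<lambda>_. 0))" for i :: nat
      have "v i \<in> frac_sobolev \<mu> rdist n (s i) (p i)" for i
        using u by (intro all) (auto simp: v_def frac_min_space_def intro: borel_measurable_const)
      moreover have "(\<Sum>i=1..l. v i x) = u x" for x
      proof -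
        have "(\<Sum>i=1..l. v i x) = (\<Sum>i=1..l. if i = 1 then u x else 0)"
          by (intro sum.cong refl) (simp add: v_def)
        then show ?thesis using l by (simp add: sum.delta)
      qed
      ultimately show ?thesis unfolding frac_sobolev_sum_def by (intro CollectI exI[of _ v]) simp
    next
      case False
      interpret min_decomposition \<mu> \<rho> n c C l s p u
        by unfold_locales (use False l s p u in auto)
      show ?thesis by (rule min_space_decomposition)
    qed
  qed
qed

end

text \<open>
  Between the radius \<open>r0\<close> and the diameter the measure of a ball is pinched between two positive
  constants, which costs only a change of the constants.
\<close>

lemma bounded_regular_metric_measureI:
  fixes \<mu> :: "'a measure" and \<rho> :: "'a \<Rightarrow> 'a \<Rightarrow> real" and c C r0 D :: real
  assumes fin: "emeasure \<mu> (space \<mu>) \<noteq> top"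
    and meas: "(\<lambda>(x, y). \<rho> x y) \<in> borel_measurable (\<mu> \<Otimes>\<^sub>M \<mu>)"
    and nonneg: "\<And>x y. x \<in> space \<mu> \<Longrightarrow> y \<in> space \<mu> \<Longrightarrow> 0 \<le> \<rho> x y"
    and refl: "\<And>x. x \<in> space \<mu> \<Longrightarrow> \<rho> x x = 0"
    and sym: "\<And>x y. x \<in> space \<mu> \<Longrightarrow> y \<in> space \<mu> \<Longrightarrow> \<rho> x y = \<rho> y x"
    and tri: "\<And>x y z. x \<in> space \<mu> \<Longrightarrow> y \<in> space \<mu> \<Longrightarrow> z \<in> space \<mu> \<Longrightarrow> \<rho> x z \<le> \<rho> x y + \<rho> y z"
    and n: "0 < n" and pos: "0 < c" "0 < C" "0 < r0"
    and bounded: "\<And>x y. x \<in> space \<mu> \<Longrightarrow> y \<in> space \<mu> \<Longrightarrow> \<rho> x y \<le> D"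
    and upper: "\<And>x r. x \<in> space \<mu> \<Longrightarrow> 0 < r \<Longrightarrow> r \<le> r0 \<Longrightarrow> emeasure \<mu> {y \<in> space \<mu>. \<rho> x y < r} \<le> ennreal (C * r ^ n)"
    and lower: "\<And>x r. x \<in> space \<mu> \<Longrightarrow> 0 < r \<Longrightarrow> r \<le> r0 \<Longrightarrow> ennreal (c * r ^ n) \<le> emeasure \<mu> {y \<in> space \<mu>. \<rho> x y < r}"
  obtains c' C' where "regular_metric_measure \<mu> \<rho> n c' C'"
proof
  define m where "m = measure \<mu> (space \<mu>)"
  have m: "emeasure \<mu> (space \<mu>) = ennreal m" using fin by (simp add: m_def emeasure_eq_ennreal_measure)
  have m0: "0 \<le> m" by (simp add: m_def)
  let ?D = "max D r0"
  define C' where "C' = C + m / r0 ^ n"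
  define c' where "c' = c * (r0 / ?D) ^ n"
  have D: "0 < ?D" using pos by auto
  have sets: "{y \<in> space \<mu>. \<rho> x y < r} \<in> sets \<mu>" if "x \<in> space \<mu>" for x r
  proof -
    have [measurable]: "\<rho> x \<in> borel_measurable \<mu>"
      using measurable_compose[OF measurable_Pair1'[OF that] meas] by simp
    show ?thesis by measurable
  qed
  show "regular_metric_measure \<mu> \<rho> n c' C'"
  proof (intro regular_metric_measure.intro regular_metric_measure_axioms.intro)
    show "sigma_finite_measure \<mu>"
      using fin by (intro finite_measure.axioms finite_measureI) (simp add: infinity_ennreal_def)
    show "0 < c'" using pos D by (simp add: c'_def)
    show "0 < C'" using pos m0 by (simp add: C'_def add_pos_nonneg)
    fix x r assume x: "x \<in> space \<mu>" and r: "(0 :: real) < r"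
    show "emeasure \<mu> {y \<in> space \<mu>. \<rho> x y < r} \<le> ennreal (C' * r ^ n)"
    proof (cases "r \<le> r0")
      case True
      have "C * r ^ n \<le> C' * r ^ n"
        using pos m0 r by (intro mult_right_mono) (auto simp: C'_def)
      then show ?thesis using upper[OF x r True] by (meson ennreal_leI order_trans)
    next
      case False
      have "emeasure \<mu> {y \<in> space \<mu>. \<rho> x y < r} \<le> ennreal m"
        unfolding m[symmetric] by (intro emeasure_mono) auto
      also have "m \<le> m / r0 ^ n * r ^ n"
        using False pos m0 mult_left_mono[OF power_mono[of r0 r n] m0] by (simp add: field_simps)
      then have "ennreal m \<le> ennreal (C' * r ^ n)"
        using pos r by (intro ennreal_leI) (simp add: C'_def distrib_right add_increasing)
      finally show ?thesis .
    qed
    show "(\<forall>y\<in>space \<mu>. \<rho> x y < r) \<or> ennreal (c' * r ^ n) \<le> emeasure \<mu> {y \<in> space \<mu>. \<rho> x y < r}"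
    proof (cases "r \<le> ?D")
      case True
      let ?r = "min r r0"
      have "c' * r ^ n = c * (r0 * r / ?D) ^ n" by (simp add: c'_def power_mult_distrib power_divide)
      also have "\<dots> \<le> c * ?r ^ n"
      proof (intro mult_left_mono power_mono)
        have "r0 * r / ?D \<le> r" using D r pos by (simp add: field_simps)
        moreover have "r0 * r / ?D \<le> r0" using D True pos by (simp add: field_simps)
        ultimately show "r0 * r / ?D \<le> ?r" by simp
      qed (use r pos D in auto)
      finally have "ennreal (c' * r ^ n) \<le> ennreal (c * ?r ^ n)" by (rule ennreal_leI)
      also have "\<dots> \<le> emeasure \<mu> {y \<in> space \<mu>. \<rho> x y < ?r}"
        using r pos by (intro lower x) auto
      also have "\<dots> \<le> emeasure \<mu> {y \<in> space \<mu>. \<rho> x y < r}"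
        by (intro emeasure_mono sets x) auto
      finally show ?thesis ..
    next
      case False
      then show ?thesis using bounded[OF x] by fastforce
    qed
  qed (use assms in auto)
qed

lemma emeasure_lebesgue_ball:
  assumes "0 \<le> r"
  shows "emeasure lebesgue (ball (x :: 'b :: euclidean_space) r) = ennreal (unit_ball_vol (DIM('b)) * r ^ DIM('b))"
proof -
  have "emeasure lebesgue (ball x r) = emeasure lborel (ball x r)"
  proof -
    have b: "ball x r \<in> sets lborel" by (simp add: borel_open)
    show ?thesis using emeasure_completion[OF sets_completionI_sets[OF b]] by (simp only: main_part[OF b])
  qed
  then show ?thesis using emeasure_ball[OF assms, of x] by simp
qed

lemma sigma_finite_lebesgue: "sigma_finite_measure (lebesgue :: 'b :: euclidean_space measure)"
proof
  let ?A = "range (\<lambda>k :: nat. ball (0 :: 'b) (real k))"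
  have "x \<in> \<Union> ?A" for x :: 'b
    using reals_Archimedean2[of "norm x"] by (auto simp: mem_ball)
  then have "\<Union> ?A = (UNIV :: 'b set)" by blast
  moreover have "emeasure lebesgue (ball (0 :: 'b) (real k)) \<noteq> \<infinity>" for k
    by (simp add: emeasure_lebesgue_ball)
  moreover have "ball (0 :: 'b) (real k) \<in> sets lebesgue" for k
    by (intro sets_completionI_sets) (simp add: borel_open)
  ultimately show "\<exists>A. countable A \<and> A \<subseteq> sets (lebesgue :: 'b measure) \<and> \<Union> A = space (lebesgue :: 'b measure) \<and> (\<forall>a\<in>A. emeasure lebesgue a \<noteq> \<infinity>)"
    by (intro exI[of _ ?A]) auto
qed

lemma dist_measurable_lebesgue_on:
  fixes S :: "'b :: euclidean_space set"
  shows "(\<lambda>(x, y). dist x y) \<in> borel_measurable (lebesgue_on S \<Otimes>\<^sub>M lebesgue_on S)"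
proof -
  have id: "(\<lambda>x. x) \<in> measurable (lebesgue_on S) borel"
    by (rule measurable_restrict_space1) (rule measurable_completion, measurable)
  have "(\<lambda>z. dist (fst z) (snd z)) \<in> borel_measurable (lebesgue_on S \<Otimes>\<^sub>M lebesgue_on S)"
    by (rule borel_measurable_dist[OF measurable_compose[OF measurable_fst id] measurable_compose[OF measurable_snd id]])
  then show ?thesis by (simp add: split_beta')
qed

theorem frac_sobolev_sum_eq_min_space_euclidean:
  assumes l: "1 \<le> l" and s: "\<And>i. i \<in> {1..l} \<Longrightarrow> 0 < s i \<and> s i < 1" and p: "\<And>i. i \<in> {1..l} \<Longrightarrow> 1 \<le> p i"
  shows "frac_sobolev_sum (lebesgue :: (real ^ 'n) measure) euclidean_dist CARD('n) l s p =
       frac_min_space lebesgue euclidean_dist CARD('n) l s p"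
proof -
  have set: "{y. dist x y < r} = ball x r" for x :: "real ^ 'n" and r
    by auto
  interpret regular_metric_measure "lebesgue :: (real ^ 'n) measure" dist "CARD('n)"
    "unit_ball_vol (CARD('n))" "unit_ball_vol (CARD('n))"
  proof (intro regular_metric_measure.intro regular_metric_measure_axioms.intro sigma_finite_lebesgue)
    show "(\<lambda>(x :: real ^ 'n, y). dist x y) \<in> borel_measurable (lebesgue \<Otimes>\<^sub>M lebesgue)"
      using dist_measurable_lebesgue_on[of UNIV] by (simp add: lebesgue_on_UNIV_eq)
  qed (auto simp: set emeasure_lebesgue_ball dist_commute dist_triangle)
  show ?thesis
    using frac_sobolev_sum_eq_min_space[OF l s p] by (simp add: euclidean_dist_def[abs_def])
qed

section \<open>Bounded domains with interior balls\<close>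

text \<open>
  Moving up by \<open>r / 2\<close> in the direction \<open>e\<close> leaves room for a ball that the slope \<open>L\<close> cannot reach.
\<close>

lemma lipschitz_graph_interior_ball:
  fixes \<Omega> :: "(real ^ 'n) set"
  assumes e: "norm e = 1" and h: "L-lipschitz_on {v. v \<bullet> e = 0} h"
    and graph: "\<Omega> \<inter> ball z R = {y \<in> ball z R. h (y - (y \<bullet> e) *\<^sub>R e) < y \<bullet> e}"
    and x: "x \<in> \<Omega>" "x \<in> ball z (R / 2)" and r: "0 < r" "r \<le> R / 2"
  shows "ball (x + (r / 2) *\<^sub>R e) (1 / (4 * (L + 1)) * r) \<subseteq> \<Omega> \<inter> ball x r"
proof
  have L: "0 \<le> L" by (rule lipschitz_on_nonneg[OF h])
  let ?k = "1 / (4 * (L + 1))" and ?w = "x + (r / 2) *\<^sub>R e"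
  let ?pr = "\<lambda>y. y - (y \<bullet> e) *\<^sub>R e"
  have ee: "e \<bullet> e = 1" using e by (simp add: norm_eq_1)
  have k: "0 < ?k" "?k \<le> 1 / 4" using L by (auto simp: field_simps)
  fix y assume "y \<in> ball ?w (?k * r)"
  then have yw: "norm (y - ?w) < ?k * r" by (simp add: dist_norm norm_minus_commute)
  have kr: "?k * r \<le> r / 4" using k(2) r mult_right_mono[of ?k "1/4" r] by simp
  have "norm (y - x) = norm ((y - ?w) + (r / 2) *\<^sub>R e)" by (simp add: algebra_simps)
  also have "\<dots> \<le> norm (y - ?w) + r / 2"
    using norm_triangle_ineq[of "y - ?w" "(r / 2) *\<^sub>R e"] r e by simp
  finally have yx: "norm (y - x) < r" using yw kr r by linarith
  then have yB: "y \<in> ball x r" by (simp add: dist_norm norm_minus_commute)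
  have "dist z y \<le> dist z x + dist x y" by (rule dist_triangle)
  then have yR: "y \<in> ball z R" using x(2) yB r by simp
  have prE: "?pr v \<bullet> e = 0" for v by (simp add: inner_diff_left ee)
  have "?pr y - ?pr x = (y - ?w) - ((y - ?w) \<bullet> e) *\<^sub>R e"
    by (simp add: inner_diff_left inner_add_left ee algebra_simps)
  then have "norm (?pr y - ?pr x) \<le> norm (y - ?w) + norm (((y - ?w) \<bullet> e) *\<^sub>R e)"
    by (simp only:) (rule norm_triangle_ineq4)
  also have "norm (((y - ?w) \<bullet> e) *\<^sub>R e) \<le> norm (y - ?w)"
    using Cauchy_Schwarz_ineq2[of "y - ?w" e] e by simp
  finally have pr: "norm (?pr y - ?pr x) \<le> 2 * (?k * r)" using yw by linarith
  have "dist (h (?pr y)) (h (?pr x)) \<le> L * dist (?pr y) (?pr x)"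
    by (rule lipschitz_onD[OF h]) (simp_all add: prE)
  then have "h (?pr y) \<le> h (?pr x) + L * norm (?pr y - ?pr x)"
    by (simp add: dist_norm)
  also have "\<dots> \<le> h (?pr x) + L * (2 * (?k * r))"
    using pr L by (intro add_left_mono mult_left_mono)
  finally have hy: "h (?pr y) \<le> h (?pr x) + L * (2 * (?k * r))" .
  have "x \<in> \<Omega> \<inter> ball z R" using x r by auto
  then have hx: "h (?pr x) < x \<bullet> e" using graph by blast
  have "y \<bullet> e = x \<bullet> e + r / 2 + (y - ?w) \<bullet> e"
    by (simp add: inner_diff_left inner_add_left ee)
  moreover have "\<bar>(y - ?w) \<bullet> e\<bar> \<le> norm (y - ?w)"
    using Cauchy_Schwarz_ineq2[of "y - ?w" e] e by simp
  ultimately have ye: "x \<bullet> e + r / 2 - ?k * r \<le> y \<bullet> e" using yw by linarith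
  have "L * (2 * (t * r)) + t * r = ((2 * L + 1) * t) * r" for t by (simp add: algebra_simps)
  then have "L * (2 * (?k * r)) + ?k * r = ((2 * L + 1) * ?k) * r" .
  also have "\<dots> \<le> (1 / 2) * r"
    using L r by (intro mult_right_mono) (auto simp: field_simps)
  finally have "L * (2 * (?k * r)) + ?k * r \<le> r / 2" by simp
  with hy hx ye have "h (?pr y) < y \<bullet> e" by linarith
  then have "y \<in> \<Omega>" using yR graph by blast
  with yB show "y \<in> \<Omega> \<inter> ball x r" by simp
qed

text \<open>
  The form of the measure density condition in which only the volume of balls has to be known.
\<close>

definition interior_ball_condition :: "'b :: metric_space set \<Rightarrow> bool" where
  "interior_ball_condition S \<longleftrightarrow>
     (\<exists>r0>0. \<exists>k>0. \<forall>x\<in>S. \<forall>r. 0 < r \<and> r \<le> r0 \<longrightarrow> (\<exists>w. ball w (k * r) \<subseteq> S \<inter> ball x r))"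

text \<open>
  Local constants exist around every point of the compact closure, inner points included.
\<close>

lemma lipschitz_open_set_interior_balls:
  fixes \<Omega> :: "(real ^ 'n) set"
  assumes "bounded \<Omega>" and lip_const: "lipschitz_open_set \<Omega>"
  shows "interior_ball_condition \<Omega>"
proof -
  have op: "open \<Omega>" using lip_const by (simp add: lipschitz_open_set_def)
  have loc: "\<exists>q>0. \<exists>k>0. \<forall>x\<in>\<Omega> \<inter> ball z q. \<forall>r. 0 < r \<and> r \<le> q \<longrightarrow> (\<exists>w. ball w (k * r) \<subseteq> \<Omega> \<inter> ball x r)"
    if z: "z \<in> closure \<Omega>" for z
  proof (cases "z \<in> \<Omega>")
    case True
    then obtain d where d: "0 < d" "ball z d \<subseteq> \<Omega>" using op openE by blast
    have "ball x (1 * r) \<subseteq> \<Omega> \<inter> ball x r" if "x \<in> ball z (d / 2)" "r \<le> d / 2" for x r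
    proof -
      have "ball x r \<subseteq> ball z d"
      proof
        fix y assume "y \<in> ball x r"
        then show "y \<in> ball z d" using that dist_triangle[of z y x] by simp
      qed
      then show ?thesis using d by auto
    qed
    then have "\<forall>x\<in>\<Omega> \<inter> ball z (d / 2). \<forall>r. 0 < r \<and> r \<le> d / 2 \<longrightarrow> (\<exists>w. ball w (1 * r) \<subseteq> \<Omega> \<inter> ball x r)"
      by blast
    moreover have "0 < d / 2" "(0 :: real) < 1" using d(1) by auto
    ultimately show ?thesis by blast
  next
    case False
    then have "z \<in> frontier \<Omega>" using z op by (simp add: frontier_def interior_open)
    then obtain R e h L where *: "R > 0" "norm e = 1" "L-lipschitz_on {v. v \<bullet> e = 0} h"
      "\<Omega> \<inter> ball z R = {y \<in> ball z R. h (y - (y \<bullet> e) *\<^sub>R e) < y \<bullet> e}"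
      using lip_const unfolding lipschitz_open_set_def by blast
    have "0 < 1 / (4 * (L + 1))" using lipschitz_on_nonneg[OF *(3)] by simp
    moreover have "\<forall>x\<in>\<Omega> \<inter> ball z (R / 2). \<forall>r. 0 < r \<and> r \<le> R / 2 \<longrightarrow> (\<exists>w. ball w (1 / (4 * (L + 1)) * r) \<subseteq> \<Omega> \<inter> ball x r)"
      using lipschitz_graph_interior_ball[OF *(2-4)] by blast
    moreover have "0 < R / 2" using *(1) by simp
    ultimately show ?thesis by blast
  qed
  then obtain q k where qk: "\<And>z. z \<in> closure \<Omega> \<Longrightarrow> 0 < q z" "\<And>z. z \<in> closure \<Omega> \<Longrightarrow> 0 < k z"
    "\<And>z x r. z \<in> closure \<Omega> \<Longrightarrow> x \<in> \<Omega> \<inter> ball z (q z) \<Longrightarrow> 0 < r \<Longrightarrow> r \<le> q z \<Longrightarrow> \<exists>w. ball w (k z * r) \<subseteq> \<Omega> \<inter> ball x r"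
    by metis
  have "compact (closure \<Omega>)" using assms(1) by (simp add: compact_closure)
  then obtain D where D: "D \<subseteq> closure \<Omega>" "finite D" "closure \<Omega> \<subseteq> (\<Union>z\<in>D. ball z (q z))"
    by (rule compactE_image[where f = "\<lambda>z. ball z (q z)"]) (use qk(1) in \<open>auto intro: centre_in_ball[THEN iffD2]\<close>)
  define r0 where "r0 = Min (insert 1 (q ` D))"
  define k0 where "k0 = Min (insert 1 (k ` D))"
  have r0: "0 < r0" "\<And>z. z \<in> D \<Longrightarrow> r0 \<le> q z"
    unfolding r0_def using D qk(1) by (auto simp: Min_gr_iff)
  have k0: "0 < k0" "\<And>z. z \<in> D \<Longrightarrow> k0 \<le> k z"
    unfolding k0_def using D qk(2) by (auto simp: Min_gr_iff)
  have "\<forall>x\<in>\<Omega>. \<forall>r. 0 < r \<and> r \<le> r0 \<longrightarrow> (\<exists>w. ball w (k0 * r) \<subseteq> \<Omega> \<inter> ball x r)"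
  proof (intro ballI allI impI)
    fix x r assume x: "x \<in> \<Omega>" and r: "0 < r \<and> r \<le> r0"
    then obtain z where z: "z \<in> D" "x \<in> ball z (q z)" using D(3) closure_subset by blast
    have "\<exists>w. ball w (k z * r) \<subseteq> \<Omega> \<inter> ball x r"
      using z x r r0(2)[OF z(1)] D(1) by (intro qk(3)[of z]) auto
    then obtain w where w: "ball w (k z * r) \<subseteq> \<Omega> \<inter> ball x r" ..
    have "ball w (k0 * r) \<subseteq> ball w (k z * r)"
      using k0(2)[OF z(1)] r by (intro subset_ball mult_right_mono) auto
    with w show "\<exists>w. ball w (k0 * r) \<subseteq> \<Omega> \<inter> ball x r" by blast
  qed
  then show ?thesis
    unfolding interior_ball_condition_def using r0(1) k0(1) by blast
qed

theorem frac_sobolev_sum_eq_min_space_interior_balls: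
  fixes \<Omega> :: "(real ^ 'n) set"
  assumes bd: "bounded \<Omega>" and meas: "\<Omega> \<in> sets lebesgue" and ib: "interior_ball_condition \<Omega>"
    and l: "1 \<le> l" and s: "\<And>i. i \<in> {1..l} \<Longrightarrow> 0 < s i \<and> s i < 1" and p: "\<And>i. i \<in> {1..l} \<Longrightarrow> 1 \<le> p i"
  shows "frac_sobolev_sum (lebesgue_on \<Omega>) euclidean_dist CARD('n) l s p =
       frac_min_space (lebesgue_on \<Omega>) euclidean_dist CARD('n) l s p"
proof -
  let ?v = "unit_ball_vol (CARD('n))"
  obtain r0 k where rk: "0 < r0" "0 < k"
    "\<And>x r. x \<in> \<Omega> \<Longrightarrow> 0 < r \<Longrightarrow> r \<le> r0 \<Longrightarrow> \<exists>w. ball w (k * r) \<subseteq> \<Omega> \<inter> ball x r"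
    using ib unfolding interior_ball_condition_def by blast
  have sp: "space (lebesgue_on \<Omega>) = \<Omega>" by simp
  have set: "{y \<in> space (lebesgue_on \<Omega>). dist x y < r} = \<Omega> \<inter> ball x r" for x r
    by auto
  have ballm: "ball w r \<in> sets lebesgue" for w :: "real ^ 'n" and r
    by (intro sets_completionI_sets) (simp add: borel_open)
  have em: "emeasure (lebesgue_on \<Omega>) (\<Omega> \<inter> ball x r) = emeasure lebesgue (\<Omega> \<inter> ball x r)" for x r
    using meas by (intro emeasure_restrict_space) auto
  obtain B where B: "0 < B" "\<Omega> \<subseteq> ball 0 B" using bounded_subset_ballD[OF bd, of 0] by auto
  obtain c C where "regular_metric_measure (lebesgue_on \<Omega>) dist CARD('n) c C"
  proof (rule bounded_regular_metric_measureI[of "lebesgue_on \<Omega>" dist "CARD('n)" "?v * k ^ CARD('n)" ?v r0 "2 * B"])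
    have "emeasure (lebesgue_on \<Omega>) \<Omega> = emeasure lebesgue \<Omega>"
      using meas by (intro emeasure_restrict_space) auto
    also have "\<dots> \<le> emeasure lebesgue (ball 0 B :: (real ^ 'n) set)"
      by (intro emeasure_mono B ballm)
    also have "\<dots> < top" using B(1) by (simp add: emeasure_lebesgue_ball)
    finally show "emeasure (lebesgue_on \<Omega>) (space (lebesgue_on \<Omega>)) \<noteq> top" by (simp add: less_top)
    show "(\<lambda>(x, y). dist x y) \<in> borel_measurable (lebesgue_on \<Omega> \<Otimes>\<^sub>M lebesgue_on \<Omega>)"
      by (rule dist_measurable_lebesgue_on)
    fix x :: "real ^ 'n" and r :: real assume x: "x \<in> space (lebesgue_on \<Omega>)" and r: "0 < r" "r \<le> r0"
    have "emeasure lebesgue (\<Omega> \<inter> ball x r) \<le> emeasure lebesgue (ball x r)"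
      by (intro emeasure_mono ballm) auto
    then show "emeasure (lebesgue_on \<Omega>) {y \<in> space (lebesgue_on \<Omega>). dist x y < r} \<le> ennreal (?v * r ^ CARD('n))"
      unfolding set em using r by (simp add: emeasure_lebesgue_ball)
    obtain w where w: "ball w (k * r) \<subseteq> \<Omega> \<inter> ball x r" using rk(3)[of x r] x r sp by blast
    have "emeasure lebesgue (ball w (k * r)) \<le> emeasure lebesgue (\<Omega> \<inter> ball x r)"
      using meas ballm by (intro emeasure_mono w) auto
    then show "ennreal (?v * k ^ CARD('n) * r ^ CARD('n)) \<le> emeasure (lebesgue_on \<Omega>) {y \<in> space (lebesgue_on \<Omega>). dist x y < r}"
      unfolding set em using r rk by (simp add: emeasure_lebesgue_ball power_mult_distrib mult.assoc)
  next
    fix x y :: "real ^ 'n" assume "x \<in> space (lebesgue_on \<Omega>)" "y \<in> space (lebesgue_on \<Omega>)"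
    then have "norm x < B" "norm y < B" using B(2) by auto
    then show "dist x y \<le> 2 * B" using norm_triangle_ineq4[of x y] by (simp add: dist_norm)
  qed (use rk in \<open>auto simp: dist_commute dist_triangle\<close>)
  then interpret regular_metric_measure "lebesgue_on \<Omega>" dist "CARD('n)" c C .
  show ?thesis
    using frac_sobolev_sum_eq_min_space[OF l s p] by (simp add: euclidean_dist_def[abs_def])
qed

section \<open>Lengths of Lipschitz curves\<close>

declare [[simproc add: measurable]]

text \<open>
  The integral of a non-measurable function is a lower integral, for which additivity fails in
  general; splitting the domain is harmless.  The speed of a curve is not known to be measurable.
\<close>

lemma nn_integral_split_le:
  assumes [measurable]: "A \<in> sets M"
  shows "(\<integral>\<^sup>+ x. f x \<partial>M) \<le> (\<integral>\<^sup>+ x. f x * indicator A x \<partial>M) + (\<integral>\<^sup>+ x. f x * indicator (- A) x \<partial>M)"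
proof (subst nn_integral_def, safe intro!: SUP_least)
  fix g assume g: "simple_function M g" "g \<le> f"
  have [measurable]: "g \<in> borel_measurable M" by (rule borel_measurable_simple_function[OF g(1)])
  have A': "A \<inter> space M \<in> sets M" by measurable
  have "integral\<^sup>S M g = (\<integral>\<^sup>+ x. g x \<partial>M)" by (rule nn_integral_eq_simple_integral[OF g(1), symmetric])
  also have "\<dots> = (\<integral>\<^sup>+ x. g x * indicator A x + g x * indicator (space M - A) x \<partial>M)"
    by (intro nn_integral_cong) (auto simp: indicator_def)
  also have "\<dots> = (\<integral>\<^sup>+ x. g x * indicator A x \<partial>M) + (\<integral>\<^sup>+ x. g x * indicator (space M - A) x \<partial>M)"
    by (rule nn_integral_add) measurable
  also have "\<dots> \<le> (\<integral>\<^sup>+ x. f x * indicator A x \<partial>M) + (\<integral>\<^sup>+ x. f x * indicator (- A) x \<partial>M)"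
    using g(2) by (intro add_mono nn_integral_mono) (auto simp: indicator_def le_fun_def)
  finally show "integral\<^sup>S M g \<le> (\<integral>\<^sup>+ x. f x * indicator A x \<partial>M) + (\<integral>\<^sup>+ x. f x * indicator (- A) x \<partial>M)" .
qed

text \<open>
  The change of variables for lower integrals, by transporting the simple functions below \<open>f\<close>.
\<close>

lemma nn_integral_lebesgue_affine_le:
  fixes f :: "real \<Rightarrow> ennreal" and a b :: real
  assumes a: "a \<noteq> 0"
  shows "(\<integral>\<^sup>+ t. ennreal \<bar>a\<bar> * f (b + a * t) \<partial>lebesgue) \<le> (\<integral>\<^sup>+ t. f t \<partial>lebesgue)"
proof (subst nn_integral_def, safe intro!: SUP_least)
  fix g assume g: "simple_function lebesgue g" "g \<le> (\<lambda>t. ennreal \<bar>a\<bar> * f (b + a * t))"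
  have gm: "g \<in> borel_measurable lebesgue" by (rule borel_measurable_simple_function[OF g(1)])
  define h where "h u = ennreal (1 / \<bar>a\<bar>) * g (- b / a + (1 / a) * u)" for u
  have "(\<lambda>u. - b / a + (1 / a) * u) \<in> measurable lebesgue (lebesgue :: real measure)"
    using lebesgue_affine_measurable[of "\<lambda>_. 1 / a" "- b / a"] a by simp
  from measurable_compose[OF this gm] have hm: "h \<in> borel_measurable lebesgue"
    unfolding h_def by measurable
  have inv: "ennreal \<bar>a\<bar> * (ennreal (1 / \<bar>a\<bar>) * z) = z" "ennreal (1 / \<bar>a\<bar>) * (ennreal \<bar>a\<bar> * z) = z" for z
    using a by (simp_all add: mult.assoc[symmetric] ennreal_mult[symmetric])
  have "h u \<le> f u" for u
  proof -
    have "h u \<le> ennreal (1 / \<bar>a\<bar>) * (ennreal \<bar>a\<bar> * f (b + a * (- b / a + (1 / a) * u)))"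
      using g(2) unfolding h_def le_fun_def by (intro mult_left_mono) auto
    also have "b + a * (- b / a + (1 / a) * u) = u" using a by (simp add: field_simps)
    finally show ?thesis by (simp add: inv)
  qed
  then have le: "(\<integral>\<^sup>+ u. h u \<partial>lebesgue) \<le> (\<integral>\<^sup>+ u. f u \<partial>lebesgue)" by (intro nn_integral_mono)
  have hb: "h (b + a * t) = ennreal (1 / \<bar>a\<bar>) * g t" for t
    using a by (simp add: h_def field_simps)
  have "integral\<^sup>S lebesgue g = (\<integral>\<^sup>+ t. g t \<partial>lebesgue)"
    by (rule nn_integral_eq_simple_integral[OF g(1), symmetric])
  also have "\<dots> = ennreal \<bar>a\<bar> * (ennreal (1 / \<bar>a\<bar>) * (\<integral>\<^sup>+ t. g t \<partial>lebesgue))" by (simp add: inv)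
  also have "\<dots> = ennreal \<bar>a\<bar> * (\<integral>\<^sup>+ t. h (b + a * t) \<partial>lebesgue)"
    by (simp only: hb nn_integral_cmult[OF gm])
  also have "\<dots> = (\<integral>\<^sup>+ u. h u \<partial>lebesgue)"
    by (rule nn_integral_real_affine_lebesgue[OF hm a, symmetric])
  finally show "integral\<^sup>S lebesgue g \<le> (\<integral>\<^sup>+ t. f t \<partial>lebesgue)" using le by simp
qed

lemma AE_lebesgue_neq: "AE t in lebesgue. t \<noteq> (a :: real)"
  by (intro AE_completion AE_lborel_singleton)

lemma riemannian_length_eq:
  "riemannian_length m U \<phi> g \<gamma> = (\<integral>\<^sup>+ t. ennreal (riemannian_speed m U \<phi> g \<gamma> t) * indicator {0..1} t \<partial>lebesgue)"
  unfolding riemannian_length_def by (rule nn_integral_restrict_space) simp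

lemma has_vector_derivative_affine:
  fixes f :: "real \<Rightarrow> 'b :: real_normed_vector"
  assumes "(f has_vector_derivative w) (at (b + a * t))"
  shows "((\<lambda>s. f (b + a * s)) has_vector_derivative (a *\<^sub>R w)) (at t)"
proof -
  have "((\<lambda>s. b + a * s) has_vector_derivative a) (at t)"
    by (auto intro!: derivative_eq_intros)
  from vector_diff_chain_at[OF this] assms show ?thesis by (simp add: o_def)
qed

text \<open>
  The second alternative occurs where \<open>f\<close> has no derivative: then neither has \<open>h\<close>, and
  \<^const>\<open>vector_derivative\<close> has the same arbitrary value for both.
\<close>

lemma vector_derivative_affine:
  fixes f :: "real \<Rightarrow> 'b :: real_normed_vector"
  assumes a: "a \<noteq> 0" and ev: "eventually (\<lambda>s. h s = f (b + a * s)) (nhds t)"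
  shows "vector_derivative h (at t) = a *\<^sub>R vector_derivative f (at (b + a * t))
       \<or> vector_derivative h (at t) = vector_derivative f (at (b + a * t))"
proof -
  have eq: "(h has_vector_derivative w) (at t) \<longleftrightarrow> ((\<lambda>s. f (b + a * s)) has_vector_derivative w) (at t)" for w
    using ev by (intro has_vector_derivative_cong_ev) (auto elim: eventually_mono dest: eventually_nhds_x_imp_x)
  show ?thesis
  proof (cases "\<exists>w. (f has_vector_derivative w) (at (b + a * t))")
    case True
    then obtain w where w: "(f has_vector_derivative w) (at (b + a * t))" ..
    from has_vector_derivative_affine[OF w] have "(h has_vector_derivative (a *\<^sub>R w)) (at t)" by (simp add: eq)
    then show ?thesis using w by (simp add: vector_derivative_at)
  next
    case False
    have "\<not> (h has_vector_derivative w) (at t)" for w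
    proof
      assume "(h has_vector_derivative w) (at t)"
      then have "((\<lambda>s. f (b + a * s)) has_vector_derivative w) (at (- b / a + (1 / a) * (b + a * t)))"
        using a by (simp add: eq field_simps)
      from has_vector_derivative_affine[OF this]
      have "((\<lambda>s. f (b + a * (- b / a + (1 / a) * s))) has_vector_derivative ((1 / a) *\<^sub>R w)) (at (b + a * t))" .
      also have "(\<lambda>s. f (b + a * (- b / a + (1 / a) * s))) = f" using a by (simp add: field_simps)
      finally show False using False by blast
    qed
    with False show ?thesis by (simp add: vector_derivative_def)
  qed
qed

text \<open>
  Where the derivative does not exist the two speeds agree, and the inequality holds as the factor
  is at least \<open>1\<close>.  Elsewhere this is the chain rule.
\<close>

lemma riemannian_speed_affine:
  assumes a: "1 \<le> \<bar>a\<bar>" and ev: "eventually (\<lambda>s. \<gamma>' s = \<gamma> (b + a * s)) (nhds t)"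
  shows "ennreal (riemannian_speed m U \<phi> g \<gamma>' t) \<le> ennreal \<bar>a\<bar> * ennreal (riemannian_speed m U \<phi> g \<gamma> (b + a * t))"
proof -
  define i where "i = (LEAST i. i < m \<and> \<gamma> (b + a * t) \<in> U i)"
  have eq: "\<gamma>' t = \<gamma> (b + a * t)" using ev by (rule eventually_nhds_x_imp_x)
  let ?w = "vector_derivative (\<phi> i \<circ> \<gamma>) (at (b + a * t))" and ?w' = "vector_derivative (\<phi> i \<circ> \<gamma>') (at t)"
  let ?G = "g i (\<phi> i (\<gamma> (b + a * t)))"
  have sp: "riemannian_speed m U \<phi> g \<gamma> (b + a * t) = sqrt (?w \<bullet> (?G *v ?w))"
    "riemannian_speed m U \<phi> g \<gamma>' t = sqrt (?w' \<bullet> (?G *v ?w'))"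
    by (simp_all add: riemannian_speed_def Let_def i_def eq)
  have "?w' = a *\<^sub>R ?w \<or> ?w' = ?w"
    using a ev by (intro vector_derivative_affine) (auto elim: eventually_mono)
  then show ?thesis
  proof
    assume "?w' = a *\<^sub>R ?w"
    then have "sqrt (?w' \<bullet> (?G *v ?w')) = \<bar>a\<bar> * sqrt (?w \<bullet> (?G *v ?w))"
      by (simp add: matrix_vector_mult_scaleR real_sqrt_mult power2_eq_square[symmetric] mult.assoc[symmetric])
    then show ?thesis by (simp add: sp ennreal_mult')
  next
    assume "?w' = ?w"
    then have "riemannian_speed m U \<phi> g \<gamma>' t = riemannian_speed m U \<phi> g \<gamma> (b + a * t)" using sp by simp
    moreover have "1 * z \<le> ennreal \<bar>a\<bar> * z" for z :: ennreal
      using a by (intro mult_right_mono) (auto simp: ennreal_leI)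
    ultimately show ?thesis by simp
  qed
qed

lemma riemannian_speed_constant:
  fixes \<gamma> :: "real \<Rightarrow> 'a" and \<phi> :: "nat \<Rightarrow> 'a \<Rightarrow> real ^ 'n"
  assumes ev: "eventually (\<lambda>s. \<gamma> s = z) (nhds t)"
  shows "riemannian_speed m U \<phi> g \<gamma> t = 0"
proof -
  have "vector_derivative (f \<circ> \<gamma>) (at t) = 0" for f :: "'a \<Rightarrow> real ^ 'n"
  proof (rule vector_derivative_at)
    have "((\<lambda>s. f z) has_vector_derivative 0) (at t)" by (rule has_vector_derivative_const)
    moreover have "eventually (\<lambda>s. (f \<circ> \<gamma>) s = f z) (nhds t)" using ev by (auto elim: eventually_mono)
    ultimately show "((f \<circ> \<gamma>) has_vector_derivative 0) (at t)"
      by (subst has_vector_derivative_cong_ev[where g = "\<lambda>s. f z"]) (auto elim: eventually_mono dest: eventually_nhds_x_imp_x)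
  qed
  then show ?thesis by (simp add: riemannian_speed_def Let_def)
qed

lemma riemannian_length_reversepath:
  "riemannian_length m U \<phi> g (reversepath \<gamma>) \<le> riemannian_length m U \<phi> g \<gamma>"
proof -
  let ?f = "\<lambda>t. ennreal (riemannian_speed m U \<phi> g \<gamma> t) * indicator {0..1} t"
  have "riemannian_length m U \<phi> g (reversepath \<gamma>) \<le> (\<integral>\<^sup>+ t. ennreal \<bar>-1\<bar> * ?f (1 + (-1) * t) \<partial>lebesgue)"
    unfolding riemannian_length_eq
  proof (rule nn_integral_mono)
    fix t :: real
    have "ennreal (riemannian_speed m U \<phi> g (reversepath \<gamma>) t) \<le> ennreal \<bar>-1\<bar> * ennreal (riemannian_speed m U \<phi> g \<gamma> (1 + (-1) * t))"
      by (rule riemannian_speed_affine) (auto simp: reversepath_def)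
    then show "ennreal (riemannian_speed m U \<phi> g (reversepath \<gamma>) t) * indicator {0..1} t \<le> ennreal \<bar>-1\<bar> * ?f (1 + (-1) * t)"
      by (auto simp: indicator_def)
  qed
  also have "\<dots> \<le> (\<integral>\<^sup>+ t. ?f t \<partial>lebesgue)" by (rule nn_integral_lebesgue_affine_le) simp
  finally show ?thesis by (simp only: riemannian_length_eq)
qed

lemma riemannian_length_truncate:
  "riemannian_length m U \<phi> g (\<lambda>t. \<gamma> (min t t0)) \<le> riemannian_length m U \<phi> g \<gamma>"
  unfolding riemannian_length_eq
proof (rule nn_integral_mono_AE)
  show "AE t in lebesgue. ennreal (riemannian_speed m U \<phi> g (\<lambda>t. \<gamma> (min t t0)) t) * indicator {0..1} t
      \<le> ennreal (riemannian_speed m U \<phi> g \<gamma> t) * indicator {0..1} t"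
    using AE_lebesgue_neq[of t0]
  proof eventually_elim
    case (elim t)
    have "ennreal (riemannian_speed m U \<phi> g (\<lambda>t. \<gamma> (min t t0)) t) \<le> ennreal (riemannian_speed m U \<phi> g \<gamma> t)"
    proof (cases "t < t0")
      case True
      have "eventually (\<lambda>s. \<gamma> (min s t0) = \<gamma> (0 + 1 * s)) (nhds t)"
        using eventually_nhds_in_open[of "{..<t0}" t] True by (auto elim!: eventually_mono simp: min_def)
      from riemannian_speed_affine[OF _ this, of m U \<phi> g] show ?thesis by simp
    next
      case False
      then have "t0 < t" using elim by simp
      then have "eventually (\<lambda>s. \<gamma> (min s t0) = \<gamma> t0) (nhds t)"
        using eventually_nhds_in_open[of "{t0<..}" t] by (auto elim!: eventually_mono simp: min_def)
      then show ?thesis by (simp add: riemannian_speed_constant)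
    qed
    then show ?case by (rule mult_right_mono) (rule zero_le)
  qed
qed

text \<open>
  Both halves are parametrised at double speed; the point where they meet is a null set of times.
\<close>

lemma riemannian_length_joinpaths:
  "riemannian_length m U \<phi> g (\<gamma>1 +++ \<gamma>2) \<le> riemannian_length m U \<phi> g \<gamma>1 + riemannian_length m U \<phi> g \<gamma>2"
proof -
  let ?s = "\<lambda>\<gamma> t. ennreal (riemannian_speed m U \<phi> g \<gamma> t)"
  let ?f = "\<lambda>\<gamma> t. ?s \<gamma> t * indicator {0..1} t"
  let ?A = "{..1/2} :: real set"
  have half1: "(\<integral>\<^sup>+ t. ?f (\<gamma>1 +++ \<gamma>2) t * indicator ?A t \<partial>lebesgue) \<le> (\<integral>\<^sup>+ t. ennreal \<bar>2\<bar> * ?f \<gamma>1 (0 + 2 * t) \<partial>lebesgue)"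
  proof (rule nn_integral_mono_AE)
    show "AE t in lebesgue. ?f (\<gamma>1 +++ \<gamma>2) t * indicator ?A t \<le> ennreal \<bar>2\<bar> * ?f \<gamma>1 (0 + 2 * t)"
      using AE_lebesgue_neq[of "1/2"]
    proof eventually_elim
      case (elim t)
      show ?case
      proof (cases "0 \<le> t \<and> t < 1 / 2")
        case True
        have "eventually (\<lambda>s. (\<gamma>1 +++ \<gamma>2) s = \<gamma>1 (0 + 2 * s)) (nhds t)"
          using eventually_nhds_in_open[of "{..<1/2}" t] True by (auto elim!: eventually_mono simp: joinpaths_def)
        from riemannian_speed_affine[OF _ this, of m U \<phi> g] True show ?thesis by (simp add: indicator_def)
      next
        case False
        then show ?thesis using elim by (auto simp: indicator_def)
      qed
    qed
  qed
  have half2: "(\<integral>\<^sup>+ t. ?f (\<gamma>1 +++ \<gamma>2) t * indicator (- ?A) t \<partial>lebesgue) \<le> (\<integral>\<^sup>+ t. ennreal \<bar>2\<bar> * ?f \<gamma>2 (- 1 + 2 * t) \<partial>lebesgue)"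
  proof (rule nn_integral_mono)
    fix t :: real
    show "?f (\<gamma>1 +++ \<gamma>2) t * indicator (- ?A) t \<le> ennreal \<bar>2\<bar> * ?f \<gamma>2 (- 1 + 2 * t)"
    proof (cases "1 / 2 < t \<and> t \<le> 1")
      case True
      have "eventually (\<lambda>s. (\<gamma>1 +++ \<gamma>2) s = \<gamma>2 (- 1 + 2 * s)) (nhds t)"
        using eventually_nhds_in_open[of "{1/2<..}" t] True by (auto elim!: eventually_mono simp: joinpaths_def)
      from riemannian_speed_affine[OF _ this, of m U \<phi> g] True show ?thesis by (simp add: indicator_def)
    next
      case False
      then show ?thesis by (auto simp: indicator_def)
    qed
  qed
  have "riemannian_length m U \<phi> g (\<gamma>1 +++ \<gamma>2) \<le> (\<integral>\<^sup>+ t. ?f (\<gamma>1 +++ \<gamma>2) t * indicator ?A t \<partial>lebesgue) + (\<integral>\<^sup>+ t. ?f (\<gamma>1 +++ \<gamma>2) t * indicator (- ?A) t \<partial>lebesgue)"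
    unfolding riemannian_length_eq by (rule nn_integral_split_le) simp
  also have "\<dots> \<le> (\<integral>\<^sup>+ t. ?f \<gamma>1 t \<partial>lebesgue) + (\<integral>\<^sup>+ t. ?f \<gamma>2 t \<partial>lebesgue)"
    by (intro add_mono order.trans[OF half1 nn_integral_lebesgue_affine_le] order.trans[OF half2 nn_integral_lebesgue_affine_le]) simp_all
  finally show ?thesis by (simp only: riemannian_length_eq)
qed

lemma lipschitz_curve_reparam:
  assumes \<gamma>: "lipschitz_curve M m U \<phi> \<gamma>" and \<sigma>: "K-lipschitz_on {0..1} \<sigma>" "\<sigma> ` {0..1} \<subseteq> {0..1}"
  shows "lipschitz_curve M m U \<phi> (\<lambda>t. \<gamma> (\<sigma> t))"
proof -
  have K: "0 \<le> K" by (rule lipschitz_on_nonneg[OF \<sigma>(1)])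
  have "path (\<gamma> \<circ> \<sigma>)"
    using \<gamma> \<sigma> unfolding lipschitz_curve_def path_def
    by (intro continuous_on_compose lipschitz_on_continuous_on) (auto intro: continuous_on_subset)
  moreover have "path_image (\<gamma> \<circ> \<sigma>) \<subseteq> M"
    using \<gamma> \<sigma>(2) unfolding lipschitz_curve_def path_image_def by auto
  moreover have "\<exists>\<delta>>0. \<exists>L. L-lipschitz_on ({0..1} \<inter> ball t \<delta>) (\<phi> i \<circ> (\<gamma> \<circ> \<sigma>))"
    if i: "i < m" and t: "t \<in> {0..1}" and Ui: "\<gamma> (\<sigma> t) \<in> U i" for i t
  proof -
    have "\<sigma> t \<in> {0..1}" using t \<sigma>(2) by blast
    then obtain \<delta> L where \<delta>: "0 < \<delta>" "L-lipschitz_on ({0..1} \<inter> ball (\<sigma> t) \<delta>) (\<phi> i \<circ> \<gamma>)"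
      using \<gamma> i Ui unfolding lipschitz_curve_def by blast
    let ?S = "{0..1} \<inter> ball t (\<delta> / (K + 1))"
    have "\<sigma> ` ?S \<subseteq> {0..1} \<inter> ball (\<sigma> t) \<delta>"
    proof (intro image_subsetI IntI)
      fix s assume s: "s \<in> ?S"
      show "\<sigma> s \<in> {0..1}" using s \<sigma>(2) by blast
      have "dist (\<sigma> t) (\<sigma> s) \<le> K * dist t s"
        using s t by (intro lipschitz_onD[OF \<sigma>(1)]) auto
      also have "\<dots> \<le> (K + 1) * dist t s" by (intro mult_right_mono) auto
      also have "\<dots> < \<delta>" using s K by (simp add: field_simps)
      finally show "\<sigma> s \<in> ball (\<sigma> t) \<delta>" by simp
    qed
    then have "L-lipschitz_on (\<sigma> ` ?S) (\<phi> i \<circ> \<gamma>)" by (rule lipschitz_on_subset[OF \<delta>(2)])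
    moreover have "K-lipschitz_on ?S \<sigma>" by (rule lipschitz_on_subset[OF \<sigma>(1)]) auto
    ultimately have "(L * K)-lipschitz_on ?S ((\<phi> i \<circ> \<gamma>) \<circ> \<sigma>)"
      by (rule lipschitz_on_compose[rotated])
    then show ?thesis using \<delta>(1) K by (intro exI[of _ "\<delta> / (K + 1)"]) (auto simp: o_assoc)
  qed
  ultimately show ?thesis by (simp add: lipschitz_curve_def o_def)
qed

lemma lipschitz_curve_reversepath:
  "lipschitz_curve M m U \<phi> \<gamma> \<Longrightarrow> lipschitz_curve M m U \<phi> (reversepath \<gamma>)"
  unfolding reversepath_def
  by (rule lipschitz_curve_reparam[where K = 1]) (auto intro!: lipschitz_onI simp: dist_real_def)

lemma lipschitz_curve_truncate:
  assumes "lipschitz_curve M m U \<phi> \<gamma>" "0 \<le> t0" "t0 \<le> 1"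
  shows "lipschitz_curve M m U \<phi> (\<lambda>t. \<gamma> (min t t0))"
  by (rule lipschitz_curve_reparam[OF assms(1), where K = 1]) (use assms in \<open>auto intro!: lipschitz_onI simp: dist_real_def min_def\<close>)

lemma lipschitz_on_affine_compose:
  fixes f :: "real \<Rightarrow> 'b :: metric_space"
  assumes f: "L-lipschitz_on T f" and sub: "\<And>s. s \<in> S \<Longrightarrow> b + 2 * s \<in> T"
  shows "(2 * L)-lipschitz_on S (\<lambda>s. f (b + 2 * s))"
proof (rule lipschitz_onI)
  fix x y assume "x \<in> S" "y \<in> S"
  then have "dist (f (b + 2 * x)) (f (b + 2 * y)) \<le> L * dist (b + 2 * x) (b + 2 * y)"
    by (intro lipschitz_onD[OF f] sub)
  also have "dist (b + 2 * x) (b + 2 * y) = 2 * dist x y"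
  proof -
    have "b + 2 * x - (b + 2 * y) = 2 * (x - y)" by simp
    then show ?thesis by (simp only: dist_real_def abs_mult abs_numeral)
  qed
  finally show "dist (f (b + 2 * x)) (f (b + 2 * y)) \<le> 2 * L * dist x y" by simp
qed (use lipschitz_on_nonneg[OF f] in simp)

text \<open>
  The only critical time is \<open>1 / 2\<close>, where Lipschitz functions on adjacent intervals are glued.
\<close>

lemma lipschitz_curve_joinpaths:
  assumes \<gamma>1: "lipschitz_curve M m U \<phi> \<gamma>1" and \<gamma>2: "lipschitz_curve M m U \<phi> \<gamma>2" and eq: "pathfinish \<gamma>1 = pathstart \<gamma>2"
  shows "lipschitz_curve M m U \<phi> (\<gamma>1 +++ \<gamma>2)"
  unfolding lipschitz_curve_def
proof (intro conjI allI impI ballI)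
  show "path (\<gamma>1 +++ \<gamma>2)" using assms by (intro path_join_imp) (auto simp: lipschitz_curve_def)
  show "path_image (\<gamma>1 +++ \<gamma>2) \<subseteq> M"
    using assms path_image_join_subset[of \<gamma>1 \<gamma>2] by (auto simp: lipschitz_curve_def)
  fix i t assume i: "i < m" and t: "t \<in> {0..1}" and Ui: "(\<gamma>1 +++ \<gamma>2) t \<in> U i"
  have loc1: "\<exists>\<delta>>0. \<exists>L. L-lipschitz_on ({0..1} \<inter> ball s \<delta>) (\<phi> i \<circ> \<gamma>1)" if "s \<in> {0..1}" "\<gamma>1 s \<in> U i" for s
    using \<gamma>1 i that unfolding lipschitz_curve_def by blast
  have loc2: "\<exists>\<delta>>0. \<exists>L. L-lipschitz_on ({0..1} \<inter> ball s \<delta>) (\<phi> i \<circ> \<gamma>2)" if "s \<in> {0..1}" "\<gamma>2 s \<in> U i" for s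
    using \<gamma>2 i that unfolding lipschitz_curve_def by blast
  consider "t < 1 / 2" | "t > 1 / 2" | "t = 1 / 2" by linarith
  then show "\<exists>\<delta>>0. \<exists>L. L-lipschitz_on ({0..1} \<inter> ball t \<delta>) (\<phi> i \<circ> (\<gamma>1 +++ \<gamma>2))"
  proof cases
    case 1
    obtain \<delta> L where \<delta>: "0 < \<delta>" "L-lipschitz_on ({0..1} \<inter> ball (2 * t) \<delta>) (\<phi> i \<circ> \<gamma>1)"
      using loc1[of "2 * t"] 1 t Ui by (auto simp: joinpaths_def)
    let ?d = "min (\<delta> / 2) (1 / 2 - t)"
    have "(2 * L)-lipschitz_on ({0..1} \<inter> ball t ?d) (\<lambda>s. (\<phi> i \<circ> \<gamma>1) (0 + 2 * s))"
      by (rule lipschitz_on_affine_compose[OF \<delta>(2)]) (auto simp: dist_real_def abs_if split: if_splits)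
    then have "(2 * L)-lipschitz_on ({0..1} \<inter> ball t ?d) (\<phi> i \<circ> (\<gamma>1 +++ \<gamma>2))"
      by (rule lipschitz_on_transform) (auto simp: joinpaths_def dist_real_def)
    moreover have "0 < ?d" using \<delta>(1) 1 by simp
    ultimately show ?thesis by blast
  next
    case 2
    obtain \<delta> L where \<delta>: "0 < \<delta>" "L-lipschitz_on ({0..1} \<inter> ball (2 * t - 1) \<delta>) (\<phi> i \<circ> \<gamma>2)"
      using loc2[of "2 * t - 1"] 2 t Ui by (auto simp: joinpaths_def)
    let ?d = "min (\<delta> / 2) (t - 1 / 2)"
    have "(2 * L)-lipschitz_on ({0..1} \<inter> ball t ?d) (\<lambda>s. (\<phi> i \<circ> \<gamma>2) (- 1 + 2 * s))"
      by (rule lipschitz_on_affine_compose[OF \<delta>(2)]) (auto simp: dist_real_def abs_if split: if_splits)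
    then have "(2 * L)-lipschitz_on ({0..1} \<inter> ball t ?d) (\<phi> i \<circ> (\<gamma>1 +++ \<gamma>2))"
      by (rule lipschitz_on_transform) (auto simp: joinpaths_def dist_real_def)
    moreover have "0 < ?d" using \<delta>(1) 2 by simp
    ultimately show ?thesis by blast
  next
    case 3
    have mid: "\<gamma>1 1 = \<gamma>2 0" using eq by (simp add: pathfinish_def pathstart_def)
    have Ui1: "\<gamma>1 1 \<in> U i" using Ui 3 by (simp add: joinpaths_def)
    obtain \<delta>1 L1 where \<delta>1: "0 < \<delta>1" "L1-lipschitz_on ({0..1} \<inter> ball 1 \<delta>1) (\<phi> i \<circ> \<gamma>1)"
      using loc1[of 1] Ui1 by auto
    obtain \<delta>2 L2 where \<delta>2: "0 < \<delta>2" "L2-lipschitz_on ({0..1} \<inter> ball 0 \<delta>2) (\<phi> i \<circ> \<gamma>2)"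
      using loc2[of 0] Ui1 mid by auto
    define d where "d = min (1 / 4) (min (\<delta>1 / 4) (\<delta>2 / 4))"
    have d: "0 < d" "d \<le> 1 / 4" "2 * d < \<delta>1" "2 * d < \<delta>2" using \<delta>1(1) \<delta>2(1) by (auto simp: d_def min_def)
    have "(2 * L1)-lipschitz_on {1 / 2 - d..1 / 2} (\<lambda>s. (\<phi> i \<circ> \<gamma>1) (0 + 2 * s))"
      using d by (intro lipschitz_on_affine_compose[OF \<delta>1(2)]) (auto simp: dist_real_def abs_if split: if_splits)
    moreover have "(2 * L2)-lipschitz_on {1 / 2..1 / 2 + d} (\<lambda>s. (\<phi> i \<circ> \<gamma>2) (- 1 + 2 * s))"
      using d by (intro lipschitz_on_affine_compose[OF \<delta>2(2)]) (auto simp: dist_real_def abs_if split: if_splits)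
    ultimately have "(max (2 * L1) (2 * L2))-lipschitz_on {1 / 2 - d..1 / 2 + d}
        (\<lambda>s. if s \<le> 1 / 2 then (\<phi> i \<circ> \<gamma>1) (0 + 2 * s) else (\<phi> i \<circ> \<gamma>2) (- 1 + 2 * s))"
      by (rule lipschitz_on_concat_max) (simp add: mid)
    then have "(max (2 * L1) (2 * L2))-lipschitz_on {1 / 2 - d..1 / 2 + d} (\<phi> i \<circ> (\<gamma>1 +++ \<gamma>2))"
      by (rule lipschitz_on_transform) (auto simp: joinpaths_def)
    then have "(max (2 * L1) (2 * L2))-lipschitz_on ({0..1} \<inter> ball t d) (\<phi> i \<circ> (\<gamma>1 +++ \<gamma>2))"
      by (rule lipschitz_on_subset) (auto simp: 3 dist_real_def)
    then show ?thesis using d(1) by blast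
  qed
qed

section \<open>The geodesic distance of a compact Lipschitz manifold\<close>

lemma negligible_real_affine:
  fixes S :: "real set"
  assumes "negligible S"
  shows "negligible ((\<lambda>t. b + a * t) ` S)"
proof (rule negligible_differentiable_image_negligible[OF order_refl assms])
  show "(\<lambda>t. b + a * t) differentiable_on S" by (intro derivative_intros)
qed

locale lipschitz_manifold =
  fixes M :: "'a :: t2_space set" and m :: nat and U :: "nat \<Rightarrow> 'a set"
    and \<phi> :: "nat \<Rightarrow> 'a \<Rightarrow> real ^ 'n" and g :: "nat \<Rightarrow> real ^ 'n \<Rightarrow> real ^ 'n ^ 'n"
  assumes manifold: "compact_lipschitz_manifold M m U \<phi> g"
begin

abbreviation d :: "'a \<Rightarrow> 'a \<Rightarrow> ennreal" where "d \<equiv> geodesic_dist M m U \<phi> g"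

definition null_family :: "'a set set" where
  "null_family = {N. N \<subseteq> M \<and> null_in_charts m U \<phi> N}"

definition curves :: "'a set \<Rightarrow> 'a \<Rightarrow> 'a \<Rightarrow> (real \<Rightarrow> 'a) set" where
  "curves N x y = {\<gamma>. lipschitz_curve M m U \<phi> \<gamma> \<and> pathstart \<gamma> = x \<and> pathfinish \<gamma> = y \<and> negligible {t \<in> {0..1}. \<gamma> t \<in> N}}"

text \<open>
  The geodesic distance is the supremum of these infima.  A fixed exceptional set \<open>N\<close> is respected by the
  concatenation and the truncation of curves.
\<close>

definition avoiding_dist :: "'a set \<Rightarrow> 'a \<Rightarrow> 'a \<Rightarrow> ennreal" where
  "avoiding_dist N x y = (INF \<gamma>\<in>curves N x y. riemannian_length m U \<phi> g \<gamma>)"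

lemma d_eq: "d x y = (SUP N\<in>null_family. avoiding_dist N x y)"
  by (simp add: geodesic_dist_def avoiding_dist_def curves_def null_family_def)

lemma avoiding_dist_le_d: "N \<in> null_family \<Longrightarrow> avoiding_dist N x y \<le> d x y"
  unfolding d_eq by (rule SUP_upper)

lemma empty_null_family: "{} \<in> null_family"
  by (simp add: null_family_def null_in_charts_def)

lemma Un_null_family:
  assumes "finite I" "\<And>j. j \<in> I \<Longrightarrow> N j \<in> null_family"
  shows "(\<Union>j\<in>I. N j) \<in> null_family"
proof -
  have "negligible (\<phi> i ` ((\<Union>j\<in>I. N j) \<inter> U i))" if "i < m" for i
  proof -
    have "\<phi> i ` ((\<Union>j\<in>I. N j) \<inter> U i) = (\<Union>j\<in>I. \<phi> i ` (N j \<inter> U i))" by blast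
    moreover have "negligible (\<Union>j\<in>I. \<phi> i ` (N j \<inter> U i))"
      using assms that by (intro negligible_Union) (auto simp: null_family_def null_in_charts_def)
    ultimately show ?thesis by simp
  qed
  then show ?thesis using assms(2) by (auto simp: null_family_def null_in_charts_def)
qed

lemma avoiding_dist_mono:
  assumes "N \<subseteq> N'"
  shows "avoiding_dist N x y \<le> avoiding_dist N' x y"
  unfolding avoiding_dist_def
proof (rule INF_superset_mono)
  show "curves N' x y \<subseteq> curves N x y"
    using assms unfolding curves_def by (auto elim!: negligible_subset)
qed simp

lemma avoiding_dist_le_length: "\<gamma> \<in> curves N x y \<Longrightarrow> avoiding_dist N x y \<le> riemannian_length m U \<phi> g \<gamma>"
  unfolding avoiding_dist_def by (rule INF_lower)

lemma avoiding_dist_sym_le: "avoiding_dist N x y \<le> avoiding_dist N y x"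
  unfolding avoiding_dist_def[of N y x]
proof (rule INF_greatest)
  fix \<gamma> assume \<gamma>: "\<gamma> \<in> curves N y x"
  have "{t \<in> {0..1}. reversepath \<gamma> t \<in> N} = (\<lambda>t. 1 - t) ` {t \<in> {0..1}. \<gamma> t \<in> N}"
  proof (intro equalityI subsetI)
    fix t assume "t \<in> {t \<in> {0..1}. reversepath \<gamma> t \<in> N}"
    then show "t \<in> (\<lambda>t. 1 - t) ` {t \<in> {0..1}. \<gamma> t \<in> N}"
      by (intro image_eqI[of _ _ "1 - t"]) (auto simp: reversepath_def)
  qed (auto simp: reversepath_def)
  moreover have "negligible ((\<lambda>t. 1 - t) ` {t \<in> {0..1}. \<gamma> t \<in> N})"
    using \<gamma> by (intro negligible_differentiable_image_negligible) (auto simp: curves_def intro!: derivative_intros)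
  ultimately have "reversepath \<gamma> \<in> curves N x y"
    using \<gamma> by (simp add: curves_def lipschitz_curve_reversepath)
  from order.trans[OF avoiding_dist_le_length[OF this] riemannian_length_reversepath]
  show "avoiding_dist N x y \<le> riemannian_length m U \<phi> g \<gamma>" .
qed

lemma d_sym: "d x y = d y x"
  unfolding d_eq by (intro SUP_cong refl antisym avoiding_dist_sym_le)

lemma joinpaths_in_curves:
  assumes \<gamma>1: "\<gamma>1 \<in> curves N x y" and \<gamma>2: "\<gamma>2 \<in> curves N y z"
  shows "\<gamma>1 +++ \<gamma>2 \<in> curves N x z"
proof -
  let ?B = "\<lambda>\<gamma>. {t \<in> {0..1 :: real}. \<gamma> t \<in> N}"
  have "?B (\<gamma>1 +++ \<gamma>2) \<subseteq> (\<lambda>t. 0 + 1 / 2 * t) ` ?B \<gamma>1 \<union> (\<lambda>t. 1 / 2 + 1 / 2 * t) ` ?B \<gamma>2"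
  proof
    fix t assume t: "t \<in> ?B (\<gamma>1 +++ \<gamma>2)"
    show "t \<in> (\<lambda>t. 0 + 1 / 2 * t) ` ?B \<gamma>1 \<union> (\<lambda>t. 1 / 2 + 1 / 2 * t) ` ?B \<gamma>2"
    proof (cases "t \<le> 1 / 2")
      case True
      then have "t \<in> (\<lambda>t. 0 + 1 / 2 * t) ` ?B \<gamma>1"
        using t by (intro image_eqI[of _ _ "2 * t"]) (auto simp: joinpaths_def)
      then show ?thesis ..
    next
      case False
      then have "t \<in> (\<lambda>t. 1 / 2 + 1 / 2 * t) ` ?B \<gamma>2"
        using t by (intro image_eqI[of _ _ "2 * t - 1"]) (auto simp: joinpaths_def field_simps)
      then show ?thesis ..
    qed
  qed
  moreover have "negligible ((\<lambda>t. 0 + 1 / 2 * t) ` ?B \<gamma>1)"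
    using \<gamma>1 by (intro negligible_real_affine) (simp add: curves_def)
  moreover have "negligible ((\<lambda>t. 1 / 2 + 1 / 2 * t) ` ?B \<gamma>2)"
    using \<gamma>2 by (intro negligible_real_affine) (simp add: curves_def)
  ultimately have "negligible (?B (\<gamma>1 +++ \<gamma>2))" by (meson negligible_Un negligible_subset)
  then show ?thesis using assms by (simp add: curves_def lipschitz_curve_joinpaths)
qed

text \<open>
  Lengths of concatenated curves add up, and the times spent in \<open>N\<close> stay negligible.
\<close>

lemma avoiding_dist_triangle: "avoiding_dist N x z \<le> avoiding_dist N x y + avoiding_dist N y z"
proof (rule ennreal_le_epsilon)
  fix e :: real assume fin: "avoiding_dist N x y + avoiding_dist N y z < top" and e: "0 < e"
  then have "avoiding_dist N x y < top" "avoiding_dist N y z < top" by auto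
  moreover have "z < z + ennreal (e / 2)" if "z < top" for z :: ennreal
    using that e by (cases z) (auto simp: ennreal_plus[symmetric] ennreal_less_iff simp del: ennreal_plus)
  ultimately have "avoiding_dist N x y < avoiding_dist N x y + ennreal (e / 2)" "avoiding_dist N y z < avoiding_dist N y z + ennreal (e / 2)"
    by blast+
  then have less: "\<exists>\<gamma>\<in>curves N x y. riemannian_length m U \<phi> g \<gamma> < avoiding_dist N x y + ennreal (e / 2)"
    "\<exists>\<gamma>\<in>curves N y z. riemannian_length m U \<phi> g \<gamma> < avoiding_dist N y z + ennreal (e / 2)"
    unfolding avoiding_dist_def[of N x y] avoiding_dist_def[of N y z] INF_less_iff by auto
  obtain \<gamma>1 where \<gamma>1: "\<gamma>1 \<in> curves N x y" "riemannian_length m U \<phi> g \<gamma>1 < avoiding_dist N x y + ennreal (e / 2)"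
    using less(1) by blast
  obtain \<gamma>2 where \<gamma>2: "\<gamma>2 \<in> curves N y z" "riemannian_length m U \<phi> g \<gamma>2 < avoiding_dist N y z + ennreal (e / 2)"
    using less(2) by blast
  have "avoiding_dist N x z \<le> riemannian_length m U \<phi> g (\<gamma>1 +++ \<gamma>2)"
    by (rule avoiding_dist_le_length[OF joinpaths_in_curves[OF \<gamma>1(1) \<gamma>2(1)]])
  also have "\<dots> \<le> riemannian_length m U \<phi> g \<gamma>1 + riemannian_length m U \<phi> g \<gamma>2"
    by (rule riemannian_length_joinpaths)
  also have "\<dots> \<le> (avoiding_dist N x y + ennreal (e / 2)) + (avoiding_dist N y z + ennreal (e / 2))"
    using \<gamma>1(2) \<gamma>2(2) by (intro add_mono) auto
  also have "\<dots> = avoiding_dist N x y + avoiding_dist N y z + (ennreal (e / 2) + ennreal (e / 2))" by (simp only: add_ac)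
  also have "ennreal (e / 2) + ennreal (e / 2) = ennreal e"
    using e by (simp add: ennreal_plus[symmetric] del: ennreal_plus)
  finally show "avoiding_dist N x z \<le> avoiding_dist N x y + avoiding_dist N y z + ennreal e" .
qed

lemma d_triangle: "d x z \<le> d x y + d y z"
  unfolding d_eq[of x z]
proof (rule SUP_least)
  fix N assume N: "N \<in> null_family"
  have "avoiding_dist N x z \<le> avoiding_dist N x y + avoiding_dist N y z" by (rule avoiding_dist_triangle)
  also have "\<dots> \<le> d x y + d y z" by (intro add_mono avoiding_dist_le_d N)
  finally show "avoiding_dist N x z \<le> d x y + d y z" .
qed

lemma M_eq: "M = (\<Union>i<m. U i)" and compact_M: "compact M"
  and U_open: "i < m \<Longrightarrow> openin (top_of_set M) (U i)"
  and chart_V: "i < m \<Longrightarrow> chart_image (\<phi> i ` U i)"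
  and chart_homeo: "i < m \<Longrightarrow> \<exists>\<psi>. homeomorphism (U i) (\<phi> i ` U i) (\<phi> i) \<psi>"
  using manifold by (auto simp: compact_lipschitz_manifold_def finite_atlas_def)

lemma U_subset: "i < m \<Longrightarrow> U i \<subseteq> M"
  using M_eq by blast

lemma bilipschitz_const:
  obtains K :: real where "1 \<le> K"
    "\<And>i x y. i < m \<Longrightarrow> x \<in> U i \<Longrightarrow> y \<in> U i \<Longrightarrow> d x y \<le> ennreal (K * dist (\<phi> i x) (\<phi> i y))"
    "\<And>i x y. i < m \<Longrightarrow> x \<in> U i \<Longrightarrow> y \<in> U i \<Longrightarrow> ennreal (dist (\<phi> i x) (\<phi> i y)) \<le> ennreal K * d x y"
proof -
  from manifold have "\<forall>i. \<exists>C. i < m \<longrightarrow> (\<forall>x\<in>U i. \<forall>y\<in>U i.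
        d x y \<le> ennreal C * ennreal (dist (\<phi> i x) (\<phi> i y)) \<and>
        ennreal (dist (\<phi> i x) (\<phi> i y)) \<le> ennreal C * d x y)"
    unfolding compact_lipschitz_manifold_def by blast
  then obtain C :: "nat \<Rightarrow> real" where C: "\<And>i x y. i < m \<Longrightarrow> x \<in> U i \<Longrightarrow> y \<in> U i \<Longrightarrow>
        d x y \<le> ennreal (C i) * ennreal (dist (\<phi> i x) (\<phi> i y)) \<and>
        ennreal (dist (\<phi> i x) (\<phi> i y)) \<le> ennreal (C i) * d x y"
    by metis
  define K where "K = Max (insert 1 (C ` {..<m}))"
  have K: "1 \<le> K" "\<And>i. i < m \<Longrightarrow> C i \<le> K" unfolding K_def by auto
  show ?thesis
  proof (rule that[OF K(1)])
    fix i x y assume i: "i < m" and xy: "x \<in> U i" "y \<in> U i"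
    have "ennreal (C i) * z \<le> ennreal K * z" for z :: ennreal
      using K(2)[OF i] by (intro mult_right_mono ennreal_leI) auto
    then show "d x y \<le> ennreal (K * dist (\<phi> i x) (\<phi> i y))" "ennreal (dist (\<phi> i x) (\<phi> i y)) \<le> ennreal K * d x y"
      using C[OF i xy] K(1) by (auto simp: ennreal_mult intro: order.trans)
  qed
qed

lemma chart_image_norm_less: "i < m \<Longrightarrow> x \<in> U i \<Longrightarrow> norm (\<phi> i x) < 1"
  using chart_V[of i] by (auto simp: chart_image_def)

lemma compact_chart_part:
  assumes i: "i < m" and r: "r < 1"
  shows "compact (\<phi> i ` U i \<inter> cball 0 r)"
proof -
  have "\<phi> i ` U i = ball 0 1 \<or> (\<exists>k. \<phi> i ` U i = ball 0 1 \<inter> {x. 0 \<le> x $ k})"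
    using chart_V[OF i] by (simp add: chart_image_def)
  then have "\<phi> i ` U i \<inter> cball 0 r = cball 0 r \<or> (\<exists>k. \<phi> i ` U i \<inter> cball 0 r = cball 0 r \<inter> {x. 0 \<le> x $ k})"
  proof (elim disjE exE)
    assume "\<phi> i ` U i = ball 0 1"
    then show ?thesis using r by auto
  next
    fix k assume "\<phi> i ` U i = ball 0 1 \<inter> {x. 0 \<le> x $ k}"
    then have "\<phi> i ` U i \<inter> cball 0 r = cball 0 r \<inter> {x. 0 \<le> x $ k}" using r by auto
    then show ?thesis by blast
  qed
  moreover have "closed {x :: real ^ 'n. 0 \<le> x $ k}" for k
    by (intro closed_Collect_le continuous_intros)
  ultimately show ?thesis using compact_Int_closed[OF compact_cball[of 0 r]] by (metis compact_cball)
qed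

lemma compact_chart_core:
  assumes i: "i < m" and r: "r < 1"
  shows "compact {x \<in> U i. norm (\<phi> i x) \<le> r}"
proof -
  obtain \<psi> where \<psi>: "homeomorphism (U i) (\<phi> i ` U i) (\<phi> i) \<psi>" using chart_homeo[OF i] by blast
  have "{x \<in> U i. norm (\<phi> i x) \<le> r} = \<psi> ` (\<phi> i ` U i \<inter> cball 0 r)"
  proof (intro equalityI subsetI)
    fix x assume "x \<in> {x \<in> U i. norm (\<phi> i x) \<le> r}"
    then show "x \<in> \<psi> ` (\<phi> i ` U i \<inter> cball 0 r)"
      using homeomorphism_apply1[OF \<psi>] by (intro image_eqI[of _ _ "\<phi> i x"]) auto
  next
    fix x assume "x \<in> \<psi> ` (\<phi> i ` U i \<inter> cball 0 r)"
    then show "x \<in> {x \<in> U i. norm (\<phi> i x) \<le> r}"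
      using homeomorphism_apply1[OF \<psi>] by auto
  qed
  moreover have "continuous_on (\<phi> i ` U i \<inter> cball 0 r) \<psi>"
    using homeomorphism_cont2[OF \<psi>] by (rule continuous_on_subset) auto
  ultimately show ?thesis using compact_continuous_image[OF _ compact_chart_part[OF i r]] by simp
qed

lemma openin_chart_core:
  assumes i: "i < m"
  shows "openin (top_of_set M) {x \<in> U i. norm (\<phi> i x) < r}"
proof -
  obtain \<psi> where \<psi>: "homeomorphism (U i) (\<phi> i ` U i) (\<phi> i) \<psi>" using chart_homeo[OF i] by blast
  have "continuous_on (U i) (\<lambda>x. norm (\<phi> i x))"
    using homeomorphism_cont1[OF \<psi>] by (intro continuous_intros)
  then have "openin (top_of_set (U i)) (U i \<inter> (\<lambda>x. norm (\<phi> i x)) -` {..<r})"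
    by (rule continuous_openin_preimage_gen) simp
  moreover have "U i \<inter> (\<lambda>x. norm (\<phi> i x)) -` {..<r} = {x \<in> U i. norm (\<phi> i x) < r}" by auto
  ultimately show ?thesis using openin_trans U_open[OF i] by metis
qed

text \<open>
  The open cores \<open>\<parallel>\<phi> i x\<parallel> < 1 - 1 / (k + 2)\<close> increase with \<open>k\<close>, and finitely many cover the compact \<open>M\<close>.
\<close>

lemma chart_cores_cover:
  obtains r where "0 < r" "r < 1" "\<And>x. x \<in> M \<Longrightarrow> \<exists>i<m. x \<in> U i \<and> norm (\<phi> i x) \<le> r"
proof -
  define O' where "O' k = (\<Union>i<m. {x \<in> U i. norm (\<phi> i x) < 1 - 1 / (real k + 2)})" for k :: nat
  have "M \<subseteq> \<Union> (range O')"
  proof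
    fix x assume "x \<in> M"
    then obtain i where i: "i < m" "x \<in> U i" using M_eq by blast
    have "0 < 1 - norm (\<phi> i x)" using chart_image_norm_less[OF i] by simp
    then obtain k where "0 < k" "inverse (real k) < 1 - norm (\<phi> i x)"
      using ex_inverse_of_nat_less by blast
    moreover have "1 / (real k + 2) \<le> inverse (real k)" using \<open>0 < k\<close> by (simp add: field_simps)
    ultimately have "x \<in> O' k" using i unfolding O'_def by (intro UN_I[of i]) auto
    then show "x \<in> \<Union> (range O')" by blast
  qed
  moreover have "\<forall>c\<in>range O'. openin (top_of_set M) c"
    unfolding O'_def by (auto intro!: openin_Union openin_chart_core)
  ultimately obtain D where D: "D \<subseteq> range O'" "finite D" "M \<subseteq> \<Union> D"
    using compact_M unfolding compact_eq_openin_cover by metis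
  then obtain I where I: "finite I" "D = O' ` I" by (meson finite_subset_image)
  define k where "k = Max (insert 0 I)"
  have k: "j \<le> k" if "j \<in> I" for j using that I unfolding k_def by auto
  let ?r = "1 - 1 / (real k + 2)"
  show ?thesis
  proof (rule that[of ?r])
    show "0 < ?r" "?r < 1" by (auto simp: field_simps)
    fix x assume "x \<in> M"
    then obtain j where j: "j \<in> I" "x \<in> O' j" using D I by blast
    then obtain i where i: "i < m" "x \<in> U i" "norm (\<phi> i x) < 1 - 1 / (real j + 2)" unfolding O'_def by blast
    have "1 / (real k + 2) \<le> 1 / (real j + 2)" using k[OF j(1)] by (intro divide_left_mono) auto
    then show "\<exists>i<m. x \<in> U i \<and> norm (\<phi> i x) \<le> ?r" using i by (intro exI[of _ i]) auto
  qed
qed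

text \<open>
  A curve that leaves the chart passes the shell between \<open>r1\<close> and \<open>r2\<close> during an interval of time, so it
  can be stopped there at a moment when it is not in \<open>N\<close>.  The stopped curve stands still afterwards and
  does not spend time in \<open>N\<close>; it is not longer than the original one.
\<close>

lemma curve_crosses_shell:
  assumes i: "i < m" and r: "r < r1" "r1 < r2" "r2 < 1" and x: "x \<in> U i" "norm (\<phi> i x) \<le> r"
    and y: "y \<notin> U i" and \<gamma>: "\<gamma> \<in> curves N x y"
  obtains z where "z \<in> U i" "r1 \<le> norm (\<phi> i z)" "norm (\<phi> i z) \<le> r2" "avoiding_dist N x z \<le> riemannian_length m U \<phi> g \<gamma>"
proof -
  \<comment> \<open>The norm in the chart, cut off at \<open>r2\<close>, extends continuously to all of \<open>M\<close>.\<close>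
  define G where "G z = (if z \<in> U i then min (norm (\<phi> i z)) r2 else r2)" for z
  let ?S = "{z \<in> U i. norm (\<phi> i z) \<le> r2}" and ?T = "M - {z \<in> U i. norm (\<phi> i z) < r2}"
  obtain \<psi> where \<psi>: "homeomorphism (U i) (\<phi> i ` U i) (\<phi> i) \<psi>" using chart_homeo[OF i] by blast
  have "closed ?S" using compact_chart_core[OF i r(3)] by (rule compact_imp_closed)
  moreover have "closed ?T"
  proof -
    have "closedin (top_of_set M) ?T" using openin_chart_core[OF i, of r2] by (simp add: closedin_def Diff_Diff_Int openin_imp_subset Int_absorb1)
    then show ?thesis using compact_M closedin_compact compact_imp_closed by blast
  qed
  moreover have "continuous_on ?S G"
  proof (rule continuous_on_eq)
    show "continuous_on ?S (\<lambda>x. norm (\<phi> i x))"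
      using homeomorphism_cont1[OF \<psi>] by (intro continuous_intros) (auto elim: continuous_on_subset)
  qed (auto simp: G_def)
  moreover have "continuous_on ?T G"
    by (rule continuous_on_eq[of _ "\<lambda>_. r2"]) (auto simp: G_def)
  ultimately have "continuous_on (?S \<union> ?T) G" by (rule continuous_on_closed_Un)
  moreover have "M \<subseteq> ?S \<union> ?T" by auto
  ultimately have GM: "continuous_on M G" by (rule continuous_on_subset)
  have lc: "lipschitz_curve M m U \<phi> \<gamma>" and \<gamma>0: "\<gamma> 0 = x" and \<gamma>1: "\<gamma> 1 = y" and neg: "negligible {t \<in> {0..1}. \<gamma> t \<in> N}"
    using \<gamma> by (auto simp: curves_def pathstart_def pathfinish_def)
  have "continuous_on {0..1} \<gamma>" "\<gamma> ` {0..1} \<subseteq> M"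
    using lc by (auto simp: lipschitz_curve_def path_def path_image_def)
  then have cont: "continuous_on {0..1} (\<lambda>t. G (\<gamma> t))"
    using continuous_on_compose2[OF GM] by blast
  let ?h = "(r1 + r2) / 2"
  have "G (\<gamma> 0) \<le> ?h" "?h \<le> G (\<gamma> 1)" using x y r by (auto simp: \<gamma>0 \<gamma>1 G_def)
  then obtain t1 where t1: "0 \<le> t1" "t1 \<le> 1" "G (\<gamma> t1) = ?h"
    using IVT'[of "\<lambda>t. G (\<gamma> t)" 0 ?h 1] cont by auto
  obtain \<eta> where \<eta>: "0 < \<eta>" "\<And>t. t \<in> {0..1} \<Longrightarrow> dist t t1 < \<eta> \<Longrightarrow> dist (G (\<gamma> t)) (G (\<gamma> t1)) < (r2 - r1) / 2"
    using cont t1 r unfolding continuous_on_iff by (metis atLeastAtMost_iff diff_gt_0_iff_gt half_gt_zero)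
  let ?a = "max 0 (t1 - \<eta>)" and ?b = "min 1 (t1 + \<eta>)"
  have "?a < ?b" using t1 \<eta>(1) by auto
  have "\<not> {?a<..<?b} \<subseteq> {t \<in> {0..1}. \<gamma> t \<in> N}"
  proof
    assume "{?a<..<?b} \<subseteq> {t \<in> {0..1}. \<gamma> t \<in> N}"
    then have "negligible {?a<..<?b}" using neg negligible_subset by blast
    moreover have "\<not> negligible {?a<..<?b}"
      using \<open>?a < ?b\<close> by (intro open_not_negligible) (simp_all only: open_greaterThanLessThan greaterThanLessThan_empty_iff not_le)
    ultimately show False by simp
  qed
  then obtain t0 where t0: "?a < t0" "t0 < ?b" "\<gamma> t0 \<notin> N" by fastforce
  then have t01: "0 \<le> t0" "t0 \<le> 1" "dist t0 t1 < \<eta>" by (auto simp: dist_real_def)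
  then have "\<bar>G (\<gamma> t0) - ?h\<bar> < (r2 - r1) / 2" using \<eta>(2)[of t0] t1 by (simp add: dist_real_def)
  then have G0: "r1 < G (\<gamma> t0)" "G (\<gamma> t0) < r2" by (auto simp: abs_less_iff field_simps)
  then have z: "\<gamma> t0 \<in> U i" "G (\<gamma> t0) = norm (\<phi> i (\<gamma> t0))" by (auto simp: G_def split: if_splits)
  have "{t \<in> {0..1}. \<gamma> (min t t0) \<in> N} \<subseteq> {t \<in> {0..1}. \<gamma> t \<in> N}"
    using t0(3) by (auto simp: min_def split: if_splits)
  then have "(\<lambda>t. \<gamma> (min t t0)) \<in> curves N x (\<gamma> t0)"
    using lipschitz_curve_truncate[OF lc t01(1,2)] t01 \<gamma>0 negligible_subset[OF neg]
    by (auto simp: curves_def pathstart_def pathfinish_def)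
  from order.trans[OF avoiding_dist_le_length[OF this] riemannian_length_truncate]
  have "avoiding_dist N x (\<gamma> t0) \<le> riemannian_length m U \<phi> g \<gamma>" .
  then show ?thesis using that[of "\<gamma> t0"] z G0 by simp
qed

text \<open>
  Curves that leave the chart have to cross a shell, and points of the core have a positive distance
  from points of the shell.  The difficulty is that this distance is a supremum over exceptional
  sets that depend on the points, while a curve is only known to avoid one set.  Therefore a single set
  \<open>N\<close> is chosen that works for all pairs of points in a finite net; by the triangle inequality for \<open>avoiding_dist\<close> it
  works for all pairs, with a smaller constant.
\<close>

lemma far_bound:
  assumes i: "i < m" and r: "0 < r" "r < 1"
  obtains \<delta> where "0 < \<delta>" "\<And>x y. x \<in> U i \<Longrightarrow> norm (\<phi> i x) \<le> r \<Longrightarrow> y \<notin> U i \<Longrightarrow> ennreal \<delta> \<le> d x y"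
proof -
  obtain K where K: "1 \<le> K"
    "\<And>i x y. i < m \<Longrightarrow> x \<in> U i \<Longrightarrow> y \<in> U i \<Longrightarrow> d x y \<le> ennreal (K * dist (\<phi> i x) (\<phi> i y))"
    "\<And>i x y. i < m \<Longrightarrow> x \<in> U i \<Longrightarrow> y \<in> U i \<Longrightarrow> ennreal (dist (\<phi> i x) (\<phi> i y)) \<le> ennreal K * d x y"
    using bilipschitz_const by blast
  define r1 where "r1 = (2 * r + 1) / 3"
  define r2 where "r2 = (r + 2) / 3"
  have r12: "r < r1" "r1 < r2" "r2 < 1" using r by (auto simp: r1_def r2_def field_simps)
  define w where "w = r1 - r"
  have w: "0 < w" using r12 by (simp add: w_def)
  \<comment> \<open>Fine enough for the net to lose at most half of the distance \<open>w / (2 * K)\<close>.\<close>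
  define e where "e = w / (16 * K\<^sup>2)"
  have e: "0 < e" using w K(1) by (simp add: e_def)
  let ?S = "{z \<in> U i. norm (\<phi> i z) \<le> r2}"
  obtain D where D: "finite D" "D \<subseteq> ?S" "\<And>z. z \<in> ?S \<Longrightarrow> \<exists>z'\<in>D. dist (\<phi> i z) (\<phi> i z') < e"
  proof -
    have "compact (\<phi> i ` U i \<inter> cball 0 r2)" by (rule compact_chart_part[OF i r12(3)])
    then obtain E where E: "E \<subseteq> \<phi> i ` U i \<inter> cball 0 r2" "finite E" "\<phi> i ` U i \<inter> cball 0 r2 \<subseteq> (\<Union>v\<in>E. ball v e)"
      using compactE_image[of _ "\<phi> i ` U i \<inter> cball 0 r2" "\<lambda>v. ball v e"] e
      by (smt (verit) UN_I centre_in_ball open_ball subsetI)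
    have "\<phi> i ` U i \<inter> cball 0 r2 = \<phi> i ` ?S" by (auto simp: dist_norm)
    with E(1,2) have "finite E" "E \<subseteq> \<phi> i ` ?S" by auto
    from finite_subset_image[OF this] obtain D where D: "D \<subseteq> ?S" "finite D" "E = \<phi> i ` D" by blast
    have "\<exists>z'\<in>D. dist (\<phi> i z) (\<phi> i z') < e" if "z \<in> ?S" for z
    proof -
      have "\<phi> i z \<in> \<phi> i ` U i \<inter> cball 0 r2" using that by auto
      then have "\<phi> i z \<in> (\<Union>v\<in>E. ball v e)" using E(3) by blast
      then show ?thesis using D(3) by (auto simp: dist_commute)
    qed
    then show ?thesis using that D by blast
  qed
  have "\<exists>N\<in>null_family. ennreal (dist (\<phi> i (fst q)) (\<phi> i (snd q)) / (2 * K)) \<le> avoiding_dist N (fst q) (snd q)" if q: "q \<in> D \<times> D" for q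
  proof (cases "dist (\<phi> i (fst q)) (\<phi> i (snd q)) = 0")
    case True
    then show ?thesis using empty_null_family by (intro bexI[of _ "{}"]) auto
  next
    case False
    let ?r = "dist (\<phi> i (fst q)) (\<phi> i (snd q))"
    have pos: "0 < ?r" using False by simp
    have "ennreal (?r / (2 * K)) < ennreal (?r / K)"
      using pos K(1) by (intro ennreal_lessI) (auto simp: field_simps)
    also have "\<dots> \<le> d (fst q) (snd q)"
    proof -
      have "ennreal ?r \<le> ennreal K * d (fst q) (snd q)" using q D(2) by (intro K(3) i) auto
      then have "ennreal (1 / K) * ennreal ?r \<le> ennreal (1 / K) * (ennreal K * d (fst q) (snd q))" by (intro mult_left_mono) auto
      also have "\<dots> = d (fst q) (snd q)" using K(1) by (simp add: mult.assoc[symmetric] ennreal_mult[symmetric])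
      finally show ?thesis using K(1) by (simp add: ennreal_mult[symmetric])
    qed
    finally show ?thesis unfolding d_eq less_SUP_iff by (auto intro: less_imp_le)
  qed
  then obtain NN where NN: "\<And>q. q \<in> D \<times> D \<Longrightarrow> NN q \<in> null_family"
    "\<And>q. q \<in> D \<times> D \<Longrightarrow> ennreal (dist (\<phi> i (fst q)) (\<phi> i (snd q)) / (2 * K)) \<le> avoiding_dist (NN q) (fst q) (snd q)"
    by metis
  define N where "N = (\<Union>q\<in>D \<times> D. NN q)"
  have N: "N \<in> null_family" unfolding N_def using D(1) NN(1) by (intro Un_null_family) auto
  have Nd: "ennreal (dist (\<phi> i x0) (\<phi> i z0) / (2 * K)) \<le> avoiding_dist N x0 z0" if "x0 \<in> D" "z0 \<in> D" for x0 z0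
  proof -
    have "ennreal (dist (\<phi> i x0) (\<phi> i z0) / (2 * K)) \<le> avoiding_dist (NN (x0, z0)) x0 z0" using NN(2)[of "(x0, z0)"] that by simp
    also have "\<dots> \<le> avoiding_dist N x0 z0" using that unfolding N_def by (intro avoiding_dist_mono) auto
    finally show ?thesis .
  qed
  define \<delta> where "\<delta> = w / (4 * K)"
  have \<delta>: "0 < \<delta>" using w K(1) by (simp add: \<delta>_def)
  have shell: "ennreal \<delta> \<le> avoiding_dist N x z" if x: "x \<in> U i" "norm (\<phi> i x) \<le> r" and z: "z \<in> U i" "r1 \<le> norm (\<phi> i z)" "norm (\<phi> i z) \<le> r2" for x z
  proof -
    have xS: "x \<in> ?S" using x r12 by auto
    have zS: "z \<in> ?S" using z by auto
    obtain x0 where x0: "x0 \<in> D" "dist (\<phi> i x) (\<phi> i x0) < e" using D(3)[OF xS] by blast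
    obtain z0 where z0: "z0 \<in> D" "dist (\<phi> i z) (\<phi> i z0) < e" using D(3)[OF zS] by blast
    have U0: "x0 \<in> U i" "z0 \<in> U i" using x0 z0 D(2) by auto
    have "w \<le> dist (\<phi> i x) (\<phi> i z)"
      using x z norm_triangle_ineq2[of "\<phi> i z" "\<phi> i x"] by (simp add: w_def dist_norm norm_minus_commute)
    also have "\<dots> \<le> dist (\<phi> i x) (\<phi> i x0) + dist (\<phi> i x0) (\<phi> i z0) + dist (\<phi> i z) (\<phi> i z0)"
      using dist_triangle[of "\<phi> i x" "\<phi> i z" "\<phi> i x0"] dist_triangle[of "\<phi> i x0" "\<phi> i z" "\<phi> i z0"] by (simp add: dist_commute)
    finally have d0: "w - 2 * e \<le> dist (\<phi> i x0) (\<phi> i z0)" using x0 z0 by simp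
    have near: "avoiding_dist N p q \<le> ennreal (K * e)" if "p \<in> U i" "q \<in> U i" "dist (\<phi> i p) (\<phi> i q) < e" for p q
    proof -
      have "avoiding_dist N p q \<le> d p q" by (rule avoiding_dist_le_d[OF N])
      also have "\<dots> \<le> ennreal (K * dist (\<phi> i p) (\<phi> i q))" by (rule K(2)[OF i that(1,2)])
      also have "\<dots> \<le> ennreal (K * e)" using K(1) that(3) by (intro ennreal_leI mult_left_mono) auto
      finally show ?thesis .
    qed
    have "ennreal ((w - 2 * e) / (2 * K)) \<le> ennreal (dist (\<phi> i x0) (\<phi> i z0) / (2 * K))"
      using d0 K(1) by (intro ennreal_leI divide_right_mono) auto
    also have "\<dots> \<le> avoiding_dist N x0 z0" by (rule Nd[OF x0(1) z0(1)])
    also have "\<dots> \<le> avoiding_dist N x0 x + avoiding_dist N x z0" by (rule avoiding_dist_triangle)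
    also have "\<dots> \<le> avoiding_dist N x0 x + (avoiding_dist N x z + avoiding_dist N z z0)" by (intro add_left_mono avoiding_dist_triangle)
    also have "\<dots> \<le> ennreal (K * e) + (avoiding_dist N x z + ennreal (K * e))"
      using x0 z0 U0 x z by (intro add_mono near order_refl) (auto simp: dist_commute)
    also have "\<dots> = avoiding_dist N x z + ennreal (2 * K * e)"
      using K(1) e by (simp add: add_ac ennreal_plus[symmetric] del: ennreal_plus)
    finally have le: "ennreal ((w - 2 * e) / (2 * K)) \<le> avoiding_dist N x z + ennreal (2 * K * e)" .
    have "\<delta> + 2 * K * e \<le> (w - 2 * e) / (2 * K)"
    proof -
      have "1 \<le> K\<^sup>2" using K(1) by simp
      then have "w / K\<^sup>2 \<le> w / 1" using w by (intro divide_left_mono) auto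
      then have "16 * e \<le> w" by (simp add: e_def)
      moreover have "2 * K * e = w / (8 * K)" using K(1) by (simp add: e_def power2_eq_square field_simps)
      ultimately show ?thesis using K(1) w by (simp add: \<delta>_def field_simps)
    qed
    then have "ennreal (\<delta> + 2 * K * e) \<le> avoiding_dist N x z + ennreal (2 * K * e)"
      using le by (meson ennreal_leI order_trans)
    then have "ennreal \<delta> + ennreal (2 * K * e) \<le> avoiding_dist N x z + ennreal (2 * K * e)"
      using \<delta> K(1) e by (subst (asm) ennreal_plus) auto
    then show ?thesis by simp
  qed
  show ?thesis
  proof (rule that[OF \<delta>])
    fix x y assume x: "x \<in> U i" "norm (\<phi> i x) \<le> r" and y: "y \<notin> U i"
    have "ennreal \<delta> \<le> avoiding_dist N x y"
      unfolding avoiding_dist_def[of N x y]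
    proof (rule INF_greatest)
      fix \<gamma> assume "\<gamma> \<in> curves N x y"
      from curve_crosses_shell[OF i r12 x y this] obtain z where
        "z \<in> U i" "r1 \<le> norm (\<phi> i z)" "norm (\<phi> i z) \<le> r2" "avoiding_dist N x z \<le> riemannian_length m U \<phi> g \<gamma>" .
      with shell[OF x this(1-3)] show "ennreal \<delta> \<le> riemannian_length m U \<phi> g \<gamma>" by (meson order_trans)
    qed
    also have "\<dots> \<le> d x y" by (rule avoiding_dist_le_d[OF N])
    finally show "ennreal \<delta> \<le> d x y" .
  qed
qed

lemma local_chart_balls:
  obtains K r0 r where "1 \<le> K" "0 < r0" "r0 \<le> 1" "0 < r" "r < 1"
    "\<And>x. x \<in> M \<Longrightarrow> \<exists>i<m. x \<in> U i \<and> norm (\<phi> i x) \<le> r"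
    "\<And>i x y. i < m \<Longrightarrow> x \<in> U i \<Longrightarrow> y \<in> U i \<Longrightarrow> d x y \<le> ennreal (K * dist (\<phi> i x) (\<phi> i y))"
    "\<And>i x y. i < m \<Longrightarrow> x \<in> U i \<Longrightarrow> y \<in> U i \<Longrightarrow> ennreal (dist (\<phi> i x) (\<phi> i y)) \<le> ennreal K * d x y"
    "\<And>i x y. i < m \<Longrightarrow> x \<in> U i \<Longrightarrow> norm (\<phi> i x) \<le> r \<Longrightarrow> d x y < ennreal r0 \<Longrightarrow> y \<in> U i"
proof -
  obtain r where r: "0 < r" "r < 1" "\<And>x. x \<in> M \<Longrightarrow> \<exists>i<m. x \<in> U i \<and> norm (\<phi> i x) \<le> r"
    using chart_cores_cover by blast
  obtain K where K: "1 \<le> K"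
    "\<And>i x y. i < m \<Longrightarrow> x \<in> U i \<Longrightarrow> y \<in> U i \<Longrightarrow> d x y \<le> ennreal (K * dist (\<phi> i x) (\<phi> i y))"
    "\<And>i x y. i < m \<Longrightarrow> x \<in> U i \<Longrightarrow> y \<in> U i \<Longrightarrow> ennreal (dist (\<phi> i x) (\<phi> i y)) \<le> ennreal K * d x y"
    using bilipschitz_const by blast
  have "\<forall>i. \<exists>\<delta>>0. i < m \<longrightarrow> (\<forall>x y. x \<in> U i \<longrightarrow> norm (\<phi> i x) \<le> r \<longrightarrow> y \<notin> U i \<longrightarrow> ennreal \<delta> \<le> d x y)"
    using far_bound[OF _ r(1,2)] by (metis zero_less_one)
  then obtain \<delta> where \<delta>: "\<And>i. 0 < \<delta> i" "\<And>i x y. i < m \<Longrightarrow> x \<in> U i \<Longrightarrow> norm (\<phi> i x) \<le> r \<Longrightarrow> y \<notin> U i \<Longrightarrow> ennreal (\<delta> i) \<le> d x y"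
    by metis
  define r0 where "r0 = Min (insert 1 (\<delta> ` {..<m}))"
  have r0: "0 < r0" "r0 \<le> 1" "\<And>i. i < m \<Longrightarrow> r0 \<le> \<delta> i"
    unfolding r0_def using \<delta>(1) by (auto simp: Min_gr_iff)
  have "y \<in> U i" if "i < m" "x \<in> U i" "norm (\<phi> i x) \<le> r" "d x y < ennreal r0" for i x y
  proof (rule ccontr)
    assume "y \<notin> U i"
    then have "ennreal (\<delta> i) \<le> d x y" using \<delta>(2) that by blast
    moreover have "ennreal r0 \<le> ennreal (\<delta> i)" using r0(3)[OF that(1)] by (rule ennreal_leI)
    ultimately show False using that(4) by (meson leD order_trans)
  qed
  then show ?thesis using that[OF K(1) r0(1,2) r(1,2,3) K(2,3)] by blast
qed

end

section \<open>Truncating the distance\<close>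

definition min_power :: "nat \<Rightarrow> (nat \<Rightarrow> real) \<Rightarrow> real \<Rightarrow> ennreal" where
  "min_power l p t = (MIN i\<in>{1..l}. ennreal (t powr p i))"

context
  fixes l :: nat and p :: "nat \<Rightarrow> real"
  assumes l: "1 \<le> l" and p: "\<And>i. i \<in> {1..l} \<Longrightarrow> 1 \<le> p i"
begin

lemma min_power_attained:
  obtains i where "i \<in> {1..l}" "min_power l p t = ennreal (t powr p i)"
proof -
  have "finite ((\<lambda>i. ennreal (t powr p i)) ` {1..l})" "(\<lambda>i. ennreal (t powr p i)) ` {1..l} \<noteq> {}" using l by auto
  from Min_in[OF this] show ?thesis using that unfolding min_power_def by auto
qed

lemma min_power_le: "i \<in> {1..l} \<Longrightarrow> min_power l p t \<le> ennreal (t powr p i)"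
  unfolding min_power_def by (intro Min_le) auto

lemma min_power_finite: "min_power l p t < top"
  by (rule min_power_attained[of t]) simp

lemma min_power_mono:
  assumes "0 \<le> a" "a \<le> b"
  shows "min_power l p a \<le> min_power l p b"
proof -
  obtain i where i: "i \<in> {1..l}" "min_power l p b = ennreal (b powr p i)" by (rule min_power_attained)
  have "min_power l p a \<le> ennreal (a powr p i)" by (rule min_power_le[OF i(1)])
  also have "\<dots> \<le> ennreal (b powr p i)" using assms p[OF i(1)] by (intro ennreal_leI powr_mono2) auto
  finally show ?thesis using i by simp
qed

text \<open>
  The minimum of finitely many powers is monotone and grows by at most a constant factor when its
  argument is doubled.
\<close>

lemma min_power_add:
  assumes "0 \<le> a" "0 \<le> b"
  shows "min_power l p (a + b) \<le> ennreal (\<Sum>i=1..l. 2 powr p i) * (min_power l p a + min_power l p b)"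
proof -
  let ?S = "\<Sum>i=1..l. 2 powr p i" and ?t = "max a b"
  obtain i where i: "i \<in> {1..l}" "min_power l p ?t = ennreal (?t powr p i)" by (rule min_power_attained)
  have "min_power l p (a + b) \<le> min_power l p (2 * ?t)" using assms by (intro min_power_mono) auto
  also have "\<dots> \<le> ennreal ((2 * ?t) powr p i)" by (rule min_power_le[OF i(1)])
  also have "(2 * ?t) powr p i = 2 powr p i * ?t powr p i" using assms by (simp add: powr_mult)
  also have "ennreal \<dots> \<le> ennreal (?S * ?t powr p i)"
    using i(1) by (intro ennreal_leI mult_right_mono member_le_sum[where f = "\<lambda>i. 2 powr p i"]) auto
  also have "\<dots> = ennreal ?S * min_power l p ?t" by (simp add: i ennreal_mult sum_nonneg)
  also have "\<dots> \<le> ennreal ?S * (min_power l p a + min_power l p b)"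
    by (intro mult_left_mono) (auto simp: max_def add_increasing add_increasing2)
  finally show ?thesis .
qed

lemma min_power_measurable [measurable (raw)]:
  "f \<in> borel_measurable M \<Longrightarrow> (\<lambda>x. min_power l p (f x)) \<in> borel_measurable M"
  unfolding min_power_def by (intro borel_measurable_Min) auto

end

lemma ennreal_inverse_antimono:
  fixes a b :: ennreal
  assumes "a \<le> b"
  shows "inverse b \<le> inverse a"
proof (cases "a = 0 \<or> b = top")
  case False
  then have "a \<noteq> top" using assms by (auto simp: top_unique)
  with False obtain x y where xy: "a = ennreal x" "b = ennreal y" "0 \<le> x" "0 \<le> y" by (cases a; cases b) auto
  then have "0 < x" "x \<le> y" using False assms by (auto simp: less_le)
  then show ?thesis using xy by (simp add: inverse_ennreal ennreal_leI le_imp_inverse_le)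
qed auto

lemma frac_quotient_antimono:
  assumes "0 \<le> real n + s * p" "e x y \<le> d x y"
  shows "frac_quotient d n s p u x y \<le> frac_quotient e n s p u x y"
proof -
  have "ennreal_powr (e x y) (real n + s * p) \<le> ennreal_powr (d x y) (real n + s * p)"
    using assms by (auto simp: ennreal_powr_def top_unique less_top intro!: ennreal_leI powr_mono2 enn2real_mono)
  then show ?thesis
    unfolding frac_quotient_def divide_ennreal_def
    by (intro mult_left_mono ennreal_inverse_antimono) auto
qed

lemma frac_quotient_one:
  assumes "d x y = 1"
  shows "frac_quotient d n s p u x y = ennreal (\<bar>u x - u y\<bar> powr p)"
proof -
  have "a / 1 = a" for a :: ennreal by (simp add: divide_ennreal_def)
  then show ?thesis using assms by (simp add: frac_quotient_def ennreal_powr_def)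
qed

lemma frac_quotient_ge_power:
  assumes "0 \<le> real n + s * p" "d x y \<le> 1"
  shows "ennreal (\<bar>u x - u y\<bar> powr p) \<le> frac_quotient d n s p u x y"
proof -
  have "frac_quotient (\<lambda>_ _. 1) n s p u x y \<le> frac_quotient d n s p u x y"
    using assms by (intro frac_quotient_antimono)
  moreover have "frac_quotient (\<lambda>_ _. 1) n s p u x y = ennreal (\<bar>u x - u y\<bar> powr p)"
    by (rule frac_quotient_one) simp
  ultimately show ?thesis by simp
qed

lemma frac_quotient_cong: "d x y = e x y \<Longrightarrow> frac_quotient d n s p u x y = frac_quotient e n s p u x y"
  by (simp add: frac_quotient_def)

lemma Min_mono_image:
  fixes f g :: "nat \<Rightarrow> ennreal"
  assumes "1 \<le> l" "\<And>i. i \<in> {1..l} \<Longrightarrow> f i \<le> g i"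
  shows "(MIN i\<in>{1..l}. f i) \<le> (MIN i\<in>{1..l}. g i)"
proof -
  have "finite (g ` {1..l})" "g ` {1..l} \<noteq> {}" using assms by auto
  from Min_in[OF this] obtain i where i: "i \<in> {1..l}" "(MIN i\<in>{1..l}. g i) = g i" by auto
  have "(MIN i\<in>{1..l}. f i) \<le> f i" using i by (intro Min_le) auto
  also have "\<dots> \<le> g i" by (rule assms(2)[OF i(1)])
  finally show ?thesis using i by simp
qed

context regular_metric_measure
begin

text \<open>
  Pairs at distance less than \<open>1\<close> have the same quotients.  For the other pairs the truncated quotient is
  a power of \<open>\<bar>u x - u y\<bar>\<close>, so it suffices that \<open>min_power\<close> of \<open>\<bar>u\<bar>\<close> is integrable.  On a set of the cover all
  distances are below \<open>1\<close>, and the finiteness of the double integral shows that \<open>min_power\<close> of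
  \<open>\<bar>u - u x0\<bar>\<close> is integrable there for some \<open>x0\<close>.
\<close>

lemma frac_min_space_truncated_dist:
  fixes d :: "'a \<Rightarrow> 'a \<Rightarrow> ennreal"
  assumes l: "1 \<le> l" and s: "\<And>i. i \<in> {1..l} \<Longrightarrow> 0 < s i" and p: "\<And>i. i \<in> {1..l} \<Longrightarrow> 1 \<le> p i"
    and d: "\<And>x y. x \<in> space \<mu> \<Longrightarrow> y \<in> space \<mu> \<Longrightarrow> ennreal (\<rho> x y) = min (d x y) 1"
    and fin: "emeasure \<mu> (space \<mu>) < top"
    and cover: "finite F" "F \<subseteq> sets \<mu>" "space \<mu> \<subseteq> \<Union> F" "\<And>E x y. E \<in> F \<Longrightarrow> x \<in> E \<Longrightarrow> y \<in> E \<Longrightarrow> d x y < 1"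
  shows "frac_min_space \<mu> d m l s p = frac_min_space \<mu> rdist m l s p"
proof
  have ex: "0 \<le> real m + s i * p i" if "i \<in> {1..l}" for i using s[OF that] p[OF that] by simp
  show "frac_min_space \<mu> rdist m l s p \<subseteq> frac_min_space \<mu> d m l s p"
  proof
    fix u assume u: "u \<in> frac_min_space \<mu> rdist m l s p"
    have "(\<integral>\<^sup>+ (x, y). (MIN i\<in>{1..l}. frac_quotient d m (s i) (p i) u x y) \<partial>(\<mu> \<Otimes>\<^sub>M \<mu>))
        \<le> (\<integral>\<^sup>+ (x, y). (MIN i\<in>{1..l}. frac_quotient rdist m (s i) (p i) u x y) \<partial>(\<mu> \<Otimes>\<^sub>M \<mu>))"
    proof (rule nn_integral_mono)
      fix z assume "z \<in> space (\<mu> \<Otimes>\<^sub>M \<mu>)"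
      then obtain x y where z: "z = (x, y)" "x \<in> space \<mu>" "y \<in> space \<mu>" by (auto simp: space_pair_measure)
      have "(MIN i\<in>{1..l}. frac_quotient d m (s i) (p i) u x y) \<le> (MIN i\<in>{1..l}. frac_quotient rdist m (s i) (p i) u x y)"
        using d[OF z(2,3)] by (intro Min_mono_image l frac_quotient_antimono ex) auto
      then show "(case z of (x, y) \<Rightarrow> MIN i\<in>{1..l}. frac_quotient d m (s i) (p i) u x y)
          \<le> (case z of (x, y) \<Rightarrow> MIN i\<in>{1..l}. frac_quotient rdist m (s i) (p i) u x y)" by (simp add: z)
    qed
    then show "u \<in> frac_min_space \<mu> d m l s p"
      using u unfolding frac_min_space_def by (auto intro: le_less_trans)
  qed
  show "frac_min_space \<mu> d m l s p \<subseteq> frac_min_space \<mu> rdist m l s p"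
  proof
    fix u assume u: "u \<in> frac_min_space \<mu> d m l s p"
    let ?P = "\<mu> \<Otimes>\<^sub>M \<mu>" and ?mp = "min_power l p"
    let ?Q = "\<lambda>z. MIN i\<in>{1..l}. frac_quotient d m (s i) (p i) u (fst z) (snd z)"
    let ?R = "\<lambda>z. MIN i\<in>{1..l}. frac_quotient rdist m (s i) (p i) u (fst z) (snd z)"
    let ?D = "\<lambda>z. ?mp \<bar>u (fst z) - u (snd z)\<bar>"
    let ?H = "\<lambda>x. ?mp \<bar>u x\<bar>"
    define S where "S = ennreal (\<Sum>i=1..l. 2 powr p i)"
    have S: "S < top" by (simp add: S_def)
    have um: "u \<in> borel_measurable \<mu>" and Qfin: "(\<integral>\<^sup>+ z. ?Q z \<partial>?P) < top"
      using u by (auto simp: frac_min_space_def split_beta')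
    have Dm: "?D \<in> borel_measurable ?P"
    proof (rule min_power_measurable[where l = l and p = p, OF l p])
      show "(\<lambda>z. \<bar>u (fst z) - u (snd z)\<bar>) \<in> borel_measurable ?P" using um by measurable
    qed
    have Hm: "?H \<in> borel_measurable \<mu>"
      by (rule min_power_measurable[where l = l and p = p, OF l p]) (use um in measurable)
    have Rm: "?R \<in> borel_measurable ?P"
      using frac_quotient_measurable[OF um] by (intro borel_measurable_Min) (auto simp: split_beta')
    have DQ: "?D z \<le> ?Q z" if "d (fst z) (snd z) \<le> 1" for z
      unfolding min_power_def using that by (intro Min_mono_image l frac_quotient_ge_power ex) auto
    have HE: "(\<integral>\<^sup>+ y. ?H y * indicator E y \<partial>\<mu>) < top" if E: "E \<in> F" for E
    proof (cases "emeasure \<mu> E = 0")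
      case True
      have "AE y in \<mu>. y \<notin> E" using True E cover(2) by (intro AE_not_in) auto
      then have "(\<integral>\<^sup>+ y. ?H y * indicator E y \<partial>\<mu>) = (\<integral>\<^sup>+ y. 0 \<partial>\<mu>)"
        by (intro nn_integral_cong_AE) (auto elim!: eventually_mono)
      then show ?thesis by simp
    next
      case False
      have Em [measurable]: "E \<in> sets \<mu>" using E cover(2) by auto
      have Esub: "E \<subseteq> space \<mu>" using sets.sets_into_space[OF Em] .
      let ?I = "\<lambda>z. ?D z * indicator (E \<times> E) z"
      have Im: "?I \<in> borel_measurable ?P" using Dm by measurable
      have "(\<integral>\<^sup>+ z. ?I z \<partial>?P) \<le> (\<integral>\<^sup>+ z. ?Q z \<partial>?P)"
      proof (rule nn_integral_mono)
        fix z show "?I z \<le> ?Q z"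
        proof (cases "z \<in> E \<times> E")
          case True
          then have "d (fst z) (snd z) < 1" using cover(4)[OF E] by auto
          from DQ[OF less_imp_le[OF this]] show ?thesis using True by simp
        qed simp
      qed
      then have "(\<integral>\<^sup>+ x. \<integral>\<^sup>+ y. ?I (x, y) \<partial>\<mu> \<partial>\<mu>) \<noteq> \<infinity>"
        using Qfin nn_integral_fst[OF Im] by (auto simp: top_unique)
      moreover have "(\<lambda>x. \<integral>\<^sup>+ y. ?I (x, y) \<partial>\<mu>) \<in> borel_measurable \<mu>"
        using Im by (intro borel_measurable_nn_integral) (simp add: split_beta')
      ultimately have ae: "AE x in \<mu>. (\<integral>\<^sup>+ y. ?I (x, y) \<partial>\<mu>) \<noteq> \<infinity>" by (intro nn_integral_PInf_AE)
      have "\<exists>x0\<in>E. (\<integral>\<^sup>+ y. ?I (x0, y) \<partial>\<mu>) \<noteq> \<infinity>"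
      proof (rule ccontr)
        assume no: "\<not> ?thesis"
        have "AE x in \<mu>. x \<notin> E" using ae by eventually_elim (use no in blast)
        then have "E \<in> null_sets \<mu>" using AE_iff_null_sets[OF Em] by simp
        with False show False by auto
      qed
      then obtain x0 where x0: "x0 \<in> E" "(\<integral>\<^sup>+ y. ?I (x0, y) \<partial>\<mu>) < top" by (auto simp: less_top)
      have Ix: "(\<lambda>y. ?I (x0, y)) \<in> borel_measurable \<mu>"
        using measurable_compose[OF measurable_Pair1' Im, of x0] x0 Esub by auto
      have "(\<integral>\<^sup>+ y. ?H y * indicator E y \<partial>\<mu>) \<le> (\<integral>\<^sup>+ y. S * (?I (x0, y) + ?H x0 * indicator E y) \<partial>\<mu>)"
      proof (rule nn_integral_mono)
        fix y
        have "?H y \<le> ?mp (\<bar>u x0 - u y\<bar> + \<bar>u x0\<bar>)"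
          by (intro min_power_mono[where l = l and p = p, OF l p]) auto
        also have "\<dots> \<le> S * (?mp \<bar>u x0 - u y\<bar> + ?H x0)"
          unfolding S_def by (intro min_power_add[where l = l and p = p, OF l p]) auto
        finally show "?H y * indicator E y \<le> S * (?I (x0, y) + ?H x0 * indicator E y)"
          using x0(1) by (auto simp: indicator_def)
      qed
      also have "\<dots> = S * ((\<integral>\<^sup>+ y. ?I (x0, y) \<partial>\<mu>) + (\<integral>\<^sup>+ y. ?H x0 * indicator E y \<partial>\<mu>))"
        by (rule nn_integral_cmult_add) (use Ix in measurable)
      also have "(\<integral>\<^sup>+ y. ?H x0 * indicator E y \<partial>\<mu>) = ?H x0 * emeasure \<mu> E"
        by (rule nn_integral_cmult_indicator[OF Em])
      also have "S * ((\<integral>\<^sup>+ y. ?I (x0, y) \<partial>\<mu>) + ?H x0 * emeasure \<mu> E) < top"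
      proof -
        have "emeasure \<mu> E < top" using fin emeasure_mono[OF Esub] le_less_trans by blast
        then show ?thesis
          using S x0(2) min_power_finite[where l = l and p = p, OF l p] by (simp add: ennreal_mult_less_top)
      qed
      finally show ?thesis .
    qed
    have Hfin: "(\<integral>\<^sup>+ y. ?H y \<partial>\<mu>) < top"
    proof -
      have "(\<integral>\<^sup>+ y. ?H y \<partial>\<mu>) \<le> (\<integral>\<^sup>+ y. (\<Sum>E\<in>F. ?H y * indicator E y) \<partial>\<mu>)"
      proof (rule nn_integral_mono)
        fix y assume "y \<in> space \<mu>"
        then obtain E where E: "E \<in> F" "y \<in> E" using cover(3) by blast
        have "?H y = ?H y * indicator E y" using E by simp
        also have "\<dots> \<le> (\<Sum>E\<in>F. ?H y * indicator E y)"
          by (rule member_le_sum[where f = "\<lambda>E. ?H y * indicator E y", OF E(1) _ cover(1)]) simp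
        finally show "?H y \<le> (\<Sum>E\<in>F. ?H y * indicator E y)" .
      qed
      also have "\<dots> = (\<Sum>E\<in>F. \<integral>\<^sup>+ y. ?H y * indicator E y \<partial>\<mu>)"
        using Hm cover(2) by (intro nn_integral_sum borel_measurable_times_ennreal borel_measurable_indicator) auto
      also have "\<dots> < top" using HE cover(1) by auto
      finally show ?thesis .
    qed
    have Dfin: "(\<integral>\<^sup>+ z. ?D z \<partial>?P) < top"
    proof -
      have H1: "(\<lambda>z. ?H (fst z)) \<in> borel_measurable ?P" by (rule measurable_compose[OF measurable_fst Hm])
      have H2: "(\<lambda>z. ?H (snd z)) \<in> borel_measurable ?P" by (rule measurable_compose[OF measurable_snd Hm])
      have "(\<integral>\<^sup>+ z. ?D z \<partial>?P) \<le> (\<integral>\<^sup>+ z. S * (?H (fst z) + ?H (snd z)) \<partial>?P)"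
      proof (rule nn_integral_mono)
        fix z
        have "?D z \<le> ?mp (\<bar>u (fst z)\<bar> + \<bar>u (snd z)\<bar>)" by (intro min_power_mono[where l = l and p = p, OF l p]) auto
        also have "\<dots> \<le> S * (?H (fst z) + ?H (snd z))"
          unfolding S_def by (intro min_power_add[where l = l and p = p, OF l p]) auto
        finally show "?D z \<le> S * (?H (fst z) + ?H (snd z))" .
      qed
      also have "\<dots> = S * ((\<integral>\<^sup>+ z. ?H (fst z) \<partial>?P) + (\<integral>\<^sup>+ z. ?H (snd z) \<partial>?P))"
        by (rule nn_integral_cmult_add[OF H1 H2])
      also have "(\<integral>\<^sup>+ z. ?H (fst z) \<partial>?P) = (\<integral>\<^sup>+ x. ?H x \<partial>\<mu>) * emeasure \<mu> (space \<mu>)"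
        using Hm by (subst nn_integral_fst[OF H1, symmetric]) (simp add: nn_integral_multc)
      also have "(\<integral>\<^sup>+ z. ?H (snd z) \<partial>?P) = emeasure \<mu> (space \<mu>) * (\<integral>\<^sup>+ x. ?H x \<partial>\<mu>)"
        by (subst nn_integral_fst[OF H2, symmetric]) (simp add: mult.commute)
      also have "S * ((\<integral>\<^sup>+ x. ?H x \<partial>\<mu>) * emeasure \<mu> (space \<mu>) + emeasure \<mu> (space \<mu>) * (\<integral>\<^sup>+ x. ?H x \<partial>\<mu>)) < top"
        using S Hfin fin by (simp add: ennreal_mult_less_top)
      finally show ?thesis .
    qed
    have rm: "{z \<in> space ?P. \<rho> (fst z) (snd z) < 1} \<in> sets ?P" by measurable
    have "(\<integral>\<^sup>+ z. ?R z \<partial>?P) \<le> (\<integral>\<^sup>+ z. ?R z * indicator {z \<in> space ?P. \<rho> (fst z) (snd z) < 1} z + ?D z \<partial>?P)"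
    proof (rule nn_integral_mono)
      fix z assume z: "z \<in> space ?P"
      then have sp: "fst z \<in> space \<mu>" "snd z \<in> space \<mu>" by (auto simp: space_pair_measure)
      show "?R z \<le> ?R z * indicator {z \<in> space ?P. \<rho> (fst z) (snd z) < 1} z + ?D z"
      proof (cases "\<rho> (fst z) (snd z) < 1")
        case True
        then show ?thesis using z by (simp add: add_increasing2)
      next
        case False
        have "ennreal (\<rho> (fst z) (snd z)) \<le> 1" by (simp add: d[OF sp])
        then have "\<rho> (fst z) (snd z) \<le> 1" by simp
        with False have "ennreal (\<rho> (fst z) (snd z)) = 1" by simp
        then have "?R z = ?D z" by (simp add: frac_quotient_one min_power_def)
        then show ?thesis by simp
      qed
    qed
    also have "\<dots> = (\<integral>\<^sup>+ z. ?R z * indicator {z \<in> space ?P. \<rho> (fst z) (snd z) < 1} z \<partial>?P) + (\<integral>\<^sup>+ z. ?D z \<partial>?P)"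
      by (intro nn_integral_add Dm borel_measurable_times_ennreal Rm borel_measurable_indicator rm)
    also have "\<dots> \<le> (\<integral>\<^sup>+ z. ?Q z \<partial>?P) + (\<integral>\<^sup>+ z. ?D z \<partial>?P)"
    proof (intro add_right_mono nn_integral_mono)
      fix z assume z: "z \<in> space ?P"
      then have sp: "fst z \<in> space \<mu>" "snd z \<in> space \<mu>" by (auto simp: space_pair_measure)
      show "?R z * indicator {z \<in> space ?P. \<rho> (fst z) (snd z) < 1} z \<le> ?Q z"
      proof (cases "\<rho> (fst z) (snd z) < 1")
        case True
        have "ennreal (\<rho> (fst z) (snd z)) < 1" using True by (simp add: ennreal_less_one_iff)
        then have "ennreal (\<rho> (fst z) (snd z)) = d (fst z) (snd z)"
          using d[OF sp] by (simp add: min_def split: if_splits)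
        then have "frac_quotient rdist m (s i) (p i) u (fst z) (snd z) = frac_quotient d m (s i) (p i) u (fst z) (snd z)" for i
          by (intro frac_quotient_cong)
        then show ?thesis by (simp add: indicator_def)
      qed simp
    qed
    also have "\<dots> < top" using Qfin Dfin by simp
    finally show "u \<in> frac_min_space \<mu> rdist m l s p"
      using um by (simp add: frac_min_space_def split_beta')
  qed
qed

end

lemma frac_sobolev_eq_min_space:
  "frac_sobolev M d n s p = frac_min_space M d n 1 (\<lambda>_. s) (\<lambda>_. p)"
  by (simp add: frac_sobolev_def frac_min_space_def)

section \<open>The Riemannian volume of geodesic balls\<close>

lemma det_abs_le:
  fixes A :: "real ^ 'n ^ 'n"
  assumes "\<And>i j. \<bar>A $ i $ j\<bar> \<le> B"
  shows "\<bar>det A\<bar> \<le> fact CARD('n) * B ^ CARD('n)"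
proof -
  have "\<bar>det A\<bar> \<le> (\<Sum>q\<in>{q. q permutes (UNIV :: 'n set)}. \<bar>of_int (sign q) * (\<Prod>i\<in>UNIV. A $ i $ q i)\<bar>)"
    unfolding det_def by (rule sum_abs)
  also have "\<dots> \<le> (\<Sum>q\<in>{q. q permutes (UNIV :: 'n set)}. B ^ CARD('n))"
  proof (rule sum_mono)
    fix q :: "'n \<Rightarrow> 'n"
    have "\<bar>\<Prod>i\<in>UNIV. A $ i $ q i\<bar> \<le> (\<Prod>i\<in>(UNIV :: 'n set). B)"
      unfolding abs_prod by (intro prod_mono) (use assms in auto)
    moreover have "\<bar>of_int (sign q) :: real\<bar> = 1" by (simp add: sign_def)
    ultimately show "\<bar>of_int (sign q) * (\<Prod>i\<in>UNIV. A $ i $ q i)\<bar> \<le> B ^ CARD('n)" by (simp add: abs_mult)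
  qed
  also have "\<dots> = fact CARD('n) * B ^ CARD('n)"
    using card_permutations[of "UNIV :: 'n set" "CARD('n)"] by simp
  finally show ?thesis .
qed

lemma elliptic_matrix_nonsingular:
  fixes A :: "real ^ 'n ^ 'n"
  assumes "0 < c" "\<And>w. c * (norm w)\<^sup>2 \<le> w \<bullet> (A *v w)"
  shows "det A \<noteq> 0"
proof -
  have "w = 0" if "A *v w = 0" for w
  proof -
    have "c * (norm w)\<^sup>2 \<le> 0" using assms(2)[of w] that by simp
    then show ?thesis using assms(1) by (simp add: mult_le_0_iff)
  qed
  then have "\<exists>B. B ** A = mat 1" by (simp add: matrix_left_invertible_ker)
  then show ?thesis using invertible_det_nz invertible_left_inverse by blast
qed

text \<open>
  The segment from the identity to \<open>A\<close> consists of elliptic matrices, so the determinant does not vanish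
  on it and keeps its sign.
\<close>

lemma elliptic_det_pos:
  fixes A :: "real ^ 'n ^ 'n"
  assumes c: "0 < c" and A: "\<And>w. c * (norm w)\<^sup>2 \<le> w \<bullet> (A *v w)"
  shows "0 < det A"
proof (rule ccontr)
  assume "\<not> 0 < det A"
  then have neg: "det A \<le> 0" by simp
  \<comment> \<open>The straight path of matrices from the identity to \<open>A\<close>.\<close>
  define T where "T t = (\<chi> i j. (1 - t) * (mat 1 :: real ^ 'n ^ 'n) $ i $ j + t * A $ i $ j)" for t :: real
  have T: "T t *v w = (1 - t) *\<^sub>R w + t *\<^sub>R (A *v w)" for t w
  proof -
    have "T t = (1 - t) *\<^sub>R mat 1 + t *\<^sub>R A" by (simp add: T_def vec_eq_iff)
    then show ?thesis by (simp add: matrix_vector_mult_add_rdistrib scaleR_matrix_vector_assoc[symmetric])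
  qed
  have nz: "det (T t) \<noteq> 0" if t: "0 \<le> t" "t \<le> 1" for t
  proof (rule elliptic_matrix_nonsingular[of "min 1 c"])
    show "0 < min 1 c" using c by simp
    fix w :: "real ^ 'n"
    have "min 1 c * (norm w)\<^sup>2 = (1 - t) * (min 1 c * (norm w)\<^sup>2) + t * (min 1 c * (norm w)\<^sup>2)" by (simp add: algebra_simps)
    also have "\<dots> \<le> (1 - t) * (1 * (norm w)\<^sup>2) + t * (c * (norm w)\<^sup>2)"
      using t by (intro add_mono mult_left_mono mult_right_mono) auto
    also have "\<dots> \<le> (1 - t) * (w \<bullet> w) + t * (w \<bullet> (A *v w))"
      using t A[of w] by (intro add_mono mult_left_mono) (auto simp: power2_norm_eq_inner)
    also have "\<dots> = w \<bullet> (T t *v w)" by (simp add: T inner_add_right)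
    finally show "min 1 c * (norm w)\<^sup>2 \<le> w \<bullet> (T t *v w)" .
  qed
  have cont: "continuous_on {0..1} (\<lambda>t. det (T t))"
    unfolding det_def T_def by (auto intro!: continuous_intros)
  have "T 0 = mat 1" "T 1 = A" by (simp_all add: T_def vec_eq_iff)
  then have "det (T 1) \<le> 0" "0 \<le> det (T 0)" using neg by auto
  from IVT2'[OF this _ cont] obtain t where "0 \<le> t" "t \<le> 1" "det (T t) = 0" by auto
  with nz show False by blast
qed

text \<open>
  The inverse matrix has entries at most \<open>1 / c\<close>, which bounds its determinant.
\<close>

lemma elliptic_det_lower:
  fixes A :: "real ^ 'n ^ 'n"
  assumes c: "0 < c" and A: "\<And>w. c * (norm w)\<^sup>2 \<le> w \<bullet> (A *v w)"
  shows "1 / (fact CARD('n) * (1 / c) ^ CARD('n)) \<le> det A"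
proof -
  have pos: "0 < det A" by (rule elliptic_det_pos[OF assms])
  then obtain B where B: "A ** B = mat 1" using invertible_det_nz[of A] by (auto simp: invertible_def)
  have "\<bar>B $ i $ j\<bar> \<le> 1 / c" for i j
  proof -
    let ?v = "B *v axis j 1"
    have Av: "A *v ?v = axis j 1" by (simp add: matrix_vector_mul_assoc B)
    have "c * (norm ?v)\<^sup>2 \<le> ?v \<bullet> axis j 1" using A[of ?v] Av by simp
    also have "\<dots> \<le> norm ?v * norm (axis j (1 :: real) :: real ^ 'n)" by (rule norm_cauchy_schwarz)
    also have "\<dots> = norm ?v" by (simp add: norm_axis_1)
    finally have "c * norm ?v * norm ?v \<le> 1 * norm ?v" by (simp add: power2_eq_square)
    then have "norm ?v \<le> 1 / c" using c by (cases "norm ?v = 0") (auto simp: field_simps)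
    moreover have "\<bar>B $ i $ j\<bar> \<le> norm ?v"
      using component_le_norm_cart[of ?v i] by (simp add: matrix_vector_mul_component inner_axis)
    ultimately show ?thesis by simp
  qed
  from det_abs_le[OF this] have "\<bar>det B\<bar> \<le> fact CARD('n) * (1 / c) ^ CARD('n)" .
  moreover have "det A * det B = 1" using det_mul[of A B] B by simp
  then have "det B = 1 / det A" using pos by (simp add: field_simps)
  ultimately have "1 / det A \<le> fact CARD('n) * (1 / c) ^ CARD('n)" using pos by simp
  then show ?thesis using pos c by (simp add: field_simps)
qed

text \<open>
  By polarisation the entries of a symmetric matrix are bounded by its quadratic form.
\<close>

lemma elliptic_det_upper:
  fixes A :: "real ^ 'n ^ 'n"
  assumes sym: "transpose A = A" and c: "0 \<le> c" and A: "\<And>w. c * (norm w)\<^sup>2 \<le> w \<bullet> (A *v w)" "\<And>w. w \<bullet> (A *v w) \<le> C * (norm w)\<^sup>2"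
  shows "det A \<le> fact CARD('n) * (4 * \<bar>C\<bar>) ^ CARD('n)"
proof -
  have "\<bar>A $ i $ j\<bar> \<le> 4 * \<bar>C\<bar>" for i j
  proof -
    let ?a = "axis i (1 :: real) :: real ^ 'n" and ?b = "axis j (1 :: real) :: real ^ 'n"
    let ?q = "\<lambda>w. w \<bullet> (A *v w)"
    have ab: "axis i 1 \<bullet> (A *v axis j 1) = A $ i $ j" "axis j 1 \<bullet> (A *v axis i 1) = A $ i $ j"
    proof -
      have "axis i' (1 :: real) \<bullet> (A *v axis j' 1) = A $ i' $ j'" for i' j'
        by (simp add: inner_axis' matrix_vector_mul_component inner_axis)
      moreover have "A $ j $ i = A $ i $ j"
      proof -
        have "transpose A $ i $ j = A $ j $ i" by (simp add: transpose_def)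
        then show ?thesis by (simp only: sym)
      qed
      ultimately show "axis i 1 \<bullet> (A *v axis j 1) = A $ i $ j" "axis j 1 \<bullet> (A *v axis i 1) = A $ i $ j" by auto
    qed
    have "4 * A $ i $ j = ?q (?a + ?b) - ?q (?a - ?b)"
      by (simp add: matrix_vector_right_distrib matrix_vector_mult_diff_distrib inner_add_left inner_add_right inner_diff_left inner_diff_right ab)
    moreover have "0 \<le> ?q w" for w using A(1)[of w] c by (meson mult_nonneg_nonneg order_trans zero_le_power2)
    moreover have "?q w \<le> 16 * \<bar>C\<bar>" if "norm w \<le> 2" for w
    proof -
      have "?q w \<le> \<bar>C\<bar> * (norm w)\<^sup>2" using A(2)[of w] mult_right_mono[OF abs_ge_self[of C] zero_le_power2[of "norm w"]] by linarith
      also have "\<dots> \<le> \<bar>C\<bar> * 2\<^sup>2" using that by (intro mult_left_mono power_mono) auto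
      finally show ?thesis by simp
    qed
    moreover have "norm (?a + ?b) \<le> 2" "norm (?a - ?b) \<le> 2"
      using norm_triangle_ineq[of ?a ?b] norm_triangle_ineq4[of ?a ?b] by (auto simp: norm_axis_1)
    ultimately show ?thesis by (smt (verit))
  qed
  from det_abs_le[OF this] show ?thesis by linarith
qed

lemma chart_image_measurable:
  fixes V :: "(real ^ 'n) set"
  assumes "chart_image V"
  shows "V \<in> sets borel"
proof -
  have "{x :: real ^ 'n. 0 \<le> x $ k} \<in> sets borel" for k
    by (intro borel_closed closed_Collect_le continuous_intros)
  moreover have "ball (0 :: real ^ 'n) 1 \<in> sets borel" by (intro borel_open open_ball)
  ultimately show ?thesis using assms unfolding chart_image_def by (elim disjE exE) (simp_all only: sets.Int)
qed

text \<open>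
  A chart image is convex and contains a ball of radius \<open>1 / 2\<close>; contracting that ball towards \<open>x\<close> gives the
  balls required at all scales.
\<close>

lemma chart_image_interior_ball:
  fixes V :: "(real ^ 'n) set"
  assumes V: "chart_image V" and x: "x \<in> V" and r: "0 < r" "r \<le> 1"
  shows "\<exists>w. ball w (r / 8) \<subseteq> V \<inter> ball x r"
proof -
  obtain a where a: "ball a (1 / 2) \<subseteq> V" "convex V" "V \<subseteq> ball 0 1"
  proof (cases "V = ball 0 1")
    case True
    have "ball (0 :: real ^ 'n) (1 / 2) \<subseteq> ball 0 1" by (intro subset_ball) simp
    then show ?thesis using that[of 0] True by auto
  next
    case False
    then obtain k where k: "V = ball 0 1 \<inter> {x. 0 \<le> x $ k}" using V unfolding chart_image_def by blast
    let ?a = "axis k (1 / 2) :: real ^ 'n"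
    have "ball ?a (1 / 2) \<subseteq> V"
    proof
      fix y assume "y \<in> ball ?a (1 / 2)"
      then have y: "norm (y - ?a) < 1 / 2" by (simp add: dist_norm norm_minus_commute)
      have "norm y \<le> norm (y - ?a) + norm ?a" using norm_triangle_ineq[of "y - ?a" ?a] by simp
      moreover have "?a = (1 / 2) *\<^sub>R axis k 1" by (simp add: vec_eq_iff axis_def)
      then have "norm ?a = 1 / 2" by (simp only: norm_scaleR norm_axis_1)
      ultimately have "norm y < 1" using y by linarith
      moreover have "\<bar>(y - ?a) $ k\<bar> \<le> norm (y - ?a)" by (rule component_le_norm_cart)
      then have "0 \<le> y $ k" using y by (simp add: axis_def)
      ultimately show "y \<in> V" by (simp add: k)
    qed
    moreover have "convex {x :: real ^ 'n. 0 \<le> x $ k}"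
      using convex_halfspace_ge[of 0 "axis k 1 :: real ^ 'n"] by (simp add: inner_axis')
    then have "convex V" unfolding k by (intro convex_Int convex_ball)
    ultimately show ?thesis using that[of ?a] k by auto
  qed
  define t where "t = r / 4"
  have t: "0 < t" "t \<le> 1" using r by (auto simp: t_def)
  let ?w = "(1 - t) *\<^sub>R x + t *\<^sub>R a"
  have "ball ?w (r / 8) \<subseteq> V \<inter> ball x r"
  proof
    fix y assume "y \<in> ball ?w (r / 8)"
    then have y: "norm (y - ?w) < r / 8" by (simp add: dist_norm norm_minus_commute)
    define z where "z = y - ?w"
    have "norm z < r / 8" using y unfolding z_def .
    moreover have "r / 8 = t * (1 / 2)" by (simp add: t_def)
    ultimately have "norm z < t * (1 / 2)" by linarith
    then have "norm z / t < 1 / 2" using t(1) by (simp only: pos_divide_less_eq mult.commute)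
    then have nz: "norm ((1 / t) *\<^sub>R z) < 1 / 2" using t(1) by simp
    let ?v = "a + (1 / t) *\<^sub>R z"
    have "?v \<in> ball a (1 / 2)" using nz by (simp only: mem_ball dist_norm) simp
    then have "?v \<in> V" using a(1) by blast
    moreover have "y = (1 - t) *\<^sub>R x + t *\<^sub>R ?v"
    proof -
      have "y = ?w + z" by (simp add: z_def)
      then show ?thesis using t(1) by (simp add: scaleR_add_right)
    qed
    ultimately have "y \<in> V" using convexD_alt[OF a(2) x, of ?v t] t by simp
    moreover have "norm (y - x) < r"
    proof -
      have "a \<in> V" using a(1) centre_in_ball[of a "1 / 2"] by auto
      then have "a \<in> ball 0 1" "x \<in> ball 0 1" using a(3) x by auto
      then have "norm (a - x) \<le> 2" using norm_triangle_ineq4[of a x] by simp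
      then have "t * norm (a - x) \<le> t * 2" using t by (intro mult_left_mono) auto
      moreover have "norm (y - x) \<le> norm (y - ?w) + t * norm (a - x)"
      proof -
        have eq: "y - x = (y - ?w) + t *\<^sub>R (a - x)" by (simp add: algebra_simps)
        have "norm (y - x) = norm ((y - ?w) + t *\<^sub>R (a - x))" by (rule arg_cong[OF eq])
        also have "\<dots> \<le> norm (y - ?w) + norm (t *\<^sub>R (a - x))" by (rule norm_triangle_ineq)
        also have "norm (t *\<^sub>R (a - x)) = t * norm (a - x)" using t(1) by simp
        finally show ?thesis .
      qed
      ultimately have "norm (y - x) \<le> norm (y - ?w) + t * 2" by linarith
      then show ?thesis using y r by (simp add: t_def)
    qed
    ultimately show "y \<in> V \<inter> ball x r" by (simp add: dist_norm norm_minus_commute)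
  qed
  then show ?thesis by blast
qed

locale measured_lipschitz_manifold = lipschitz_manifold M m U \<phi> g
  for M :: "'a :: t2_space set" and m :: nat and U :: "nat \<Rightarrow> 'a set"
    and \<phi> :: "nat \<Rightarrow> 'a \<Rightarrow> real ^ 'n" and g :: "nat \<Rightarrow> real ^ 'n \<Rightarrow> real ^ 'n ^ 'n" +
  fixes \<nu> :: "'a measure"
  assumes volume: "riemannian_volume M m U \<phi> g \<nu>"
begin

lemma space_nu: "space \<nu> = M"
  and sets_nu: "A \<in> sets \<nu> \<longleftrightarrow> A \<subseteq> M \<and> (\<forall>i<m. \<phi> i ` (A \<inter> U i) \<in> sets lebesgue)"
  and emeasure_nu: "i < m \<Longrightarrow> A \<in> sets \<nu> \<Longrightarrow> A \<subseteq> U i \<Longrightarrow>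
        emeasure \<nu> A = (\<integral>\<^sup>+ x. ennreal (sqrt (det (g i x))) \<partial>lebesgue_on (\<phi> i ` A))"
  using volume by (auto simp: riemannian_volume_def)

lemma V_lebesgue: "i < m \<Longrightarrow> \<phi> i ` U i \<in> sets lebesgue"
  using chart_image_measurable[OF chart_V] by (intro sets_completionI_sets) (simp add: sets_lborel)

text \<open>
  A relatively open set has relatively open chart images, because charts are homeomorphisms.
\<close>

lemma openin_sets_nu:
  assumes A: "openin (top_of_set M) A"
  shows "A \<in> sets \<nu>"
  unfolding sets_nu
proof (intro conjI allI impI)
  show "A \<subseteq> M" using A openin_imp_subset by blast
  fix i assume i: "i < m"
  obtain \<psi> where \<psi>: "homeomorphism (U i) (\<phi> i ` U i) (\<phi> i) \<psi>" using chart_homeo[OF i] by blast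
  obtain T where T: "open T" "A = M \<inter> T" using A unfolding openin_open by blast
  have "A \<inter> U i = U i \<inter> T" using T(2) U_subset[OF i] by blast
  then have "openin (top_of_set (U i)) (A \<inter> U i)" using openin_open_Int[OF T(1), of "U i"] by simp
  then have "openin (top_of_set (\<phi> i ` U i)) (\<phi> i ` (A \<inter> U i))"
    using homeomorphism_imp_open_map[OF \<psi>] by blast
  then obtain W where "open W" "\<phi> i ` (A \<inter> U i) = \<phi> i ` U i \<inter> W" unfolding openin_open by blast
  moreover have "\<phi> i ` U i \<inter> W \<in> sets borel" if "open W" for W
    by (rule sets.Int[OF chart_image_measurable[OF chart_V[OF i]] borel_open[OF that]])
  ultimately have "\<phi> i ` (A \<inter> U i) \<in> sets borel" by simp
  then show "\<phi> i ` (A \<inter> U i) \<in> sets lebesgue" by (intro sets_completionI_sets) (simp add: sets_lborel)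
qed

lemma openin_chartI:
  assumes sub: "A \<subseteq> M"
    and loc: "\<And>i y. i < m \<Longrightarrow> y \<in> A \<Longrightarrow> y \<in> U i \<Longrightarrow> \<exists>\<eta>>0. \<forall>y'\<in>U i. dist (\<phi> i y) (\<phi> i y') < \<eta> \<longrightarrow> y' \<in> A"
  shows "openin (top_of_set M) A"
proof -
  have "openin (top_of_set M) (A \<inter> U i)" if i: "i < m" for i
  proof -
    obtain \<psi> where \<psi>: "homeomorphism (U i) (\<phi> i ` U i) (\<phi> i) \<psi>" using chart_homeo[OF i] by blast
    have "\<forall>y. \<exists>\<eta>. y \<in> A \<inter> U i \<longrightarrow> 0 < \<eta> \<and> (\<forall>y'\<in>U i. dist (\<phi> i y) (\<phi> i y') < \<eta> \<longrightarrow> y' \<in> A)"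
      using loc[OF i] by blast
    then obtain \<eta> where \<eta>: "\<forall>y. y \<in> A \<inter> U i \<longrightarrow> 0 < \<eta> y \<and> (\<forall>y'\<in>U i. dist (\<phi> i y) (\<phi> i y') < \<eta> y \<longrightarrow> y' \<in> A)"
      by (rule choice[THEN exE])
    let ?W = "\<Union>y\<in>A \<inter> U i. ball (\<phi> i y) (\<eta> y)"
    have eq: "A \<inter> U i = U i \<inter> \<phi> i -` ?W"
    proof (intro equalityI subsetI)
      fix y assume y: "y \<in> A \<inter> U i"
      then have "\<phi> i y \<in> ball (\<phi> i y) (\<eta> y)" using \<eta> by simp
      then show "y \<in> U i \<inter> \<phi> i -` ?W" using y by blast
    next
      fix y' assume y': "y' \<in> U i \<inter> \<phi> i -` ?W"
      then obtain y where "y \<in> A \<inter> U i" "dist (\<phi> i y) (\<phi> i y') < \<eta> y" by auto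
      then show "y' \<in> A \<inter> U i" using \<eta> y' by blast
    qed
    have "openin (top_of_set (U i)) (U i \<inter> \<phi> i -` ?W)"
      by (rule continuous_openin_preimage_gen[OF homeomorphism_cont1[OF \<psi>]]) auto
    then have "openin (top_of_set (U i)) (A \<inter> U i)" by (simp only: eq[symmetric])
    then show ?thesis by (rule openin_trans[OF _ U_open[OF i]])
  qed
  then have "openin (top_of_set M) (\<Union>i<m. A \<inter> U i)" by (intro openin_Union) auto
  moreover have "(\<Union>i<m. A \<inter> U i) = A" using sub M_eq by blast
  ultimately show ?thesis by simp
qed

lemma det_bounds:
  obtains a b :: real where "0 < a" "0 < b"
    "\<And>i. i < m \<Longrightarrow> AE x in lebesgue. x \<in> \<phi> i ` U i \<longrightarrow> a \<le> sqrt (det (g i x)) \<and> sqrt (det (g i x)) \<le> b"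
proof -
  have "riemannian_metric m U \<phi> g" using manifold by (simp add: compact_lipschitz_manifold_def)
  then obtain c C where c: "0 < c" and cC: "\<And>i. i < m \<Longrightarrow> AE x in lebesgue_on (\<phi> i ` U i).
        transpose (g i x) = g i x \<and>
        (\<forall>w. c * (norm w)\<^sup>2 \<le> w \<bullet> (g i x *v w) \<and> w \<bullet> (g i x *v w) \<le> C * (norm w)\<^sup>2)"
    unfolding riemannian_metric_def by blast
  let ?a = "1 / (fact CARD('n) * (1 / c) ^ CARD('n)) :: real" and ?b = "fact CARD('n) * (4 * \<bar>C\<bar>) ^ CARD('n) :: real"
  have a: "0 < ?a" using c by simp
  show ?thesis
  proof (rule that[of "sqrt ?a" "sqrt ?b + 1"])
    show "0 < sqrt ?a" using a by simp
    show "0 < sqrt ?b + 1" by (intro add_nonneg_pos) auto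
    fix i assume i: "i < m"
    have "AE x in lebesgue. x \<in> \<phi> i ` U i \<longrightarrow> transpose (g i x) = g i x \<and>
        (\<forall>w. c * (norm w)\<^sup>2 \<le> w \<bullet> (g i x *v w) \<and> w \<bullet> (g i x *v w) \<le> C * (norm w)\<^sup>2)"
      using cC[OF i] V_lebesgue[OF i] by (simp only: AE_restrict_space_iff sets.Int_space_eq2)
    then show "AE x in lebesgue. x \<in> \<phi> i ` U i \<longrightarrow> sqrt ?a \<le> sqrt (det (g i x)) \<and> sqrt (det (g i x)) \<le> sqrt ?b + 1"
    proof eventually_elim
      case (elim x)
      show ?case
      proof
        assume "x \<in> \<phi> i ` U i"
        with elim have "transpose (g i x) = g i x" "\<And>w. c * (norm w)\<^sup>2 \<le> w \<bullet> (g i x *v w)" "\<And>w. w \<bullet> (g i x *v w) \<le> C * (norm w)\<^sup>2" by auto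
        moreover have "0 \<le> c" using c by simp
        ultimately have "?a \<le> det (g i x)" "det (g i x) \<le> ?b"
          using elliptic_det_lower[OF c, of "g i x"] elliptic_det_upper[of "g i x" c C] c by blast+
        then have "sqrt ?a \<le> sqrt (det (g i x))" "sqrt (det (g i x)) \<le> sqrt ?b" by (simp_all only: real_sqrt_le_iff)
        then show "sqrt ?a \<le> sqrt (det (g i x)) \<and> sqrt (det (g i x)) \<le> sqrt ?b + 1" by linarith
      qed
    qed
  qed
qed

lemma volume_bounds:
  obtains a b :: real where "0 < a" "0 < b"
    "\<And>i A. i < m \<Longrightarrow> A \<in> sets \<nu> \<Longrightarrow> A \<subseteq> U i \<Longrightarrow> ennreal a * emeasure lebesgue (\<phi> i ` A) \<le> emeasure \<nu> A"
    "\<And>i A. i < m \<Longrightarrow> A \<in> sets \<nu> \<Longrightarrow> A \<subseteq> U i \<Longrightarrow> emeasure \<nu> A \<le> ennreal b * emeasure lebesgue (\<phi> i ` A)"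
proof -
  obtain a b where ab: "0 < a" "0 < b"
    "\<And>i. i < m \<Longrightarrow> AE x in lebesgue. x \<in> \<phi> i ` U i \<longrightarrow> a \<le> sqrt (det (g i x)) \<and> sqrt (det (g i x)) \<le> b"
    by (rule det_bounds) (rule that)
  have main: "ennreal a * emeasure lebesgue (\<phi> i ` A) \<le> emeasure \<nu> A \<and> emeasure \<nu> A \<le> ennreal b * emeasure lebesgue (\<phi> i ` A)"
    if i: "i < m" and A: "A \<in> sets \<nu>" "A \<subseteq> U i" for i A
  proof -
    have L: "\<phi> i ` A \<in> sets lebesgue" using A i unfolding sets_nu by (auto simp: Int_absorb2)
    have sub: "\<phi> i ` A \<subseteq> \<phi> i ` U i" using A by blast
    have ae: "AE x in lebesgue_on (\<phi> i ` A). a \<le> sqrt (det (g i x)) \<and> sqrt (det (g i x)) \<le> b"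
    proof -
      have "AE x in lebesgue. x \<in> \<phi> i ` A \<longrightarrow> a \<le> sqrt (det (g i x)) \<and> sqrt (det (g i x)) \<le> b"
        using ab(3)[OF i] by eventually_elim (use sub in blast)
      then show ?thesis using L by (simp only: AE_restrict_space_iff sets.Int_space_eq2)
    qed
    have const: "(\<integral>\<^sup>+ x. ennreal z \<partial>lebesgue_on (\<phi> i ` A)) = ennreal z * emeasure lebesgue (\<phi> i ` A)" for z
      using L by (simp add: emeasure_restrict_space space_restrict_space)
    have "(\<integral>\<^sup>+ x. ennreal a \<partial>lebesgue_on (\<phi> i ` A)) \<le> emeasure \<nu> A"
      unfolding emeasure_nu[OF i A] by (rule nn_integral_mono_AE) (use ae in \<open>eventually_elim, auto intro: ennreal_leI\<close>)
    moreover have "emeasure \<nu> A \<le> (\<integral>\<^sup>+ x. ennreal b \<partial>lebesgue_on (\<phi> i ` A))"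
      unfolding emeasure_nu[OF i A] by (rule nn_integral_mono_AE) (use ae in \<open>eventually_elim, auto intro: ennreal_leI\<close>)
    ultimately show ?thesis unfolding const by simp
  qed
  show ?thesis using that[OF ab(1,2)] main by blast
qed

lemma U_sets_nu: "i < m \<Longrightarrow> U i \<in> sets \<nu>"
  by (rule openin_sets_nu[OF U_open])

lemma emeasure_chart_image_finite: "i < m \<Longrightarrow> emeasure lebesgue (\<phi> i ` A) < top" if "A \<subseteq> U i"
proof -
  assume i: "i < m"
  have "\<phi> i ` A \<subseteq> ball 0 1" using chart_image_norm_less[OF i] that by auto
  then have "emeasure lebesgue (\<phi> i ` A) \<le> emeasure lebesgue (ball (0 :: real ^ 'n) 1)"
    by (intro emeasure_mono sets_completionI_sets) (simp_all add: borel_open)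
  also have "\<dots> < top" by (subst emeasure_lebesgue_ball) simp_all
  finally show ?thesis .
qed

lemma emeasure_nu_finite: "emeasure \<nu> (space \<nu>) < top"
proof -
  obtain a b where ab: "0 < a" "0 < b"
    "\<And>i A. i < m \<Longrightarrow> A \<in> sets \<nu> \<Longrightarrow> A \<subseteq> U i \<Longrightarrow> ennreal a * emeasure lebesgue (\<phi> i ` A) \<le> emeasure \<nu> A"
    "\<And>i A. i < m \<Longrightarrow> A \<in> sets \<nu> \<Longrightarrow> A \<subseteq> U i \<Longrightarrow> emeasure \<nu> A \<le> ennreal b * emeasure lebesgue (\<phi> i ` A)"
    by (rule volume_bounds) (rule that)
  have "emeasure \<nu> (space \<nu>) = emeasure \<nu> (\<Union>i<m. U i)" using M_eq space_nu by simp
  also have "\<dots> \<le> (\<Sum>i<m. emeasure \<nu> (U i))"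
    using U_sets_nu by (intro emeasure_subadditive_finite) auto
  also have "\<dots> < top"
  proof -
    have "emeasure \<nu> (U i) < top" if i: "i < m" for i
    proof -
      have "emeasure \<nu> (U i) \<le> ennreal b * emeasure lebesgue (\<phi> i ` U i)" by (rule ab(4)[OF i U_sets_nu[OF i] order_refl])
      also have "\<dots> < top" using emeasure_chart_image_finite[OF order_refl i] by (simp add: ennreal_mult_less_top)
      finally show ?thesis .
    qed
    then show ?thesis by (simp add: less_top)
  qed
  finally show ?thesis .
qed

lemma openin_d_ball: "openin (top_of_set M) {y \<in> M. d x y < t}"
proof (rule openin_chartI)
  fix i y assume i: "i < m" and y: "y \<in> {y \<in> M. d x y < t}" and Ui: "y \<in> U i"
  obtain K where K: "1 \<le> K"
    "\<And>i x y. i < m \<Longrightarrow> x \<in> U i \<Longrightarrow> y \<in> U i \<Longrightarrow> d x y \<le> ennreal (K * dist (\<phi> i x) (\<phi> i y))"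
    "\<And>i x y. i < m \<Longrightarrow> x \<in> U i \<Longrightarrow> y \<in> U i \<Longrightarrow> ennreal (dist (\<phi> i x) (\<phi> i y)) \<le> ennreal K * d x y"
    by (rule bilipschitz_const) (rule that)
  have "d x y < t" using y by simp
  then obtain e where e: "0 < e" "d x y + ennreal e \<le> t"
  proof (cases "t = top")
    case True
    then show ?thesis using that[of 1] by simp
  next
    case False
    then obtain t' v where tv: "t = ennreal t'" "0 \<le> t'" "d x y = ennreal v" "0 \<le> v"
      using \<open>d x y < t\<close> by (cases t; cases "d x y") (auto simp: top_unique)
    then have "v < t'" using \<open>d x y < t\<close> by (simp add: ennreal_less_iff)
    then show ?thesis using that[of "t' - v"] tv by (simp add: ennreal_plus[symmetric] del: ennreal_plus)
  qed
  have "y' \<in> {y \<in> M. d x y < t}" if y': "y' \<in> U i" "dist (\<phi> i y) (\<phi> i y') < e / K" for y'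
  proof -
    have "K * dist (\<phi> i y) (\<phi> i y') < e" using y'(2) K(1) by (simp add: field_simps)
    then have le: "ennreal (K * dist (\<phi> i y) (\<phi> i y')) < ennreal e" by (rule ennreal_lessI[OF e(1)])
    have "d x y' \<le> d x y + d y y'" by (rule d_triangle)
    also have "\<dots> \<le> d x y + ennreal (K * dist (\<phi> i y) (\<phi> i y'))" by (intro add_left_mono K(2) i Ui y')
    also have "\<dots> < d x y + ennreal e"
    proof -
      have "d x y \<noteq> top" using \<open>d x y < t\<close> by auto
      then show ?thesis using le by (simp add: ennreal_add_left_cancel_less)
    qed
    also note e(2)
    finally show ?thesis using y'(1) U_subset[OF i] by auto
  qed
  then show "\<exists>\<eta>>0. \<forall>y'\<in>U i. dist (\<phi> i y) (\<phi> i y') < \<eta> \<longrightarrow> y' \<in> {y \<in> M. d x y < t}"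
    using e(1) K(1) by (intro exI[of _ "e / K"]) auto
qed auto

lemma openin_chart_ball: "i < m \<Longrightarrow> openin (top_of_set M) {y \<in> U i. dist v (\<phi> i y) < t}"
proof -
  assume i: "i < m"
  obtain \<psi> where \<psi>: "homeomorphism (U i) (\<phi> i ` U i) (\<phi> i) \<psi>" using chart_homeo[OF i] by blast
  have eq: "{y \<in> U i. dist v (\<phi> i y) < t} = U i \<inter> \<phi> i -` ball v t" by auto
  have "openin (top_of_set (U i)) {y \<in> U i. dist v (\<phi> i y) < t}"
    unfolding eq by (rule continuous_openin_preimage_gen[OF homeomorphism_cont1[OF \<psi>] open_ball])
  then show ?thesis by (rule openin_trans[OF _ U_open[OF i]])
qed

definition tdist :: "'a \<Rightarrow> 'a \<Rightarrow> real" where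
  "tdist x y = enn2real (min (d x y) 1)"

lemma ennreal_tdist: "ennreal (tdist x y) = min (d x y) 1"
  unfolding tdist_def by (rule ennreal_enn2real) (simp add: min_less_iff_disj)

lemma tdist_nonneg: "0 \<le> tdist x y" by (simp add: tdist_def)

lemma tdist_le_1: "tdist x y \<le> 1"
  using ennreal_tdist[of x y] by (metis ennreal_1 ennreal_le_iff min.cobounded2 zero_le_one)

lemma tdist_sym: "tdist x y = tdist y x" by (simp add: tdist_def d_sym)

lemma tdist_triangle: "tdist x z \<le> tdist x y + tdist y z"
proof -
  have "min (d x z) 1 \<le> min (d x y) 1 + min (d y z) 1"
    using d_triangle[of x z y] by (auto simp: min_def add_increasing add_increasing2)
  then have "ennreal (tdist x z) \<le> ennreal (tdist x y + tdist y z)"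
    by (simp add: ennreal_tdist tdist_nonneg)
  then show ?thesis by (subst (asm) ennreal_le_iff) (simp_all add: tdist_nonneg)
qed

lemma d_refl: "x \<in> M \<Longrightarrow> d x x = 0"
proof -
  assume "x \<in> M"
  then obtain i where i: "i < m" "x \<in> U i" using M_eq by blast
  obtain K where K: "1 \<le> K" "\<And>i x y. i < m \<Longrightarrow> x \<in> U i \<Longrightarrow> y \<in> U i \<Longrightarrow> d x y \<le> ennreal (K * dist (\<phi> i x) (\<phi> i y))"
    "\<And>i x y. i < m \<Longrightarrow> x \<in> U i \<Longrightarrow> y \<in> U i \<Longrightarrow> ennreal (dist (\<phi> i x) (\<phi> i y)) \<le> ennreal K * d x y"
    by (rule bilipschitz_const) (rule that)
  from K(2)[OF i i(2)] show ?thesis by simp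
qed

lemma countable_dense:
  obtains Q where "countable Q" "Q \<subseteq> M"
    "\<And>i x e. i < m \<Longrightarrow> x \<in> U i \<Longrightarrow> 0 < e \<Longrightarrow> \<exists>q\<in>Q \<inter> U i. dist (\<phi> i x) (\<phi> i q) < e"
proof -
  have "\<exists>T. countable T \<and> T \<subseteq> \<phi> i ` U i \<and> \<phi> i ` U i \<subseteq> closure T" for i
    using separable[of "\<phi> i ` U i"] by metis
  then obtain T where T: "\<And>i. countable (T i)" "\<And>i. T i \<subseteq> \<phi> i ` U i" "\<And>i. \<phi> i ` U i \<subseteq> closure (T i)" by metis
  have "\<exists>S. countable S \<and> S \<subseteq> U i \<and> T i = \<phi> i ` S" for i
    using countable_subset_image[of "T i" "\<phi> i" "U i"] T(1,2) by auto
  then obtain S where S: "\<And>i. countable (S i)" "\<And>i. S i \<subseteq> U i" "\<And>i. T i = \<phi> i ` S i" by metis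
  show ?thesis
  proof (rule that[of "\<Union>i<m. S i"])
    show "countable (\<Union>i<m. S i)" using S(1) by auto
    show "(\<Union>i<m. S i) \<subseteq> M" using S(2) M_eq by blast
    fix i x and e :: real assume i: "i < m" "x \<in> U i" "0 < e"
    then have "\<phi> i x \<in> closure (\<phi> i ` S i)" using T(3)[of i] S(3)[of i] by auto
    then obtain q where "q \<in> S i" "dist (\<phi> i q) (\<phi> i x) < e" using i(3) unfolding closure_approachable by blast
    then show "\<exists>q\<in>(\<Union>i<m. S i) \<inter> U i. dist (\<phi> i x) (\<phi> i q) < e"
      using S(2)[of i] i(1) by (intro bexI[of _ q]) (auto simp: dist_commute)
  qed
qed

lemma d_measurable_left: "(\<lambda>x. d q x) \<in> borel_measurable \<nu>"
proof (rule borel_measurableI_less)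
  fix t
  have "{x \<in> space \<nu>. d q x < t} = {y \<in> M. d q y < t}" by (simp add: space_nu)
  then show "{x \<in> space \<nu>. d q x < t} \<in> sets \<nu>" using openin_sets_nu[OF openin_d_ball] by simp
qed

text \<open>
  For a countable dense set \<open>Q\<close>, the distance of \<open>x\<close> and \<open>y\<close> is the infimum of \<open>d q x + d q y\<close> over \<open>q\<close> in \<open>Q\<close>,
  and distances to a fixed point are measurable since geodesic balls are open.
\<close>

lemma tdist_measurable: "(\<lambda>(x, y). tdist x y) \<in> borel_measurable (\<nu> \<Otimes>\<^sub>M \<nu>)"
proof -
  obtain Q where Q: "countable Q" "Q \<subseteq> M"
    "\<And>i x e. i < m \<Longrightarrow> x \<in> U i \<Longrightarrow> 0 < e \<Longrightarrow> \<exists>q\<in>Q \<inter> U i. dist (\<phi> i x) (\<phi> i q) < e"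
    by (rule countable_dense) (rule that)
  obtain K where K: "1 \<le> K"
    "\<And>i x y. i < m \<Longrightarrow> x \<in> U i \<Longrightarrow> y \<in> U i \<Longrightarrow> d x y \<le> ennreal (K * dist (\<phi> i x) (\<phi> i y))"
    "\<And>i x y. i < m \<Longrightarrow> x \<in> U i \<Longrightarrow> y \<in> U i \<Longrightarrow> ennreal (dist (\<phi> i x) (\<phi> i y)) \<le> ennreal K * d x y"
    by (rule bilipschitz_const) (rule that)
  have d_INF: "d x y = (INF q\<in>Q. d q x + d q y)" if x: "x \<in> M" for x y
  proof (rule antisym)
    show "d x y \<le> (INF q\<in>Q. d q x + d q y)"
    proof (rule INF_greatest)
      fix q show "d x y \<le> d q x + d q y" using d_triangle[of x y q] by (simp add: d_sym)
    qed
    show "(INF q\<in>Q. d q x + d q y) \<le> d x y"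
    proof (rule ennreal_le_epsilon)
      fix e :: real assume e: "0 < e"
      obtain i where i: "i < m" "x \<in> U i" using x M_eq by blast
      have "0 < e / (2 * K)" using e K(1) by simp
      then obtain q where q: "q \<in> Q" "q \<in> U i" "dist (\<phi> i x) (\<phi> i q) < e / (2 * K)" using Q(3)[OF i] by blast
      have "K * dist (\<phi> i q) (\<phi> i x) \<le> e / 2" using q(3) K(1) by (simp add: dist_commute field_simps)
      then have dq: "d q x \<le> ennreal (e / 2)" using K(2)[OF i(1) q(2) i(2)] by (meson ennreal_leI order_trans)
      have "(INF q\<in>Q. d q x + d q y) \<le> d q x + d q y" by (rule INF_lower[OF q(1)])
      also have "\<dots> \<le> d q x + (d q x + d x y)" by (intro add_left_mono d_triangle)
      also have "\<dots> \<le> ennreal (e / 2) + (ennreal (e / 2) + d x y)" by (intro add_mono dq order_refl)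
      also have "\<dots> = d x y + (ennreal (e / 2) + ennreal (e / 2))" by (simp only: add_ac)
      also have "ennreal (e / 2) + ennreal (e / 2) = ennreal e" using e by (simp add: ennreal_plus[symmetric] del: ennreal_plus)
      finally show "(INF q\<in>Q. d q x + d q y) \<le> d x y + ennreal e" .
    qed
  qed
  have m1: "(\<lambda>z. d q (fst z)) \<in> borel_measurable (\<nu> \<Otimes>\<^sub>M \<nu>)" for q by (rule measurable_compose[OF measurable_fst d_measurable_left])
  have m2: "(\<lambda>z. d q (snd z)) \<in> borel_measurable (\<nu> \<Otimes>\<^sub>M \<nu>)" for q by (rule measurable_compose[OF measurable_snd d_measurable_left])
  have INFm: "(\<lambda>z. INF q\<in>Q. d q (fst z) + d q (snd z)) \<in> borel_measurable (\<nu> \<Otimes>\<^sub>M \<nu>)"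
    by (intro borel_measurable_INF Q(1) borel_measurable_add m1 m2)
  have "(\<lambda>z. d (fst z) (snd z)) \<in> borel_measurable (\<nu> \<Otimes>\<^sub>M \<nu>)"
  proof (subst measurable_cong[where g = "\<lambda>z. INF q\<in>Q. d q (fst z) + d q (snd z)"])
    fix z assume "z \<in> space (\<nu> \<Otimes>\<^sub>M \<nu>)"
    then show "d (fst z) (snd z) = (INF q\<in>Q. d q (fst z) + d q (snd z))"
      by (intro d_INF) (auto simp: space_pair_measure space_nu)
  qed (rule INFm)
  then have "(\<lambda>z. enn2real (min (d (fst z) (snd z)) 1)) \<in> borel_measurable (\<nu> \<Otimes>\<^sub>M \<nu>)" by measurable
  then show ?thesis by (simp only: tdist_def split_beta')
qed

lemma tdist_less_iff: "0 < t \<Longrightarrow> t \<le> 1 \<Longrightarrow> tdist x y < t \<longleftrightarrow> d x y < ennreal t"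
proof -
  assume t: "0 < t" "t \<le> 1"
  have "tdist x y < t \<longleftrightarrow> ennreal (tdist x y) < ennreal t"
    using t tdist_nonneg[of x y] by (simp add: ennreal_less_iff)
  also have "\<dots> \<longleftrightarrow> d x y < ennreal t"
  proof -
    have "\<not> 1 < ennreal t" using t(2) by (simp add: not_less)
    then show ?thesis unfolding ennreal_tdist min_less_iff_disj by blast
  qed
  finally show ?thesis .
qed

text \<open>
  Around a point of a chart core, a small geodesic ball lies in the chart, between two Euclidean balls
  that are intersected with the chart image.
\<close>

lemma tdist_ball_bounds:
  obtains r0 c C :: real where "0 < r0" "0 < c" "0 < C"
    "\<And>x t. x \<in> M \<Longrightarrow> 0 < t \<Longrightarrow> t \<le> r0 \<Longrightarrow> ennreal (c * t ^ CARD('n)) \<le> emeasure \<nu> {y \<in> M. tdist x y < t}"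
    "\<And>x t. x \<in> M \<Longrightarrow> 0 < t \<Longrightarrow> t \<le> r0 \<Longrightarrow> emeasure \<nu> {y \<in> M. tdist x y < t} \<le> ennreal (C * t ^ CARD('n))"
proof -
  obtain K r0 r where *: "1 \<le> K" "0 < r0" "r0 \<le> 1" "0 < r" "r < 1"
    "\<And>x. x \<in> M \<Longrightarrow> \<exists>i<m. x \<in> U i \<and> norm (\<phi> i x) \<le> r"
    "\<And>i x y. i < m \<Longrightarrow> x \<in> U i \<Longrightarrow> y \<in> U i \<Longrightarrow> d x y \<le> ennreal (K * dist (\<phi> i x) (\<phi> i y))"
    "\<And>i x y. i < m \<Longrightarrow> x \<in> U i \<Longrightarrow> y \<in> U i \<Longrightarrow> ennreal (dist (\<phi> i x) (\<phi> i y)) \<le> ennreal K * d x y"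
    "\<And>i x y. i < m \<Longrightarrow> x \<in> U i \<Longrightarrow> norm (\<phi> i x) \<le> r \<Longrightarrow> d x y < ennreal r0 \<Longrightarrow> y \<in> U i"
    by (rule local_chart_balls) (rule that)
  obtain a b where ab: "0 < a" "0 < b"
    "\<And>i A. i < m \<Longrightarrow> A \<in> sets \<nu> \<Longrightarrow> A \<subseteq> U i \<Longrightarrow> ennreal a * emeasure lebesgue (\<phi> i ` A) \<le> emeasure \<nu> A"
    "\<And>i A. i < m \<Longrightarrow> A \<in> sets \<nu> \<Longrightarrow> A \<subseteq> U i \<Longrightarrow> emeasure \<nu> A \<le> ennreal b * emeasure lebesgue (\<phi> i ` A)"
    by (rule volume_bounds) (rule that)
  let ?v = "unit_ball_vol (CARD('n))" and ?n = "CARD('n)"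
  have ballm: "ball w q \<in> sets lebesgue" for w :: "real ^ 'n" and q
    by (intro sets_completionI_sets) (simp add: borel_open)
  have main: "ennreal (a * (?v * (1 / (8 * K)) ^ ?n) * t ^ ?n) \<le> emeasure \<nu> {y \<in> M. tdist x y < t} \<and>
      emeasure \<nu> {y \<in> M. tdist x y < t} \<le> ennreal (b * (?v * (2 * K) ^ ?n) * t ^ ?n)"
    if x: "x \<in> M" and t: "0 < t" "t \<le> r0" for x t
  proof -
    obtain i where i: "i < m" "x \<in> U i" "norm (\<phi> i x) \<le> r" using *(6)[OF x] by blast
    have B: "{y \<in> M. tdist x y < t} = {y \<in> M. d x y < ennreal t}"
      using t *(3) by (auto simp: tdist_less_iff)
    let ?B = "{y \<in> M. d x y < ennreal t}" and ?S = "{y \<in> U i. dist (\<phi> i x) (\<phi> i y) < t / K}"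
    have BU: "?B \<subseteq> U i"
    proof
      fix y assume "y \<in> ?B"
      then have "d x y < ennreal r0" using ennreal_leI[OF t(2)] by (auto intro: less_le_trans)
      then show "y \<in> U i" by (rule *(9)[OF i])
    qed
    have Bm: "?B \<in> sets \<nu>" by (rule openin_sets_nu[OF openin_d_ball])
    have Sm: "?S \<in> sets \<nu>" by (rule openin_sets_nu[OF openin_chart_ball[OF i(1)]])
    have SB: "?S \<subseteq> ?B"
    proof
      fix y assume y: "y \<in> ?S"
      then have "K * dist (\<phi> i x) (\<phi> i y) < t" using *(1) by (simp add: field_simps)
      then have "ennreal (K * dist (\<phi> i x) (\<phi> i y)) < ennreal t" by (rule ennreal_lessI[OF t(1)])
      moreover have "d x y \<le> ennreal (K * dist (\<phi> i x) (\<phi> i y))" using y by (intro *(7) i) auto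
      ultimately show "y \<in> ?B" using y U_subset[OF i(1)] by (auto intro: le_less_trans)
    qed
    have "\<phi> i ` ?B \<subseteq> ball (\<phi> i x) (2 * K * t)"
    proof (rule image_subsetI)
      fix y assume y: "y \<in> ?B"
      then have "ennreal (dist (\<phi> i x) (\<phi> i y)) \<le> ennreal K * d x y" using BU by (intro *(8) i) auto
      also have "\<dots> \<le> ennreal K * ennreal t" using y by (intro mult_left_mono) auto
      also have "\<dots> = ennreal (K * t)" using *(1) t by (simp add: ennreal_mult)
      finally have "dist (\<phi> i x) (\<phi> i y) \<le> K * t" using *(1) t by (subst (asm) ennreal_le_iff) auto
      moreover have "0 < K * t" using *(1) t by simp
      ultimately show "\<phi> i y \<in> ball (\<phi> i x) (2 * K * t)" by (simp only: mem_ball)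
    qed
    then have "emeasure lebesgue (\<phi> i ` ?B) \<le> emeasure lebesgue (ball (\<phi> i x) (2 * K * t))"
      by (intro emeasure_mono ballm)
    also have "\<dots> = ennreal (?v * (2 * K) ^ ?n * t ^ ?n)"
      using *(1) t by (subst emeasure_lebesgue_ball) (auto simp: power_mult_distrib mult.assoc)
    finally have "emeasure lebesgue (\<phi> i ` ?B) \<le> \<dots>" .
    then have "ennreal b * emeasure lebesgue (\<phi> i ` ?B) \<le> ennreal b * ennreal (?v * (2 * K) ^ ?n * t ^ ?n)"
      by (intro mult_left_mono) auto
    also have "\<dots> = ennreal (b * (?v * (2 * K) ^ ?n) * t ^ ?n)"
      using ab(2) *(1) t by (subst ennreal_mult[symmetric]) (auto simp: mult.assoc)
    finally have up: "emeasure \<nu> ?B \<le> \<dots>" using ab(4)[OF i(1) Bm BU] by (rule order.trans[rotated])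
    have tK: "0 < t / K" "t / K \<le> 1" using t *(1,3) by (auto simp: field_simps)
    obtain w where w: "ball w (t / K / 8) \<subseteq> \<phi> i ` U i \<inter> ball (\<phi> i x) (t / K)"
      using chart_image_interior_ball[OF chart_V[OF i(1)] imageI[OF i(2)] tK] by blast
    have "\<phi> i ` U i \<inter> ball (\<phi> i x) (t / K) \<subseteq> \<phi> i ` ?S" by auto
    with w have wS: "ball w (t / K / 8) \<subseteq> \<phi> i ` ?S" by blast
    have SL: "\<phi> i ` ?S \<in> sets lebesgue"
    proof -
      have "\<phi> i ` (?S \<inter> U i) \<in> sets lebesgue" using Sm i(1) unfolding sets_nu by blast
      moreover have "?S \<inter> U i = ?S" by blast
      ultimately show ?thesis by simp
    qed
    have "ennreal (a * (?v * (1 / (8 * K)) ^ ?n) * t ^ ?n) = ennreal a * ennreal (?v * (t / K / 8) ^ ?n)"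
      using ab(1) *(1) t by (subst ennreal_mult[symmetric]) (auto simp: power_mult_distrib power_divide mult_ac)
    also have "\<dots> = ennreal a * emeasure lebesgue (ball w (t / K / 8))"
      using tK by (subst emeasure_lebesgue_ball) auto
    also have "\<dots> \<le> ennreal a * emeasure lebesgue (\<phi> i ` ?S)"
      by (intro mult_left_mono emeasure_mono wS SL) simp
    also have "\<dots> \<le> emeasure \<nu> ?S" by (rule ab(3)[OF i(1) Sm]) blast
    also have "\<dots> \<le> emeasure \<nu> ?B" by (rule emeasure_mono[OF SB Bm])
    finally show ?thesis using up by (simp only: B)
  qed
  show ?thesis
  proof (rule that[OF *(2)])
    show "0 < a * (?v * (1 / (8 * K)) ^ ?n)" "0 < b * (?v * (2 * K) ^ ?n)" using ab *(1) by simp_all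
  qed (use main in blast)+
qed

lemma small_cover:
  obtains F where "finite F" "F \<subseteq> sets \<nu>" "space \<nu> \<subseteq> \<Union> F" "\<And>E x y. E \<in> F \<Longrightarrow> x \<in> E \<Longrightarrow> y \<in> E \<Longrightarrow> d x y < 1"
proof -
  obtain K where K: "1 \<le> K"
    "\<And>i x y. i < m \<Longrightarrow> x \<in> U i \<Longrightarrow> y \<in> U i \<Longrightarrow> d x y \<le> ennreal (K * dist (\<phi> i x) (\<phi> i y))"
    "\<And>i x y. i < m \<Longrightarrow> x \<in> U i \<Longrightarrow> y \<in> U i \<Longrightarrow> ennreal (dist (\<phi> i x) (\<phi> i y)) \<le> ennreal K * d x y"
    by (rule bilipschitz_const) (rule that)
  let ?E = "\<lambda>q. {y \<in> U (fst q). dist (snd q) (\<phi> (fst q) y) < 1 / (4 * K)}"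
  let ?C = "?E ` ({..<m} \<times> UNIV)"
  have "\<forall>c\<in>?C. openin (top_of_set M) c" by (auto intro: openin_chart_ball)
  moreover have "M \<subseteq> \<Union> ?C"
  proof
    fix x assume "x \<in> M"
    then obtain i where i: "i < m" "x \<in> U i" using M_eq by blast
    then have "x \<in> ?E (i, \<phi> i x)" using K(1) by simp
    moreover have "(i, \<phi> i x) \<in> {..<m} \<times> UNIV" using i by simp
    ultimately show "x \<in> \<Union> ?C" by blast
  qed
  ultimately obtain F where F: "F \<subseteq> ?C" "finite F" "M \<subseteq> \<Union> F"
    using compact_M unfolding compact_eq_openin_cover by meson
  show ?thesis
  proof (rule that[OF F(2)])
    show "F \<subseteq> sets \<nu>"
    proof
      fix c assume "c \<in> F"
      then have "openin (top_of_set M) c" using F(1) \<open>\<forall>c\<in>?C. openin (top_of_set M) c\<close> by blast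
      then show "c \<in> sets \<nu>" by (rule openin_sets_nu)
    qed
    show "space \<nu> \<subseteq> \<Union> F" using F(3) by (simp add: space_nu)
    fix E x y assume E: "E \<in> F" and xy: "x \<in> E" "y \<in> E"
    obtain q where q: "q \<in> {..<m} \<times> UNIV" "E = ?E q" using E F(1) by blast
    obtain i v where iv: "q = (i, v)" by (cases q)
    have i: "i < m" and x: "x \<in> U i" "dist v (\<phi> i x) < 1 / (4 * K)" and y: "y \<in> U i" "dist v (\<phi> i y) < 1 / (4 * K)"
      using q xy by (auto simp: iv)
    have "dist (\<phi> i x) (\<phi> i y) \<le> dist v (\<phi> i x) + dist v (\<phi> i y)" by (metis dist_commute dist_triangle)
    then have "dist (\<phi> i x) (\<phi> i y) < 1 / (4 * K) + 1 / (4 * K)" using x y by linarith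
    also have "\<dots> = (1 / K) * (1 / 2)" by (simp add: field_simps)
    finally have "K * dist (\<phi> i x) (\<phi> i y) < 1" using K(1) by (simp add: field_simps)
    then have "ennreal (K * dist (\<phi> i x) (\<phi> i y)) < 1" by (simp add: ennreal_less_one_iff)
    with K(2)[OF i x(1) y(1)] show "d x y < 1" by (rule le_less_trans)
  qed
qed

text \<open>
  Truncation does not change the minimum spaces, nor the single fractional Sobolev spaces, which are
  minimum spaces for one exponent.
\<close>

theorem frac_sobolev_sum_eq_min_space_manifold:
  assumes l: "1 \<le> l" and s: "\<And>i. i \<in> {1..l} \<Longrightarrow> 0 < s i \<and> s i < 1" and p: "\<And>i. i \<in> {1..l} \<Longrightarrow> 1 \<le> p i"
  shows "frac_sobolev_sum \<nu> d CARD('n) l s p = frac_min_space \<nu> d CARD('n) l s p"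
proof -
  obtain r0 c0 C0 where ball: "0 < r0" "0 < c0" "0 < C0"
    "\<And>x t. x \<in> M \<Longrightarrow> 0 < t \<Longrightarrow> t \<le> r0 \<Longrightarrow> ennreal (c0 * t ^ CARD('n)) \<le> emeasure \<nu> {y \<in> M. tdist x y < t}"
    "\<And>x t. x \<in> M \<Longrightarrow> 0 < t \<Longrightarrow> t \<le> r0 \<Longrightarrow> emeasure \<nu> {y \<in> M. tdist x y < t} \<le> ennreal (C0 * t ^ CARD('n))"
    by (rule tdist_ball_bounds) (rule that)
  obtain c C where "regular_metric_measure \<nu> tdist CARD('n) c C"
  proof (rule bounded_regular_metric_measureI[of \<nu> tdist "CARD('n)" c0 C0 r0 1])
    show "emeasure \<nu> (space \<nu>) \<noteq> top" using emeasure_nu_finite by simp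
    show "tdist x x = 0" if "x \<in> space \<nu>" for x using that d_refl[of x] by (simp add: space_nu tdist_def)
  qed (use ball tdist_nonneg tdist_le_1 tdist_measurable in \<open>auto simp: space_nu intro: tdist_sym tdist_triangle\<close>)
  then interpret regular_metric_measure \<nu> tdist "CARD('n)" c C .
  obtain F where F: "finite F" "F \<subseteq> sets \<nu>" "space \<nu> \<subseteq> \<Union> F" "\<And>E x y. E \<in> F \<Longrightarrow> x \<in> E \<Longrightarrow> y \<in> E \<Longrightarrow> d x y < 1"
    by (rule small_cover) (rule that)
  have trunc: "frac_min_space \<nu> d CARD('n) k \<sigma> q = frac_min_space \<nu> rdist CARD('n) k \<sigma> q"
    if "1 \<le> k" "\<And>i. i \<in> {1..k} \<Longrightarrow> 0 < \<sigma> i" "\<And>i. i \<in> {1..k} \<Longrightarrow> 1 \<le> q i" for k \<sigma> q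
    by (rule frac_min_space_truncated_dist[OF that(1) that(2) that(3) ennreal_tdist emeasure_nu_finite F]) auto
  have "frac_sobolev \<nu> d CARD('n) (s i) (p i) = frac_sobolev \<nu> rdist CARD('n) (s i) (p i)" if "i \<in> {1..l}" for i
    unfolding frac_sobolev_eq_min_space using s[OF that] p[OF that] by (intro trunc) auto
  then have "frac_sobolev_sum \<nu> d CARD('n) l s p = frac_sobolev_sum \<nu> rdist CARD('n) l s p"
    unfolding frac_sobolev_sum_def by simp
  also have "\<dots> = frac_min_space \<nu> rdist CARD('n) l s p" by (rule frac_sobolev_sum_eq_min_space[OF l s p])
  also have "\<dots> = frac_min_space \<nu> d CARD('n) l s p" using s p by (intro trunc[symmetric] l) auto
  finally show ?thesis .
qed

end

section \<open>The three kinds of domains\<close>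

theorem theorem1p1:
  fixes l :: nat and s p :: "nat \<Rightarrow> real"
    and \<Omega> :: "(real ^ 'n) set"
    and M :: "'a::t2_space set" and m :: nat and U :: "nat \<Rightarrow> 'a set"
    and \<phi> :: "nat \<Rightarrow> 'a \<Rightarrow> real ^ 'n" and g :: "nat \<Rightarrow> real ^ 'n \<Rightarrow> real ^ 'n ^ 'n"
    and \<nu> :: "'a measure"
  assumes "1 \<le> l"
    and "\<And>i. i \<in> {1..l} \<Longrightarrow> 0 < s i \<and> s i < 1"
    and "\<And>i. i \<in> {1..l} \<Longrightarrow> 1 \<le> p i"
  shows
    "frac_sobolev_sum (lebesgue :: (real ^ 'n) measure) euclidean_dist CARD('n) l s p =
       frac_min_space lebesgue euclidean_dist CARD('n) l s p
     \<and>
     (bounded \<Omega> \<and> lipschitz_open_set \<Omega> \<longrightarrow>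
       frac_sobolev_sum (lebesgue_on \<Omega>) euclidean_dist CARD('n) l s p =
         frac_min_space (lebesgue_on \<Omega>) euclidean_dist CARD('n) l s p)
     \<and>
     (compact_lipschitz_manifold M m U \<phi> g \<and> riemannian_volume M m U \<phi> g \<nu> \<longrightarrow>
       frac_sobolev_sum \<nu> (geodesic_dist M m U \<phi> g) CARD('n) l s p =
         frac_min_space \<nu> (geodesic_dist M m U \<phi> g) CARD('n) l s p)"
proof (intro conjI impI)
  show "frac_sobolev_sum (lebesgue :: (real ^ 'n) measure) euclidean_dist CARD('n) l s p =
      frac_min_space lebesgue euclidean_dist CARD('n) l s p"
    by (rule frac_sobolev_sum_eq_min_space_euclidean[OF assms])
next
  assume \<Omega>: "bounded \<Omega> \<and> lipschitz_open_set \<Omega>"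
  then have "\<Omega> \<in> sets lebesgue"
    by (intro sets_completionI_sets) (simp add: lipschitz_open_set_def borel_open)
  with \<Omega> show "frac_sobolev_sum (lebesgue_on \<Omega>) euclidean_dist CARD('n) l s p =
      frac_min_space (lebesgue_on \<Omega>) euclidean_dist CARD('n) l s p"
    by (intro frac_sobolev_sum_eq_min_space_interior_balls lipschitz_open_set_interior_balls assms) auto
next
  assume "compact_lipschitz_manifold M m U \<phi> g \<and> riemannian_volume M m U \<phi> g \<nu>"
  then interpret measured_lipschitz_manifold M m U \<phi> g \<nu>
    by unfold_locales auto
  show "frac_sobolev_sum \<nu> (geodesic_dist M m U \<phi> g) CARD('n) l s p =
      frac_min_space \<nu> (geodesic_dist M m U \<phi> g) CARD('n) l s p"
    by (rule frac_sobolev_sum_eq_min_space_manifold[OF assms])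
qed

end
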